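(* Let $1<p<\infty$, $m\in\mathbb N$, and let $z\in B_{\ell_p}$ satisfy $\operatorname{supp}(z)\subset\{1,\dots,m\}$ and $r^p=\|z\|^p\in\mathbb Q$. Then there are at least $\mathfrak c$ strong boundary points in $\mathcal M_z$. More precisely, denoting $s=(1-r^p)^{1/p}$, for each $\xi\in\mathbb C$ with $|\xi|=1$ there exists a strong boundary point $\varphi_\xi$ in $w^*\text{-}ac\{\delta_{z+s\xi e_n}: n\in\mathbb N,\ n>m\}\cap\mathcal M_z$, so that all the $\varphi_\xi$ are different.
   Context: $\ell_p$ is the complex sequence space with canonical vectors $(e_n)$; $B_{\ell_p}$ and $\overline B_{\ell_p}$ are its open and closed unit balls. $\mathcal A_u(B_{\ell_p})$ is the Banach algebra, with the supremum norm, of all uniformly continuous holomorphic functions $f:B_{\ell_p}\to\mathbb C$; each such $f$ extends continuously to $\overline B_{\ell_p}$. $\mathcal M(\mathcal A_u(B_{\ell_p}))$ is its spectrum: the set of all non-zero multiplicative linear functionals, with the $w^*$-topology inherited from $\mathcal A_u(B_{\ell_p})'$. For $x\in\overline B_{\ell_p}$, $\delta_x(f)=f(x)$. The fiber over $z$ is $\mathcal M_z=\{\varphi\in\mathcal M(\mathcal A_u(B_{\ell_p})): \varphi(x')=x'(z)\text{ for all }x'\in \ell_p'\}$. For a net (in particular a sequence) $(\varphi_\alpha)_{\alpha\in I}$ in the spectrum, $w^*\text{-}ac\{\varphi_\alpha:\alpha\in I\}$ is the set of all its $w^*$-accumulation (cluster) points. An element $\varphi\in\mathcal M(\mathcal A_u(B_{\ell_p}))$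 is a strong boundary point if for every open neighborhood $U\subset\mathcal M(\mathcal A_u(B_{\ell_p}))$ of $\varphi$ there exists $f\in\mathcal A_u(B_{\ell_p})$ with $\|f\|=1=\varphi(f)$ and $|\psi(f)|<1$ for all $\psi\in\mathcal M(\mathcal A_u(B_{\ell_p}))\setminus U$. $\mathfrak c$ is the cardinality of the continuum. *)

theory Defs
  imports "HOL-Analysis.Analysis" "HOL-Library.Equipollence"
begin

text \<open>
  The exponent \<open>p\<close> is a real parameter, so \<open>\<ell>\<^sub>p\<close> is a carrier set rather than a type.
  Coordinates are indexed from 0: the coordinates \<open>1, \<dots>, m\<close> of the usual notation are \<open>{..<m}\<close>,
  and \<open>e\<^sub>n\<close> with \<open>n > m\<close> is \<open>lp_unit n\<close> with \<open>n \<ge> m\<close>.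
\<close>

definition lp :: "real \<Rightarrow> (nat \<Rightarrow> complex) set" where
  "lp p = {x. summable (\<lambda>k. norm (x k) powr p)}"

definition lp_norm :: "real \<Rightarrow> (nat \<Rightarrow> complex) \<Rightarrow> real" where
  "lp_norm p x = (\<Sum>k. norm (x k) powr p) powr (1 / p)"

definition lp_dist :: "real \<Rightarrow> (nat \<Rightarrow> complex) \<Rightarrow> (nat \<Rightarrow> complex) \<Rightarrow> real" where
  "lp_dist p x y = lp_norm p (\<lambda>k. x k - y k)"

definition lp_topology :: "real \<Rightarrow> (nat \<Rightarrow> complex) topology" where
  "lp_topology p = Metric_space.mtopology (lp p) (lp_dist p)"

definition lp_unit :: "nat \<Rightarrow> nat \<Rightarrow> complex" where
  "lp_unit n = (\<lambda>k. if k = n then 1 else 0)"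

definition lp_ball :: "real \<Rightarrow> (nat \<Rightarrow> complex) set" where
  "lp_ball p = {x \<in> lp p. lp_norm p x < 1}"

definition lp_dual :: "real \<Rightarrow> ((nat \<Rightarrow> complex) \<Rightarrow> complex) set" where
  "lp_dual p = {L.
     (\<forall>x\<in>lp p. \<forall>y\<in>lp p. L (\<lambda>k. x k + y k) = L x + L y) \<and>
     (\<forall>c. \<forall>x\<in>lp p. L (\<lambda>k. c * x k) = c * L x) \<and>
     (\<exists>C. \<forall>x\<in>lp p. norm (L x) \<le> C * lp_norm p x)}"

text \<open>Holomorphy on the open ball is complex Frechet differentiability at each of its points.\<close>

definition lp_has_frechet_derivative ::
  "real \<Rightarrow> ((nat \<Rightarrow> complex) \<Rightarrow> complex) \<Rightarrow> ((nat \<Rightarrow> complex) \<Rightarrow> complex) \<Rightarrow> (nat \<Rightarrow> complex) \<Rightarrow> bool" where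
  "lp_has_frechet_derivative p f L x \<longleftrightarrow> L \<in> lp_dual p \<and>
     (\<forall>\<epsilon>>0. \<exists>\<delta>>0. \<forall>y\<in>lp_ball p. lp_dist p y x < \<delta> \<longrightarrow>
        norm (f y - f x - L (\<lambda>k. y k - x k)) \<le> \<epsilon> * lp_dist p y x)"

definition lp_holomorphic :: "real \<Rightarrow> ((nat \<Rightarrow> complex) \<Rightarrow> complex) \<Rightarrow> bool" where
  "lp_holomorphic p f \<longleftrightarrow> (\<forall>x\<in>lp_ball p. \<exists>L. lp_has_frechet_derivative p f L x)"

definition lp_uniformly_continuous :: "real \<Rightarrow> ((nat \<Rightarrow> complex) \<Rightarrow> complex) \<Rightarrow> bool" where
  "lp_uniformly_continuous p f \<longleftrightarrow>
     (\<forall>\<epsilon>>0. \<exists>\<delta>>0. \<forall>x\<in>lp_ball p. \<forall>y\<in>lp_ball p. lp_dist p x y < \<delta> \<longrightarrow> norm (f x - f y) < \<epsilon>)"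

text \<open>
  Functions on the ball are represented extensionally, so that equality in the algebra is equality
  of HOL functions; the operations of the algebra are the restricted pointwise ones.
\<close>

definition Au :: "real \<Rightarrow> ((nat \<Rightarrow> complex) \<Rightarrow> complex) set" where
  "Au p = {f \<in> extensional (lp_ball p). lp_uniformly_continuous p f \<and> lp_holomorphic p f}"

definition Au_norm :: "real \<Rightarrow> ((nat \<Rightarrow> complex) \<Rightarrow> complex) \<Rightarrow> real" where
  "Au_norm p f = (SUP x\<in>lp_ball p. norm (f x))"

text \<open>Functionals on the algebra are likewise extensional.\<close>

definition spectrum :: "real \<Rightarrow> (((nat \<Rightarrow> complex) \<Rightarrow> complex) \<Rightarrow> complex) set" where
  "spectrum p = {\<phi> \<in> extensional (Au p).
     (\<forall>f\<in>Au p. \<forall>g\<in>Au p. \<phi> (\<lambda>x\<in>lp_ball p. f x + g x) = \<phi> f + \<phi> g) \<and>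
     (\<forall>c. \<forall>f\<in>Au p. \<phi> (\<lambda>x\<in>lp_ball p. c * f x) = c * \<phi> f) \<and>
     (\<forall>f\<in>Au p. \<forall>g\<in>Au p. \<phi> (\<lambda>x\<in>lp_ball p. f x * g x) = \<phi> f * \<phi> g) \<and>
     (\<exists>f\<in>Au p. \<phi> f \<noteq> 0)}"

text \<open>The weak-star topology is the topology of pointwise convergence on the algebra.\<close>

definition spectrum_topology ::
  "real \<Rightarrow> (((nat \<Rightarrow> complex) \<Rightarrow> complex) \<Rightarrow> complex) topology" where
  "spectrum_topology p = subtopology (product_topology (\<lambda>_. euclidean) (Au p)) (spectrum p)"

text \<open>
  For \<open>x\<close> in the closed unit ball, \<open>delta p x f\<close> is the value at \<open>x\<close> of the continuous extension
  of \<open>f\<close>, i.e. the limit of \<open>f\<close> at \<open>x\<close> from within the open ball.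
\<close>

definition delta :: "real \<Rightarrow> (nat \<Rightarrow> complex) \<Rightarrow> ((nat \<Rightarrow> complex) \<Rightarrow> complex) \<Rightarrow> complex" where
  "delta p x = (\<lambda>f\<in>Au p. Lim (atin_within (lp_topology p) x (lp_ball p)) f)"

definition fiber :: "real \<Rightarrow> (nat \<Rightarrow> complex) \<Rightarrow> (((nat \<Rightarrow> complex) \<Rightarrow> complex) \<Rightarrow> complex) set" where
  "fiber p z = {\<phi> \<in> spectrum p. \<forall>L\<in>lp_dual p. \<phi> (restrict L (lp_ball p)) = L z}"

definition wstar_ac ::
  "real \<Rightarrow> 'i::order set \<Rightarrow> ('i \<Rightarrow> ((nat \<Rightarrow> complex) \<Rightarrow> complex) \<Rightarrow> complex) \<Rightarrow>
     (((nat \<Rightarrow> complex) \<Rightarrow> complex) \<Rightarrow> complex) set" where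
  "wstar_ac p I \<Phi> = {\<psi> \<in> spectrum p. \<forall>U. openin (spectrum_topology p) U \<and> \<psi> \<in> U \<longrightarrow>
     (\<forall>i\<in>I. \<exists>j\<in>I. i \<le> j \<and> \<Phi> j \<in> U)}"

definition strong_boundary_point ::
  "real \<Rightarrow> (((nat \<Rightarrow> complex) \<Rightarrow> complex) \<Rightarrow> complex) \<Rightarrow> bool" where
  "strong_boundary_point p \<phi> \<longleftrightarrow> \<phi> \<in> spectrum p \<and>
     (\<forall>U. openin (spectrum_topology p) U \<and> \<phi> \<in> U \<longrightarrow>
        (\<exists>f\<in>Au p. Au_norm p f = 1 \<and> \<phi> f = 1 \<and> (\<forall>\<psi>\<in>spectrum p - U. norm (\<psi> f) < 1)))"

end

theory Submission
  imports Defs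
begin

text \<open>
  Put \<open>w\<^sub>n = z + s \<xi> e\<^sub>n\<close>, fix a free ultrafilter on \<open>\<nat>\<close> and let \<open>\<phi>\<^sub>\<xi>\<close> be the limit of \<open>\<delta>\<close> at \<open>w\<^sub>n\<close> along
  it. Since \<open>e\<^sub>n\<close> is weakly null for \<open>p > 1\<close>, this is a point of the fiber over \<open>z\<close>. For a set \<open>A\<close> of
  indices \<open>\<ge> m\<close> and \<open>N \<ge> p + 2\<close> consider
  \<open>f x = exp (N / s powr p * (l x - r powr p)) * (\<Sum>k\<in>A. (x\<^sub>k / (s \<xi>))\<^sup>N)\<close>, where
  \<open>l x = (\<Sum>k<m. cnj z\<^sub>k * \<bar>z\<^sub>k\<bar> powr (p - 2) * x\<^sub>k)\<close>.
  With \<open>\<tau> = s\<^sup>-\<^sup>p \<Sum>\<^sub>k\<^sub>\<ge>\<^sub>m \<bar>x\<^sub>k\<bar>\<^sup>p\<close>, Young's inequality gives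
  \<open>\<bar>f x\<bar> \<le> (\<tau> exp (1 - \<tau>)) powr (N/p) \<le> 1\<close>, and \<open>f x\<close> can be close to 1 only if \<open>x\<close> is close to some
  \<open>w\<^sub>n\<close>, \<open>n \<in> A\<close>, up to an \<open>N\<close>-th root of unity in the coordinate \<open>n\<close>; averaging the functions for \<open>N\<close>
  and \<open>N + 1\<close> removes this ambiguity. Given a basic neighborhood of \<open>\<phi>\<^sub>\<xi>\<close> determined by finitely many
  \<open>g\<close>, let \<open>A\<close> be the set of those \<open>n\<close> for which \<open>g (w\<^sub>n)\<close> is close to \<open>\<phi>\<^sub>\<xi> g\<close>, and let \<open>h\<close> be half of 1
  plus the average. Every character \<open>\<psi>\<close> with \<open>\<bar>\<psi> h\<bar> = 1\<close> satisfies \<open>\<psi> h = 1\<close>, hence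
  \<open>\<psi> g - \<phi>\<^sub>\<xi> g = \<psi> (h\<^sup>2\<^sup>k (g - \<phi>\<^sub>\<xi> g))\<close>, and the function on the right is uniformly small for large \<open>k\<close>
  because \<open>g - \<phi>\<^sub>\<xi> g\<close> is small wherever \<open>h\<close> is close to 1. So \<open>\<psi>\<close> lies in the neighborhood.
\<close>

section \<open>The sequence space\<close>

lemma lp_norm_nonneg: "0 \<le> lp_norm p x"
  by (simp add: lp_norm_def)

lemma lp_norm_powr:
  assumes "x \<in> lp p" "0 < p"
  shows "lp_norm p x powr p = (\<Sum>k. norm (x k) powr p)"
proof -
  have "0 \<le> (\<Sum>k. norm (x k) powr p)"
    using assms by (intro suminf_nonneg) (auto simp: lp_def)
  then show ?thesis
    using assms by (simp add: lp_norm_def powr_powr)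
qed

lemma lp_norm_le_iff:
  assumes "x \<in> lp p" "0 < p" "0 \<le> c"
  shows "lp_norm p x \<le> c \<longleftrightarrow> (\<Sum>k. norm (x k) powr p) \<le> c powr p"
proof
  show "(\<Sum>k. norm (x k) powr p) \<le> c powr p" if "lp_norm p x \<le> c"
    using powr_mono2[of p "lp_norm p x" c] that assms lp_norm_nonneg[of p x]
    by (simp add: lp_norm_powr)
  show "lp_norm p x \<le> c" if "(\<Sum>k. norm (x k) powr p) \<le> c powr p"
  proof (rule ccontr)
    assume "\<not> lp_norm p x \<le> c"
    then have "c powr p < lp_norm p x powr p"
      using assms by (intro powr_less_mono2) auto
    then show False
      using that assms by (simp add: lp_norm_powr)
  qed
qed

lemma lp_norm_zero_vec: "lp_norm p (\<lambda>k. 0) = 0"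
  by (simp add: lp_norm_def)

lemma lp_norm_eq_0:
  assumes "x \<in> lp p" "0 < p"
  shows "lp_norm p x = 0 \<longleftrightarrow> x = (\<lambda>k. 0)"
proof
  assume "lp_norm p x = 0"
  then have "(\<Sum>k. norm (x k) powr p) = 0"
    using lp_norm_powr[OF assms] by simp
  then have "norm (x k) powr p = 0" for k
    using assms(1) suminf_eq_zero_iff[of "\<lambda>k. norm (x k) powr p"] by (auto simp: lp_def)
  then show "x = (\<lambda>k. 0)" by auto
qed (simp add: lp_norm_zero_vec)

lemma norm_le_lp_norm:
  assumes "x \<in> lp p" "0 < p"
  shows "norm (x k) \<le> lp_norm p x"
proof -
  have "norm (x k) powr p \<le> (\<Sum>k. norm (x k) powr p)"
    using assms sum_le_suminf[of "\<lambda>k. norm (x k) powr p" "{k}"] by (simp add: lp_def)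
  also have "\<dots> = lp_norm p x powr p"
    using assms by (simp add: lp_norm_powr)
  finally show ?thesis
    using assms(2) lp_norm_nonneg by (metis not_le norm_ge_zero powr_less_mono2)
qed

lemma lp_scale:
  assumes "x \<in> lp p"
  shows "(\<lambda>k. c * x k) \<in> lp p"
  using assms by (simp add: lp_def norm_mult powr_mult summable_mult)

lemma lp_norm_scale:
  assumes "x \<in> lp p" "0 < p"
  shows "lp_norm p (\<lambda>k. c * x k) = norm c * lp_norm p x"
  using assms
  by (simp add: lp_norm_def lp_def norm_mult powr_mult suminf_mult powr_powr suminf_nonneg)

section \<open>Convexity of powers and Minkowski's inequality\<close>

lemma convex_powr_ge0:
  fixes x y u v p :: real
  assumes "1 \<le> p" "0 \<le> x" "0 \<le> y" "0 \<le> u" "0 \<le> v" "u + v = 1"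
  shows "(u * x + v * y) powr p \<le> u * x powr p + v * y powr p"
proof -
  have pow: "a powr p \<le> a" if "0 \<le> a" "a \<le> 1" for a :: real
    using that assms(1) powr_mono'[of 1 p a] by (cases "a = 0") auto
  consider "x = 0" | "y = 0" | "0 < x" "0 < y" using assms by linarith
  then show ?thesis
  proof cases
    case 1
    then show ?thesis
      using assms pow[of v] by (simp add: powr_mult mult_right_mono)
  next
    case 2
    then show ?thesis
      using assms pow[of u] by (simp add: powr_mult mult_right_mono)
  next
    case 3
    have u: "1 - v = u" using assms by simp
    show ?thesis
      using 3 convex_onD[OF powr_convex[OF assms(1)], of v x y] assms
      by (simp add: u)
  qed
qed

text \<open>Pointwise form of Minkowski's inequality: \<open>|x| + |y|\<close> is
  \<open>a + b\<close> times a convex combination of \<open>|x| / a\<close> and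
  \<open>|y| / b\<close>. With the two norms as \<open>a\<close> and \<open>b\<close>, the
  right-hand side sums to \<open>(a + b) powr p\<close>.\<close>

lemma norm_add_powr_le:
  fixes x y :: complex
  assumes "1 \<le> p" "0 < a" "0 < b"
  shows "norm (x + y) powr p
    \<le> (a + b) powr p * (a / (a + b) * (norm x / a) powr p + b / (a + b) * (norm y / b) powr p)"
proof -
  have "norm (x + y) \<le> (a + b) * (a / (a + b) * (norm x / a) + b / (a + b) * (norm y / b))"
    using assms norm_triangle_ineq[of x y]
    by (simp add: distrib_left[of "a + b"] add_pos_pos less_imp_neq[THEN not_sym])
  then have "norm (x + y) powr p
      \<le> ((a + b) * (a / (a + b) * (norm x / a) + b / (a + b) * (norm y / b))) powr p"
    using assms by (intro powr_mono2) auto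
  also have "\<dots> = (a + b) powr p * (a / (a + b) * (norm x / a) + b / (a + b) * (norm y / b)) powr p"
    using assms by (subst powr_mult) auto
  also have "\<dots> \<le> (a + b) powr p * (a / (a + b) * (norm x / a) powr p + b / (a + b) * (norm y / b) powr p)"
    using assms by (intro mult_left_mono convex_powr_ge0) (auto simp: add_divide_distrib[symmetric])
  finally show ?thesis .
qed

lemma lp_add:
  assumes "1 \<le> p" "x \<in> lp p" "y \<in> lp p"
  shows "(\<lambda>k. x k + y k) \<in> lp p"
proof -
  have "summable (\<lambda>k. (1 + 1) powr p * (1 / (1 + 1) * (norm (x k) / 1) powr p
      + 1 / (1 + 1) * (norm (y k) / 1) powr p))"
    using assms by (intro summable_mult summable_add) (auto simp: lp_def)
  then show ?thesis
    unfolding lp_def mem_Collect_eq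
    by (rule summable_comparison_test'[where N = 0])
       (use norm_add_powr_le[OF assms(1), of 1 1] in simp)
qed

lemma lp_norm_triangle:
  assumes p: "1 \<le> p" and x: "x \<in> lp p" and y: "y \<in> lp p"
  shows "lp_norm p (\<lambda>k. x k + y k) \<le> lp_norm p x + lp_norm p y"
\<comment> \<open>The normalization below divides by both norms, so zero vectors are treated
  apart.\<close>
proof (cases "lp_norm p x = 0 \<or> lp_norm p y = 0")
  case True
  then show ?thesis
    using lp_norm_eq_0[OF x] lp_norm_eq_0[OF y] p by (auto simp: lp_norm_nonneg)
next
  case False
  define a b where "a = lp_norm p x" and "b = lp_norm p y"
  have ab: "0 < a" "0 < b"
    using False lp_norm_nonneg[of p] unfolding a_def b_def by (metis less_eq_real_def)+
  have sa: "summable (\<lambda>k. (norm (x k) / a) powr p)" "(\<Sum>k. (norm (x k) / a) powr p) = 1"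
    using x p ab lp_norm_powr[OF x]
    by (auto simp: powr_divide lp_def a_def[symmetric] suminf_divide intro: summable_divide)
  have sb: "summable (\<lambda>k. (norm (y k) / b) powr p)" "(\<Sum>k. (norm (y k) / b) powr p) = 1"
    using y p ab lp_norm_powr[OF y]
    by (auto simp: powr_divide lp_def b_def[symmetric] suminf_divide intro: summable_divide)
  have s: "(\<lambda>k. (a + b) powr p * (a / (a + b) * (norm (x k) / a) powr p
      + b / (a + b) * (norm (y k) / b) powr p)) sums
      ((a + b) powr p * (a / (a + b) * 1 + b / (a + b) * 1))"
    using sa sb by (intro sums_mult sums_add) (auto simp: sums_iff)
  have "(\<Sum>k. norm (x k + y k) powr p) \<le> (a + b) powr p * (a / (a + b) * 1 + b / (a + b) * 1)"
    using lp_add[OF p x y] s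
    by (intro sums_le[OF norm_add_powr_le[OF p ab] summable_sums s]) (auto simp: lp_def)
  also have "\<dots> = (a + b) powr p"
    using ab by (simp add: add_divide_distrib[symmetric])
  finally show ?thesis
    using lp_norm_le_iff[OF lp_add[OF p x y], of "a + b"] p ab by (simp add: a_def b_def)
qed

lemma lp_uminus: "x \<in> lp p \<Longrightarrow> (\<lambda>k. - x k) \<in> lp p"
  by (simp add: lp_def)

lemma lp_diff:
  assumes "1 \<le> p" "x \<in> lp p" "y \<in> lp p"
  shows "(\<lambda>k. x k - y k) \<in> lp p"
  using lp_add[OF assms(1,2) lp_uminus[OF assms(3)]] by simp

lemma Metric_space_lp:
  assumes "1 \<le> p"
  shows "Metric_space (lp p) (lp_dist p)"
proof
  show "0 \<le> lp_dist p x y" for x y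
    by (simp add: lp_dist_def lp_norm_nonneg)
  show "lp_dist p x y = lp_dist p y x" for x y
    by (simp add: lp_dist_def lp_norm_def norm_minus_commute)
  show "lp_dist p x y = 0 \<longleftrightarrow> x = y" if "x \<in> lp p" "y \<in> lp p" for x y
    using lp_norm_eq_0[OF lp_diff[OF assms that]] assms by (auto simp: lp_dist_def fun_eq_iff)
  show "lp_dist p x z \<le> lp_dist p x y + lp_dist p y z"
    if "x \<in> lp p" "y \<in> lp p" "z \<in> lp p" for x y z
    using lp_norm_triangle[OF assms lp_diff[OF assms that(1,2)] lp_diff[OF assms that(2,3)]]
    by (simp add: lp_dist_def)
qed

lemma lp_ball_lp: "x \<in> lp_ball p \<Longrightarrow> x \<in> lp p"
  by (simp add: lp_ball_def)

lemma lp_zero: "(\<lambda>k. 0) \<in> lp p"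
  by (simp add: lp_def)

lemma lp_ball_zero: "(\<lambda>k. 0) \<in> lp_ball p"
  by (simp add: lp_ball_def lp_zero lp_norm_zero_vec)

lemma lp_ball_scale:
  assumes "x \<in> lp p" "lp_norm p x \<le> 1" "0 < p" "norm c < 1"
  shows "(\<lambda>k. c * x k) \<in> lp_ball p"
proof -
  have "norm c * lp_norm p x \<le> norm c"
    using assms(2) by (simp add: mult_left_le)
  then show ?thesis
    using assms by (simp add: lp_ball_def lp_scale lp_norm_scale)
qed

lemma lp_dist_scale:
  assumes "x \<in> lp p" "0 < p"
  shows "lp_dist p (\<lambda>k. a * x k) (\<lambda>k. b * x k) = norm (a - b) * lp_norm p x"
  using lp_norm_scale[OF assms, of "a - b"] by (simp add: lp_dist_def left_diff_distrib)

lemma lp_ball_suminf_le_1: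
  assumes "x \<in> lp_ball p" "0 < p"
  shows "(\<Sum>k. norm (x k) powr p) \<le> 1"
  using assms lp_norm_le_iff[of x p 1] by (simp add: lp_ball_def)

section \<open>The algebra of uniformly continuous holomorphic functions\<close>

lemma lp_dual_add:
  "L \<in> lp_dual p \<Longrightarrow> x \<in> lp p \<Longrightarrow> y \<in> lp p \<Longrightarrow> L (\<lambda>k. x k + y k) = L x + L y"
  by (simp add: lp_dual_def)

lemma lp_dual_scale:
  "L \<in> lp_dual p \<Longrightarrow> x \<in> lp p \<Longrightarrow> L (\<lambda>k. c * x k) = c * L x"
  by (simp add: lp_dual_def)

lemma norm_combo_le:
  fixes a b x y :: complex
  shows "norm (a * x + b * y) \<le> norm a * norm x + norm b * norm y"
  using norm_triangle_ineq[of "a * x" "b * y"] by (simp add: norm_mult)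

lemma lp_dual_combo:
  assumes "1 \<le> p" "L \<in> lp_dual p" "M \<in> lp_dual p"
  shows "(\<lambda>x. a * L x + b * M x) \<in> lp_dual p"
proof -
  obtain C D where C: "\<forall>x\<in>lp p. norm (L x) \<le> C * lp_norm p x"
    and D: "\<forall>x\<in>lp p. norm (M x) \<le> D * lp_norm p x"
    using assms by (auto simp: lp_dual_def)
  have "norm (a * L x + b * M x) \<le> (norm a * C + norm b * D) * lp_norm p x" if "x \<in> lp p" for x
  proof -
    have "norm (a * L x + b * M x) \<le> norm a * norm (L x) + norm b * norm (M x)"
      by (rule norm_combo_le)
    also have "\<dots> \<le> norm a * (C * lp_norm p x) + norm b * (D * lp_norm p x)"
      using C D that by (intro add_mono mult_left_mono) auto
    finally show ?thesis by (simp add: algebra_simps)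
  qed
  then have "\<exists>C. \<forall>x\<in>lp p. norm (a * L x + b * M x) \<le> C * lp_norm p x"
    by blast
  with assms(2,3) show ?thesis
    by (simp add: lp_dual_def algebra_simps)
qed

lemma lp_dual_bound:
  assumes "L \<in> lp_dual p"
  obtains C where "0 < C" "\<And>x. x \<in> lp p \<Longrightarrow> norm (L x) \<le> C * lp_norm p x"
proof -
  obtain C where C: "\<forall>x\<in>lp p. norm (L x) \<le> C * lp_norm p x"
    using assms by (auto simp: lp_dual_def)
  have "norm (L x) \<le> (\<bar>C\<bar> + 1) * lp_norm p x" if "x \<in> lp p" for x
  proof -
    have "C * lp_norm p x \<le> (\<bar>C\<bar> + 1) * lp_norm p x"
      by (intro mult_right_mono) (auto simp: lp_norm_nonneg)
    then show ?thesis using C that by fastforce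
  qed
  then show ?thesis using that[of "\<bar>C\<bar> + 1"] by simp
qed

lemma lp_dual_diff:
  assumes "1 \<le> p" "L \<in> lp_dual p" "x \<in> lp p" "y \<in> lp p"
  shows "L (\<lambda>k. x k - y k) = L x - L y"
proof -
  show ?thesis
    using lp_dual_add[OF assms(2) lp_diff[OF assms(1,3,4)] assms(4)] by simp
qed

lemma lp_frechet_cong:
  assumes "lp_has_frechet_derivative p f L x" "\<And>y. y \<in> lp_ball p \<Longrightarrow> f y = g y" "x \<in> lp_ball p"
  shows "lp_has_frechet_derivative p g L x"
  using assms unfolding lp_has_frechet_derivative_def by simp

lemma lp_frechet_combo:
  assumes p: "1 \<le> p" and f: "lp_has_frechet_derivative p f L x"
    and g: "lp_has_frechet_derivative p g M x"
  shows "lp_has_frechet_derivative p (\<lambda>y. a * f y + b * g y) (\<lambda>y. a * L y + b * M y) x"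
  unfolding lp_has_frechet_derivative_def
proof (intro conjI allI impI)
  show "(\<lambda>y. a * L y + b * M y) \<in> lp_dual p"
    using f g p by (intro lp_dual_combo) (auto simp: lp_has_frechet_derivative_def)
  fix \<epsilon> :: real assume "0 < \<epsilon>"
  define e where "e = \<epsilon> / (norm a + norm b + 1)"
  have pos: "0 < norm a + norm b + 1" by (simp add: add_nonneg_pos)
  then have e: "0 < e" using \<open>0 < \<epsilon>\<close> by (simp add: e_def)
  have le: "(norm a + norm b) * e \<le> \<epsilon>"
    using pos \<open>0 < \<epsilon>\<close> by (simp add: e_def field_simps)
  obtain d1 where d1: "0 < d1" "\<And>y. y \<in> lp_ball p \<Longrightarrow> lp_dist p y x < d1 \<Longrightarrow>
      norm (f y - f x - L (\<lambda>k. y k - x k)) \<le> e * lp_dist p y x"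
    using f e unfolding lp_has_frechet_derivative_def by blast
  obtain d2 where d2: "0 < d2" "\<And>y. y \<in> lp_ball p \<Longrightarrow> lp_dist p y x < d2 \<Longrightarrow>
      norm (g y - g x - M (\<lambda>k. y k - x k)) \<le> e * lp_dist p y x"
    using g e unfolding lp_has_frechet_derivative_def by blast
  show "\<exists>\<delta>>0. \<forall>y\<in>lp_ball p. lp_dist p y x < \<delta> \<longrightarrow>
      norm (a * f y + b * g y - (a * f x + b * g x)
        - (a * L (\<lambda>k. y k - x k) + b * M (\<lambda>k. y k - x k))) \<le> \<epsilon> * lp_dist p y x"
  proof (intro exI[of _ "min d1 d2"] conjI ballI impI)
    fix y assume y: "y \<in> lp_ball p" "lp_dist p y x < min d1 d2"
    have "norm (a * f y + b * g y - (a * f x + b * g x)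
        - (a * L (\<lambda>k. y k - x k) + b * M (\<lambda>k. y k - x k)))
      = norm (a * (f y - f x - L (\<lambda>k. y k - x k)) + b * (g y - g x - M (\<lambda>k. y k - x k)))"
      by (simp add: algebra_simps)
    also have "\<dots> \<le> norm a * norm (f y - f x - L (\<lambda>k. y k - x k))
        + norm b * norm (g y - g x - M (\<lambda>k. y k - x k))"
      by (rule norm_combo_le)
    also have "\<dots> \<le> norm a * (e * lp_dist p y x) + norm b * (e * lp_dist p y x)"
      using d1(2)[OF y(1)] d2(2)[OF y(1)] y(2) by (intro add_mono mult_left_mono) auto
    also have "\<dots> = ((norm a + norm b) * e) * lp_dist p y x"
      by (simp add: algebra_simps)
    also have "\<dots> \<le> \<epsilon> * lp_dist p y x"
      using le by (intro mult_right_mono) (auto simp: lp_dist_def lp_norm_nonneg)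
    finally show "norm (a * f y + b * g y - (a * f x + b * g x)
        - (a * L (\<lambda>k. y k - x k) + b * M (\<lambda>k. y k - x k))) \<le> \<epsilon> * lp_dist p y x" .
  qed (use d1 d2 in auto)
qed

lemma lp_frechet_compose:
  assumes p: "1 \<le> p" and x: "x \<in> lp_ball p" and f: "lp_has_frechet_derivative p f L x"
    and g: "(g has_field_derivative g') (at (f x))"
  shows "lp_has_frechet_derivative p (\<lambda>y. g (f y)) (\<lambda>y. g' * L y) x"
  unfolding lp_has_frechet_derivative_def
proof (intro conjI allI impI)
  have L: "L \<in> lp_dual p" using f by (auto simp: lp_has_frechet_derivative_def)
  show "(\<lambda>y. g' * L y) \<in> lp_dual p"
    using lp_dual_combo[OF p L L, of g' 0] by simp
  obtain C where C: "0 < C" "\<And>x. x \<in> lp p \<Longrightarrow> norm (L x) \<le> C * lp_norm p x"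
    using lp_dual_bound[OF L] by blast
  fix \<epsilon> :: real assume \<epsilon>: "0 < \<epsilon>"
  \<comment> \<open>The error splits into the remainder of \<open>g\<close>, at most
    \<open>e1\<close> times \<open>|f y - f x| \<le> (C + 1) * lp_dist p y x\<close>, and
    \<open>g'\<close> times the remainder of \<open>f\<close>; each gets half of
    \<open>\<epsilon>\<close>. The bound \<open>e2 \<le> 1\<close> is what yields the factor
    \<open>C + 1\<close>.\<close>
  define e1 where "e1 = \<epsilon> / (2 * (C + 1))"
  define e2 where "e2 = min 1 (\<epsilon> / (2 * (norm g' + 1)))"
  have e1: "0 < e1" using \<epsilon> C by (simp add: e1_def)
  have e2: "0 < e2" using \<epsilon> by (simp add: e2_def add_nonneg_pos)
  have e1_le: "e1 * (C + 1) = \<epsilon> / 2"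
    using nonzero_eq_divide_eq[THEN iffD1, OF _ e1_def] C(1) by auto
  have "e2 \<le> \<epsilon> / (2 * (norm g' + 1))" by (simp add: e2_def)
  then have "e2 * (2 * (norm g' + 1)) \<le> \<epsilon>"
    using add_nonneg_pos[OF norm_ge_zero zero_less_one, of g'] by (subst (asm) pos_le_divide_eq) auto
  then have e2_le: "norm g' * e2 \<le> \<epsilon> / 2"
    using e2 by (simp add: algebra_simps)
  have "(g has_derivative (*) g') (at (f x))"
    using g by (simp add: has_field_derivative_def)
  then obtain d0 where d0: "0 < d0" "\<And>w. norm (w - f x) < d0 \<Longrightarrow>
      norm (g w - g (f x) - g' * (w - f x)) \<le> e1 * norm (w - f x)"
    using e1 unfolding has_derivative_at_alt by blast
  obtain d1 where d1: "0 < d1" "\<And>y. y \<in> lp_ball p \<Longrightarrow> lp_dist p y x < d1 \<Longrightarrow>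
      norm (f y - f x - L (\<lambda>k. y k - x k)) \<le> e2 * lp_dist p y x"
    using f e2 unfolding lp_has_frechet_derivative_def by blast
  define d where "d = min d1 (d0 / (C + 1))"
  have d: "0 < d" using d0(1) d1(1) C by (simp add: d_def)
  show "\<exists>\<delta>>0. \<forall>y\<in>lp_ball p. lp_dist p y x < \<delta> \<longrightarrow>
      norm (g (f y) - g (f x) - g' * L (\<lambda>k. y k - x k)) \<le> \<epsilon> * lp_dist p y x"
  proof (intro exI[of _ d] conjI ballI impI d)
    fix y assume y: "y \<in> lp_ball p" "lp_dist p y x < d"
    have D0: "0 \<le> lp_dist p y x" by (simp add: lp_dist_def lp_norm_nonneg)
    have E: "norm (f y - f x - L (\<lambda>k. y k - x k)) \<le> e2 * lp_dist p y x"
      using d1(2)[OF y(1)] y(2) by (simp add: d_def)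
    have "norm (L (\<lambda>k. y k - x k)) \<le> C * lp_dist p y x"
      using C(2)[OF lp_diff[OF p lp_ball_lp[OF y(1)] lp_ball_lp[OF x]]] by (simp add: lp_dist_def)
    moreover have "e2 * lp_dist p y x \<le> lp_dist p y x"
      using mult_right_mono[of e2 1, OF _ D0] by (simp add: e2_def)
    moreover have "norm (f y - f x) \<le> norm (f y - f x - L (\<lambda>k. y k - x k)) + norm (L (\<lambda>k. y k - x k))"
      using norm_triangle_sub by (simp add: add.commute)
    ultimately have F: "norm (f y - f x) \<le> (C + 1) * lp_dist p y x"
      using E by (simp add: algebra_simps)
    also have "\<dots> < d0"
      using y(2) C(1) by (simp add: d_def field_simps)
    finally have "norm (g (f y) - g (f x) - g' * (f y - f x)) \<le> e1 * norm (f y - f x)"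
      by (rule d0(2))
    also have "\<dots> \<le> e1 * ((C + 1) * lp_dist p y x)"
      using F e1 by (intro mult_left_mono) auto
    also have "\<dots> = \<epsilon> / 2 * lp_dist p y x" unfolding mult.assoc[symmetric] e1_le ..
    finally have 1: "norm (g (f y) - g (f x) - g' * (f y - f x)) \<le> \<epsilon> / 2 * lp_dist p y x" .
    have "norm (g' * (f y - f x - L (\<lambda>k. y k - x k))) \<le> norm g' * (e2 * lp_dist p y x)"
      unfolding norm_mult using E by (intro mult_left_mono) auto
    also have "\<dots> \<le> \<epsilon> / 2 * lp_dist p y x"
      using mult_right_mono[OF e2_le D0] by (simp add: mult.assoc)
    finally have 2: "norm (g' * (f y - f x - L (\<lambda>k. y k - x k))) \<le> \<epsilon> / 2 * lp_dist p y x" .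
    have eq: "g (f y) - g (f x) - g' * L (\<lambda>k. y k - x k)
      = (g (f y) - g (f x) - g' * (f y - f x)) + g' * (f y - f x - L (\<lambda>k. y k - x k))"
      by (simp add: algebra_simps)
    show "norm (g (f y) - g (f x) - g' * L (\<lambda>k. y k - x k)) \<le> \<epsilon> * lp_dist p y x"
      unfolding eq by (rule norm_triangle_le) (use 1 2 in simp)
  qed
qed

section \<open>Closure properties of the algebra\<close>

lemma AuI:
  assumes "lp_uniformly_continuous p f" "lp_holomorphic p f"
  shows "restrict f (lp_ball p) \<in> Au p"
proof -
  \<comment> \<open>Differentiability tests only points of the ball, so restriction leaves the
    derivative unchanged.\<close>
  have "lp_holomorphic p (restrict f (lp_ball p))"
    unfolding lp_holomorphic_def
  proof
    fix x assume x: "x \<in> lp_ball p"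
    then obtain L where "lp_has_frechet_derivative p f L x"
      using assms(2) by (auto simp: lp_holomorphic_def)
    then have "lp_has_frechet_derivative p (restrict f (lp_ball p)) L x"
      by (rule lp_frechet_cong) (use x in auto)
    then show "\<exists>L. lp_has_frechet_derivative p (restrict f (lp_ball p)) L x" by blast
  qed
  then show ?thesis
    using assms(1) by (simp add: Au_def lp_uniformly_continuous_def)
qed

lemma Au_restrict: "f \<in> Au p \<Longrightarrow> restrict f (lp_ball p) = f"
  by (simp add: Au_def extensional_restrict)

lemma Au_uc: "f \<in> Au p \<Longrightarrow> lp_uniformly_continuous p f"
  by (simp add: Au_def)

lemma Au_ucE:
  assumes "f \<in> Au p" "0 < \<epsilon>"
  obtains \<delta> where "0 < \<delta>"
    "\<And>x y. x \<in> lp_ball p \<Longrightarrow> y \<in> lp_ball p \<Longrightarrow> lp_dist p x y < \<delta> \<Longrightarrow> norm (f x - f y) < \<epsilon>"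
  using Au_uc[OF assms(1)] assms(2) unfolding lp_uniformly_continuous_def by blast

text \<open>Walk from the centre to \<open>x\<close> along the segment in \<open>N\<close> steps
  shorter than \<open>\<delta>\<close>: each step changes \<open>f\<close> by less than 1, and
  \<open>N\<close> does not depend on \<open>x\<close>.\<close>

lemma Au_bounded:
  assumes p: "1 \<le> p" and f: "f \<in> Au p"
  obtains C where "0 < C" "\<And>x. x \<in> lp_ball p \<Longrightarrow> norm (f x) \<le> C"
proof -
  obtain \<delta> where \<delta>: "0 < \<delta>"
    "\<And>x y. x \<in> lp_ball p \<Longrightarrow> y \<in> lp_ball p \<Longrightarrow> lp_dist p x y < \<delta> \<Longrightarrow> norm (f x - f y) < 1"
    using Au_ucE[OF f zero_less_one] by blast
  obtain N :: nat where N: "0 < N" "inverse (of_nat N) < \<delta>"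
    using reals_Archimedean[OF \<delta>(1)] by (metis zero_less_Suc)
  have "norm (f x) \<le> norm (f (\<lambda>k. 0)) + of_nat N" if x: "x \<in> lp_ball p" for x
  proof -
    have xl: "x \<in> lp p" "lp_norm p x < 1" "0 < p" using x p by (auto simp: lp_ball_def)
    define y where "y i = (\<lambda>k. of_real (of_nat i / of_nat N) * x k)" for i
    have yb: "y i \<in> lp_ball p" if "i \<le> N" for i
    proof (cases "i = N")
      case True
      then have "y i = x" using N by (simp add: y_def)
      then show ?thesis using x by simp
    next
      case False
      then show ?thesis unfolding y_def
        using xl that N by (intro lp_ball_scale) (auto simp: norm_divide)
    qed
    have "norm (f (y i)) \<le> norm (f (\<lambda>k. 0)) + of_nat i" if "i \<le> N" for i
      using that
    proof (induction i)
      case 0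
      then show ?case by (simp add: y_def)
    next
      case (Suc i)
      have "norm (of_real (of_nat (Suc i) / of_nat N) - of_real (of_nat i / of_nat N) :: complex) = 1 / N"
        unfolding of_real_diff[symmetric] norm_of_real by (simp add: diff_divide_distrib[symmetric])
      then have "lp_dist p (y (Suc i)) (y i) = 1 / N * lp_norm p x"
        using xl unfolding y_def by (subst lp_dist_scale) auto
      also have "\<dots> \<le> 1 / N * 1" using xl by (intro mult_left_mono) auto
      also have "\<dots> < \<delta>" using N by (simp add: inverse_eq_divide)
      finally have "norm (f (y (Suc i)) - f (y i)) < 1"
        using \<delta>(2) yb Suc.prems by simp
      then show ?case
        using Suc norm_triangle_ineq2[of "f (y (Suc i))" "f (y i)"] by simp
    qed
    from this[of N] show ?thesis using N by (simp add: y_def)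
  qed
  moreover have "0 < norm (f (\<lambda>k. 0)) + of_nat N" using N by (simp add: add_nonneg_pos)
  ultimately show ?thesis using that by blast
qed

lemma Au_combo:
  assumes p: "1 \<le> p" and f: "f \<in> Au p" and g: "g \<in> Au p"
  shows "(\<lambda>x\<in>lp_ball p. a * f x + b * g x) \<in> Au p"
proof (rule AuI)
  show "lp_holomorphic p (\<lambda>x. a * f x + b * g x)"
    using f g lp_frechet_combo[OF p] unfolding Au_def lp_holomorphic_def by fast
  show "lp_uniformly_continuous p (\<lambda>x. a * f x + b * g x)"
    unfolding lp_uniformly_continuous_def
  proof (intro allI impI)
    fix \<epsilon> :: real assume "0 < \<epsilon>"
    define e where "e = \<epsilon> / (norm a + norm b + 1)"
    have pos: "0 < norm a + norm b + 1" by (simp add: add_nonneg_pos)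
    then have e: "0 < e" using \<open>0 < \<epsilon>\<close> by (simp add: e_def)
    have "(norm a + norm b + 1) * e = \<epsilon>" using pos by (simp add: e_def)
    then have le: "norm a * e + norm b * e < \<epsilon>"
      using e by (simp add: algebra_simps)
    obtain d1 where d1: "0 < d1"
      "\<And>x y. x \<in> lp_ball p \<Longrightarrow> y \<in> lp_ball p \<Longrightarrow> lp_dist p x y < d1 \<Longrightarrow> norm (f x - f y) < e"
      using Au_ucE[OF f e] by blast
    obtain d2 where d2: "0 < d2"
      "\<And>x y. x \<in> lp_ball p \<Longrightarrow> y \<in> lp_ball p \<Longrightarrow> lp_dist p x y < d2 \<Longrightarrow> norm (g x - g y) < e"
      using Au_ucE[OF g e] by blast
    show "\<exists>\<delta>>0. \<forall>x\<in>lp_ball p. \<forall>y\<in>lp_ball p. lp_dist p x y < \<delta> \<longrightarrow>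
        norm (a * f x + b * g x - (a * f y + b * g y)) < \<epsilon>"
    proof (intro exI[of _ "min d1 d2"] conjI ballI impI)
      fix x y assume xy: "x \<in> lp_ball p" "y \<in> lp_ball p" "lp_dist p x y < min d1 d2"
      have "norm (a * f x + b * g x - (a * f y + b * g y))
          = norm (a * (f x - f y) + b * (g x - g y))" by (simp add: algebra_simps)
      also have "\<dots> \<le> norm a * norm (f x - f y) + norm b * norm (g x - g y)"
        by (rule norm_combo_le)
      also have "\<dots> \<le> norm a * e + norm b * e"
        using d1(2)[OF xy(1,2)] d2(2)[OF xy(1,2)] xy(3)
        by (intro add_mono mult_left_mono) (auto intro: less_imp_le)
      finally show "norm (a * f x + b * g x - (a * f y + b * g y)) < \<epsilon>" using le by simp
    qed (use d1 d2 in auto)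
  qed
qed

text \<open>A compact set \<open>K\<close> containing the range turns continuity of \<open>g\<close>
  into uniform continuity. Applied below to squares, exponentials and resolvents.\<close>

lemma Au_compose:
  assumes p: "1 \<le> p" and f: "f \<in> Au p" and K: "compact K" "\<And>x. x \<in> lp_ball p \<Longrightarrow> f x \<in> K"
    and g: "g holomorphic_on S" "open S" "K \<subseteq> S"
  shows "(\<lambda>x\<in>lp_ball p. g (f x)) \<in> Au p"
proof (rule AuI)
  show "lp_holomorphic p (\<lambda>x. g (f x))"
    unfolding lp_holomorphic_def
  proof
    fix x assume x: "x \<in> lp_ball p"
    obtain L where L: "lp_has_frechet_derivative p f L x"
      using f x by (auto simp: Au_def lp_holomorphic_def)
    have "f x \<in> S" using K x g by auto
    then obtain g' where "(g has_field_derivative g') (at (f x))"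
      using g by (metis holomorphic_on_imp_differentiable_at field_differentiable_def)
    then show "\<exists>L. lp_has_frechet_derivative p (\<lambda>x. g (f x)) L x"
      using lp_frechet_compose[OF p x L] by blast
  qed
  have "uniformly_continuous_on K g"
    using K g by (intro compact_uniformly_continuous)
      (auto intro: holomorphic_on_imp_continuous_on holomorphic_on_subset)
  then show "lp_uniformly_continuous p (\<lambda>x. g (f x))"
    unfolding lp_uniformly_continuous_def
  proof (intro allI impI)
    fix \<epsilon> :: real assume "0 < \<epsilon>"
    with \<open>uniformly_continuous_on K g\<close> obtain e where e: "0 < e"
      "\<And>v w. v \<in> K \<Longrightarrow> w \<in> K \<Longrightarrow> norm (v - w) < e \<Longrightarrow> norm (g v - g w) < \<epsilon>"
      unfolding uniformly_continuous_on_def dist_norm by blast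
    obtain \<delta> where "0 < \<delta>"
      "\<And>x y. x \<in> lp_ball p \<Longrightarrow> y \<in> lp_ball p \<Longrightarrow> lp_dist p x y < \<delta> \<Longrightarrow> norm (f x - f y) < e"
      using Au_ucE[OF f e(1)] by blast
    then show "\<exists>\<delta>>0. \<forall>x\<in>lp_ball p. \<forall>y\<in>lp_ball p. lp_dist p x y < \<delta> \<longrightarrow>
        norm (g (f x) - g (f y)) < \<epsilon>"
      using e(2) K(2) by blast
  qed
qed

lemma Au_const:
  shows "(\<lambda>x\<in>lp_ball p. c) \<in> Au p"
proof (rule AuI)
  show "lp_uniformly_continuous p (\<lambda>x. c)"
    by (auto simp: lp_uniformly_continuous_def intro: exI[of _ 1])
  have "(\<lambda>x. 0) \<in> lp_dual p"
    by (auto simp: lp_dual_def lp_norm_nonneg intro!: exI[of _ 0])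
  then have "lp_has_frechet_derivative p (\<lambda>x. c) (\<lambda>x. 0) x" for x
    by (auto simp: lp_has_frechet_derivative_def lp_dist_def lp_norm_nonneg intro!: exI[of _ 1])
  then show "lp_holomorphic p (\<lambda>x. c)"
    by (auto simp: lp_holomorphic_def)
qed

lemma Au_add:
  assumes "1 \<le> p" "f \<in> Au p" "g \<in> Au p"
  shows "(\<lambda>x\<in>lp_ball p. f x + g x) \<in> Au p"
  using Au_combo[OF assms, of 1 1] by simp

lemma Au_scale:
  assumes "1 \<le> p" "f \<in> Au p"
  shows "(\<lambda>x\<in>lp_ball p. c * f x) \<in> Au p"
  using Au_combo[OF assms assms(2), of c 0] by simp

lemma Au_power2:
  assumes p: "1 \<le> p" and f: "f \<in> Au p"
  shows "(\<lambda>x\<in>lp_ball p. (f x)\<^sup>2) \<in> Au p"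
proof -
  obtain C where "0 < C" "\<And>x. x \<in> lp_ball p \<Longrightarrow> norm (f x) \<le> C"
    using Au_bounded[OF p f] by blast
  then show ?thesis
    by (intro Au_compose[OF p f compact_cball[of 0 C], of "\<lambda>w. w\<^sup>2" UNIV])
       (auto intro!: holomorphic_intros)
qed

text \<open>By polarization, closure under squares and linear combinations gives closure under products.\<close>

lemma Au_mult:
  assumes p: "1 \<le> p" and f: "f \<in> Au p" and g: "g \<in> Au p"
  shows "(\<lambda>x\<in>lp_ball p. f x * g x) \<in> Au p"
proof -
  have "(\<lambda>x\<in>lp_ball p. 1/4 * ((\<lambda>x\<in>lp_ball p. ((\<lambda>x\<in>lp_ball p. 1 * f x + 1 * g x) x)\<^sup>2) x)
     + (-1/4) * ((\<lambda>x\<in>lp_ball p. ((\<lambda>x\<in>lp_ball p. 1 * f x + (-1) * g x) x)\<^sup>2) x)) \<in> Au p" (is "?h \<in> _")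
    by (intro Au_combo Au_power2 p f g)
  also have "?h = (\<lambda>x\<in>lp_ball p. f x * g x)"
  proof (rule restrict_ext)
    fix x assume "x \<in> lp_ball p"
    moreover have "1/4 * (1 * a + 1 * b)\<^sup>2 + (-1/4) * (1 * a + (-1) * b)\<^sup>2 = a * b" for a b :: complex
      by algebra
    ultimately show "1/4 * ((\<lambda>x\<in>lp_ball p. ((\<lambda>x\<in>lp_ball p. 1 * f x + 1 * g x) x)\<^sup>2) x)
       + (-1/4) * ((\<lambda>x\<in>lp_ball p. ((\<lambda>x\<in>lp_ball p. 1 * f x + (-1) * g x) x)\<^sup>2) x) = f x * g x"
      by (simp only: restrict_apply' mult_1)
  qed
  finally show ?thesis .
qed

lemma Au_power:
  assumes p: "1 \<le> p" and f: "f \<in> Au p"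
  shows "(\<lambda>x\<in>lp_ball p. f x ^ n) \<in> Au p"
proof (induction n)
  case 0
  show ?case unfolding power_0 by (rule Au_const)
next
  case (Suc n)
  have "(\<lambda>x\<in>lp_ball p. f x * (\<lambda>x\<in>lp_ball p. f x ^ n) x) \<in> Au p"
    by (intro Au_mult p f Suc)
  also have "(\<lambda>x\<in>lp_ball p. f x * (\<lambda>x\<in>lp_ball p. f x ^ n) x) = (\<lambda>x\<in>lp_ball p. f x ^ Suc n)"
    by (intro restrict_ext) simp
  finally show ?case .
qed

lemma Au_lp_dual:
  assumes p: "1 \<le> p" and L: "L \<in> lp_dual p"
  shows "restrict L (lp_ball p) \<in> Au p"
proof (rule AuI)
  \<comment> \<open>A linear functional is its own derivative with zero remainder, so any
    \<open>\<delta>\<close> works.\<close>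
  have "lp_has_frechet_derivative p L L x" if "x \<in> lp_ball p" for x
    using L lp_dual_diff[OF p L] lp_ball_lp that
    by (auto simp: lp_has_frechet_derivative_def lp_dist_def lp_norm_nonneg intro!: exI[of _ 1])
  then show "lp_holomorphic p L" by (auto simp: lp_holomorphic_def)
  obtain C where C: "0 < C" "\<And>x. x \<in> lp p \<Longrightarrow> norm (L x) \<le> C * lp_norm p x"
    using lp_dual_bound[OF L] by blast
  show "lp_uniformly_continuous p L"
    unfolding lp_uniformly_continuous_def
  proof (intro allI impI)
    fix \<epsilon> :: real assume \<epsilon>: "0 < \<epsilon>"
    show "\<exists>\<delta>>0. \<forall>x\<in>lp_ball p. \<forall>y\<in>lp_ball p. lp_dist p x y < \<delta> \<longrightarrow> norm (L x - L y) < \<epsilon>"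
    proof (intro exI[of _ "\<epsilon> / C"] conjI ballI impI)
      fix x y assume xy: "x \<in> lp_ball p" "y \<in> lp_ball p" "lp_dist p x y < \<epsilon> / C"
      have "norm (L x - L y) \<le> C * lp_dist p x y"
        using C(2)[OF lp_diff[OF p lp_ball_lp[OF xy(1)] lp_ball_lp[OF xy(2)]]]
          lp_dual_diff[OF p L lp_ball_lp[OF xy(1)] lp_ball_lp[OF xy(2)]] by (simp add: lp_dist_def)
      then show "norm (L x - L y) < \<epsilon>" using xy(3) C(1) by (simp add: field_simps)
    qed (use \<epsilon> C in auto)
  qed
qed

section \<open>Evaluations on the sphere and characters\<close>

text \<open>Evaluation at a point of the sphere is computed along this sequence of interior points.
  The shift by 2 keeps the factor in \<open>[1/2, 1)\<close>.\<close>

definition radial :: "nat \<Rightarrow> (nat \<Rightarrow> complex) \<Rightarrow> nat \<Rightarrow> complex" where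
  "radial j w = (\<lambda>k. of_real (1 - 1 / real (j + 2)) * w k)"

lemma radial_ball:
  assumes "1 \<le> p" "w \<in> lp p" "lp_norm p w = 1"
  shows "radial j w \<in> lp_ball p"
  unfolding radial_def
proof (rule lp_ball_scale)
  have "\<bar>1 - 1 / real (j + 2)\<bar> < 1" by (simp add: field_simps)
  then show "norm (of_real (1 - 1 / real (j + 2)) :: complex) < 1"
    unfolding norm_of_real .
qed (use assms in auto)

lemma radial_tendsto:
  assumes "1 \<le> p" "w \<in> lp p" "lp_norm p w = 1"
  shows "(\<lambda>j. lp_dist p (radial j w) w) \<longlonglongrightarrow> 0"
proof -
  have "lp_dist p (radial j w) w = 1 / real (j + 2)" for j
  proof -
    have "lp_dist p (radial j w) w = norm (of_real (1 - 1 / real (j + 2)) - 1 :: complex) * lp_norm p w"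
      using lp_dist_scale[OF assms(2), of _ 1] assms(1) unfolding radial_def by simp
    also have "\<dots> = norm (of_real (- (1 / real (j + 2))) :: complex)"
      by (simp add: assms(3))
    also have "\<dots> = 1 / real (j + 2)"
      by (simp only: norm_of_real) simp
    finally show ?thesis .
  qed
  moreover have "(\<lambda>j. 1 / real (j + 2)) \<longlonglongrightarrow> 0"
    using LIMSEQ_ignore_initial_segment[OF lim_1_over_n, of 2] by simp
  ultimately show ?thesis by simp
qed

lemma lp_dist_nonneg: "0 \<le> lp_dist p x y"
  by (simp add: lp_dist_def lp_norm_nonneg)

text \<open>Uniform continuity makes the values along the radius a Cauchy sequence. A ball point
  close to \<open>w\<close> is close to all late radial points, so the radial limit is the full
  limit; the second claim keeps this quantitative.\<close>

lemma delta_radial_approx: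
  assumes p: "1 \<le> p" and f: "f \<in> Au p" and w: "w \<in> lp p" "lp_norm p w = 1"
  shows "(\<lambda>j. f (radial j w)) \<longlonglongrightarrow> delta p w f"
    and "\<And>\<epsilon> \<delta> x. (\<And>x y. x \<in> lp_ball p \<Longrightarrow> y \<in> lp_ball p \<Longrightarrow> lp_dist p x y < \<delta> \<Longrightarrow> norm (f x - f y) < \<epsilon>)
      \<Longrightarrow> x \<in> lp_ball p \<Longrightarrow> lp_dist p x w < \<delta> \<Longrightarrow> norm (f x - delta p w f) \<le> \<epsilon>"
proof -
  interpret Metric_space "lp p" "lp_dist p" by (rule Metric_space_lp[OF p])
  let ?F = "atin_within (lp_topology p) w (lp_ball p)"
  note rb = radial_ball[OF p w]
  have near: "eventually (\<lambda>j. lp_dist p x (radial j w) < \<delta>) sequentially"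
    if "x \<in> lp p" "lp_dist p x w < \<delta>" for x \<delta>
  proof -
    have "eventually (\<lambda>j. lp_dist p (radial j w) w < \<delta> - lp_dist p x w) sequentially"
      using order_tendstoD(2)[OF radial_tendsto[OF p w]] that by simp
    then show ?thesis
    proof eventually_elim
      case (elim j)
      then show ?case
        using triangle'[OF that(1) w(1) lp_ball_lp[OF rb[of j]]] by simp
    qed
  qed
  have "Cauchy (\<lambda>j. f (radial j w))"
  proof (rule metric_CauchyI)
    fix \<epsilon> :: real assume "0 < \<epsilon>"
    then obtain \<delta> where \<delta>: "0 < \<delta>"
      "\<And>x y. x \<in> lp_ball p \<Longrightarrow> y \<in> lp_ball p \<Longrightarrow> lp_dist p x y < \<delta> \<Longrightarrow> norm (f x - f y) < \<epsilon>"
      using Au_ucE[OF f] by blast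
    obtain N where N: "\<And>j. N \<le> j \<Longrightarrow> lp_dist p (radial j w) w < \<delta> / 2"
      using order_tendstoD(2)[OF radial_tendsto[OF p w], of "\<delta> / 2"] \<delta>(1)
      by (auto simp: eventually_sequentially)
    have "dist (f (radial i w)) (f (radial j w)) < \<epsilon>" if "N \<le> i" "N \<le> j" for i j
    proof -
      have "lp_dist p (radial i w) (radial j w) < \<delta>"
        using triangle'[OF lp_ball_lp[OF rb[of i]] w(1) lp_ball_lp[OF rb[of j]]] N[OF that(1)] N[OF that(2)]
        by linarith
      then show ?thesis using \<delta>(2) rb by (simp add: dist_norm)
    qed
    then show "\<exists>M. \<forall>m\<ge>M. \<forall>n\<ge>M. dist (f (radial m w)) (f (radial n w)) < \<epsilon>" by blast
  qed
  then obtain c where c: "(\<lambda>j. f (radial j w)) \<longlonglongrightarrow> c"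
    using Cauchy_convergent_iff convergent_def by blast
  have approx: "norm (f x - c) \<le> \<epsilon>"
    if uc: "\<And>x y. x \<in> lp_ball p \<Longrightarrow> y \<in> lp_ball p \<Longrightarrow> lp_dist p x y < \<delta> \<Longrightarrow> norm (f x - f y) < \<epsilon>"
      and x: "x \<in> lp_ball p" "lp_dist p x w < \<delta>" for \<epsilon> \<delta> x
  proof (rule tendsto_upperbound)
    show "(\<lambda>j. norm (f x - f (radial j w))) \<longlonglongrightarrow> norm (f x - c)"
      by (intro tendsto_intros c)
    show "eventually (\<lambda>j. norm (f x - f (radial j w)) \<le> \<epsilon>) sequentially"
      using near[OF lp_ball_lp[OF x(1)] x(2)]
      by eventually_elim (use uc x(1) rb in \<open>auto intro: less_imp_le\<close>)
  qed simp
  \<comment> \<open>\<open>Lim\<close> is determined only along a proper filter: the radial points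
    show that \<open>w\<close> is a limit of ball points other than \<open>w\<close>.\<close>
  have nonbot: "?F \<noteq> bot"
  proof
    assume "?F = bot"
    then have "eventually (\<lambda>x. False) ?F" by simp
    then obtain \<delta> where \<delta>: "0 < \<delta>" "\<And>x. x \<in> lp_ball p \<Longrightarrow> 0 < lp_dist p x w \<Longrightarrow> \<not> lp_dist p x w < \<delta>"
      unfolding lp_topology_def eventually_atin_within_metric using w(1) lp_ball_lp by blast
    obtain j where j: "lp_dist p (radial j w) w < \<delta>"
      using order_tendstoD(2)[OF radial_tendsto[OF p w] \<delta>(1)] by (auto simp: eventually_sequentially)
    have "radial j w \<noteq> w"
      using rb[of j] w(2) by (auto simp: lp_ball_def)
    then show False
      using \<delta>(2)[OF rb, of j] j mdist_pos_less[of "radial j w" w] w(1) lp_ball_lp[OF rb[of j]] by blast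
  qed
  have "(f \<longlongrightarrow> c) ?F"
  proof (rule tendstoI)
    fix \<epsilon> :: real assume "0 < \<epsilon>"
    then obtain \<delta> where \<delta>: "0 < \<delta>"
      "\<And>x y. x \<in> lp_ball p \<Longrightarrow> y \<in> lp_ball p \<Longrightarrow> lp_dist p x y < \<delta> \<Longrightarrow> norm (f x - f y) < \<epsilon> / 2"
      using Au_ucE[OF f, of "\<epsilon> / 2"] by auto
    have "dist (f x) c < \<epsilon>" if "x \<in> lp_ball p" "lp_dist p x w < \<delta>" for x
      using approx[OF \<delta>(2) that] \<open>0 < \<epsilon>\<close> by (simp add: dist_norm)
    then show "eventually (\<lambda>x. dist (f x) c < \<epsilon>) ?F"
      unfolding lp_topology_def eventually_atin_within_metric using \<delta>(1) by blast
  qed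
  then have "delta p w f = c"
    using tendsto_Lim[OF nonbot] f by (simp add: delta_def)
  note dc = this
  show "(\<lambda>j. f (radial j w)) \<longlonglongrightarrow> delta p w f"
    unfolding dc by (rule c)
  fix \<epsilon> \<delta> x
  assume "\<And>x y. x \<in> lp_ball p \<Longrightarrow> y \<in> lp_ball p \<Longrightarrow> lp_dist p x y < \<delta> \<Longrightarrow> norm (f x - f y) < \<epsilon>"
    and "x \<in> lp_ball p" "lp_dist p x w < \<delta>"
  then show "norm (f x - delta p w f) \<le> \<epsilon>"
    unfolding dc by (rule approx)
qed

lemmas delta_radial = delta_radial_approx(1)

text \<open>One \<open>\<delta>\<close> has to serve all points of the sphere at once, because the
  point \<open>w\<close> close to a given \<open>x\<close> will vary with \<open>x\<close>.\<close>

lemma delta_uniform_approx: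
  assumes p: "1 \<le> p" and f: "f \<in> Au p" and "0 < \<epsilon>"
  obtains \<delta> where "0 < \<delta>"
    "\<And>w x. w \<in> lp p \<Longrightarrow> lp_norm p w = 1 \<Longrightarrow> x \<in> lp_ball p \<Longrightarrow> lp_dist p x w < \<delta> \<Longrightarrow>
       norm (f x - delta p w f) \<le> \<epsilon>"
proof -
  obtain \<delta> where \<delta>: "0 < \<delta>"
      "\<And>x y. x \<in> lp_ball p \<Longrightarrow> y \<in> lp_ball p \<Longrightarrow> lp_dist p x y < \<delta> \<Longrightarrow> norm (f x - f y) < \<epsilon>"
    using Au_ucE[OF f \<open>0 < \<epsilon>\<close>] by blast
  show ?thesis
    using that[OF \<delta>(1)] delta_radial_approx(2)[OF p f _ _ \<delta>(2)] by blast
qed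

text \<open>Reduces identities for \<open>delta\<close> to limits of the same identities at interior
  points.\<close>

lemma delta_eqI:
  assumes "1 \<le> p" "f \<in> Au p" "w \<in> lp p" "lp_norm p w = 1" "(\<lambda>j. f (radial j w)) \<longlonglongrightarrow> c"
  shows "delta p w f = c"
  using LIMSEQ_unique[OF delta_radial[OF assms(1-4)] assms(5)] .

lemma delta_add:
  assumes "1 \<le> p" "f \<in> Au p" "g \<in> Au p" "w \<in> lp p" "lp_norm p w = 1"
  shows "delta p w (\<lambda>x\<in>lp_ball p. f x + g x) = delta p w f + delta p w g"
  using assms by (intro delta_eqI Au_add) (auto simp: radial_ball intro!: tendsto_intros delta_radial)

lemma delta_scale:
  assumes "1 \<le> p" "f \<in> Au p" "w \<in> lp p" "lp_norm p w = 1"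
  shows "delta p w (\<lambda>x\<in>lp_ball p. c * f x) = c * delta p w f"
  using assms by (intro delta_eqI Au_scale) (auto simp: radial_ball intro!: tendsto_intros delta_radial)

lemma delta_mult:
  assumes "1 \<le> p" "f \<in> Au p" "g \<in> Au p" "w \<in> lp p" "lp_norm p w = 1"
  shows "delta p w (\<lambda>x\<in>lp_ball p. f x * g x) = delta p w f * delta p w g"
  using assms by (intro delta_eqI Au_mult) (auto simp: radial_ball intro!: tendsto_intros delta_radial)

lemma delta_const:
  assumes "1 \<le> p" "w \<in> lp p" "lp_norm p w = 1"
  shows "delta p w (\<lambda>x\<in>lp_ball p. c) = c"
  using assms by (intro delta_eqI Au_const) (auto simp: radial_ball)

lemma delta_norm_le:
  assumes "1 \<le> p" "f \<in> Au p" "w \<in> lp p" "lp_norm p w = 1" "\<And>x. x \<in> lp_ball p \<Longrightarrow> norm (f x) \<le> C"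
  shows "norm (delta p w f) \<le> C"
  using assms radial_ball[OF assms(1,3,4)]
  by (intro tendsto_upperbound[OF tendsto_norm[OF delta_radial[OF assms(1-4)]]]) auto

lemma delta_lp_dual:
  assumes p: "1 \<le> p" and L: "L \<in> lp_dual p" and w: "w \<in> lp p" "lp_norm p w = 1"
  shows "delta p w (restrict L (lp_ball p)) = L w"
proof (rule delta_eqI[OF p Au_lp_dual[OF p L] w])
  have "(\<lambda>j. 1 / real (j + 2)) \<longlonglongrightarrow> 0"
    using LIMSEQ_ignore_initial_segment[OF lim_1_over_n, of 2] by simp
  then have "(\<lambda>j. of_real (1 - 1 / real (j + 2)) * L w) \<longlonglongrightarrow> of_real (1 - 0) * L w"
    by (intro tendsto_intros)
  moreover have "restrict L (lp_ball p) (radial j w) = of_real (1 - 1 / real (j + 2)) * L w" for j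
    using radial_ball[OF p w, of j] lp_dual_scale[OF L w(1)] by (simp add: radial_def)
  ultimately show "(\<lambda>j. restrict L (lp_ball p) (radial j w)) \<longlonglongrightarrow> L w"
    by simp
qed

section \<open>Characters of the algebra\<close>

lemma spectrum_add:
  "\<psi> \<in> spectrum p \<Longrightarrow> f \<in> Au p \<Longrightarrow> g \<in> Au p \<Longrightarrow> \<psi> (\<lambda>x\<in>lp_ball p. f x + g x) = \<psi> f + \<psi> g"
  by (simp add: spectrum_def)

lemma spectrum_scale:
  "\<psi> \<in> spectrum p \<Longrightarrow> f \<in> Au p \<Longrightarrow> \<psi> (\<lambda>x\<in>lp_ball p. c * f x) = c * \<psi> f"
  by (simp add: spectrum_def)

lemma spectrum_mult:
  "\<psi> \<in> spectrum p \<Longrightarrow> f \<in> Au p \<Longrightarrow> g \<in> Au p \<Longrightarrow> \<psi> (\<lambda>x\<in>lp_ball p. f x * g x) = \<psi> f * \<psi> g"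
  by (simp add: spectrum_def)

text \<open>Some \<open>f\<close> has \<open>\<psi> f \<noteq> 0\<close>, and
  \<open>f = f * 1\<close> then forces \<open>\<psi> 1 = 1\<close>; other constants follow by
  homogeneity.\<close>

lemma spectrum_const:
  assumes "\<psi> \<in> spectrum p"
  shows "\<psi> (\<lambda>x\<in>lp_ball p. c) = c"
proof -
  obtain f where f: "f \<in> Au p" "\<psi> f \<noteq> 0" using assms by (auto simp: spectrum_def)
  have "(\<lambda>x\<in>lp_ball p. f x * (\<lambda>x\<in>lp_ball p. 1) x) = f"
    using Au_restrict[OF f(1)] by (simp cong: restrict_cong)
  then have "\<psi> f = \<psi> f * \<psi> (\<lambda>x\<in>lp_ball p. 1)"
    using spectrum_mult[OF assms f(1) Au_const[where c = 1]] by simp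
  then have "\<psi> (\<lambda>x\<in>lp_ball p. 1) = 1" using f(2) by simp
  moreover have "(\<lambda>x\<in>lp_ball p. c * (\<lambda>x\<in>lp_ball p. 1) x) = (\<lambda>x\<in>lp_ball p. c)"
    by (rule restrict_ext) simp
  ultimately show ?thesis
    using spectrum_scale[OF assms Au_const[where c = 1], of c] by simp
qed

lemma spectrum_affine:
  assumes p: "1 \<le> p" and \<psi>: "\<psi> \<in> spectrum p" and f: "f \<in> Au p"
  shows "\<psi> (\<lambda>x\<in>lp_ball p. a * f x + b) = a * \<psi> f + b"
proof -
  have "(\<lambda>x\<in>lp_ball p. (\<lambda>x\<in>lp_ball p. a * f x) x + (\<lambda>x\<in>lp_ball p. b) x) = (\<lambda>x\<in>lp_ball p. a * f x + b)"
    by (rule restrict_ext) simp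
  then show ?thesis
    using spectrum_add[OF \<psi> Au_scale[OF p f, of a] Au_const[where c = b]]
    by (simp add: spectrum_scale[OF \<psi> f] spectrum_const[OF \<psi>])
qed

lemma Au_affine:
  assumes p: "1 \<le> p" and f: "f \<in> Au p"
  shows "(\<lambda>x\<in>lp_ball p. a * f x + b) \<in> Au p"
proof -
  have "(\<lambda>x\<in>lp_ball p. (\<lambda>x\<in>lp_ball p. a * f x) x + (\<lambda>x\<in>lp_ball p. b) x) = (\<lambda>x\<in>lp_ball p. a * f x + b)"
    by (rule restrict_ext) simp
  then show ?thesis
    using Au_add[OF p Au_scale[OF p f, of a] Au_const[where c = b]] by simp
qed

lemma spectrum_power:
  assumes p: "1 \<le> p" and \<psi>: "\<psi> \<in> spectrum p" and f: "f \<in> Au p"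
  shows "\<psi> (\<lambda>x\<in>lp_ball p. f x ^ n) = \<psi> f ^ n"
proof (induction n)
  case 0
  show ?case using spectrum_const[OF \<psi>, of 1] by (simp only: power_0)
next
  case (Suc n)
  have "(\<lambda>x\<in>lp_ball p. f x * (\<lambda>x\<in>lp_ball p. f x ^ n) x) = (\<lambda>x\<in>lp_ball p. f x ^ Suc n)"
    by (rule restrict_ext) simp
  then show ?case
    using spectrum_mult[OF \<psi> f Au_power[OF p f, of n]] Suc by (simp only: power_Suc)
qed

text \<open>If \<open>\<psi> f\<close> had modulus above the supremum of \<open>f\<close>, then \<open>\<psi> f - f\<close> would be an invertible
  element of the algebra in the kernel of \<open>\<psi>\<close>.\<close>

lemma spectrum_norm_le:
  assumes p: "1 \<le> p" and \<psi>: "\<psi> \<in> spectrum p" and f: "f \<in> Au p"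
    and C: "\<And>x. x \<in> lp_ball p \<Longrightarrow> norm (f x) \<le> C"
  shows "norm (\<psi> f) \<le> C"
proof (rule ccontr)
  assume "\<not> norm (\<psi> f) \<le> C"
  then have ne: "w \<noteq> \<psi> f" if "w \<in> cball 0 C" for w
    using that by auto
  define g where "g = (\<lambda>x\<in>lp_ball p. 1 / (\<psi> f - f x))"
  have g: "g \<in> Au p" unfolding g_def
    by (rule Au_compose[OF p f compact_cball[of 0 C], of "\<lambda>w. 1 / (\<psi> f - w)" "- {\<psi> f}"])
       (use C ne in \<open>auto intro!: holomorphic_intros\<close>)
  have "(\<lambda>x\<in>lp_ball p. (\<lambda>x\<in>lp_ball p. (-1) * f x + \<psi> f) x * g x) = (\<lambda>x\<in>lp_ball p. 1)"
  proof (rule restrict_ext)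
    fix x assume x: "x \<in> lp_ball p"
    then have "\<psi> f \<noteq> f x" using ne[of "f x"] C by auto
    then show "(\<lambda>x\<in>lp_ball p. (-1) * f x + \<psi> f) x * g x = 1"
      using x by (simp add: g_def)
  qed
  then have "\<psi> (\<lambda>x\<in>lp_ball p. (-1) * f x + \<psi> f) * \<psi> g = \<psi> (\<lambda>x\<in>lp_ball p. 1)"
    using spectrum_mult[OF \<psi> Au_affine[OF p f, of "-1" "\<psi> f"] g] by simp
  then show False
    unfolding spectrum_affine[OF p \<psi> f] spectrum_const[OF \<psi>] by simp
qed

section \<open>Free ultrafilters and limits along them\<close>

lemma free_ultrafilter_exists:
  obtains F :: "nat filter" where "F \<noteq> bot" "F \<le> sequentially"
    "\<forall>P. eventually P F \<or> eventually (\<lambda>n. \<not> P n) F"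
proof -
  define A where "A = {F :: nat filter. F \<noteq> bot \<and> F \<le> sequentially}"
  \<comment> \<open>Zorn's lemma for proper filters below \<open>sequentially\<close>, ordered by
    refinement. The infimum of a nonempty chain stays proper, because a property holding eventually
    along it already holds eventually along one member.\<close>
  have "\<exists>F\<in>A. \<forall>G\<in>A. G \<le> F \<longrightarrow> G = F"
  proof (rule predicate_Zorn)
    show "partial_order_on A (relation_of (\<lambda>F G. G \<le> F) A)"
      by (rule partial_order_on_relation_ofI) auto
    fix C assume C: "C \<in> Chains (relation_of (\<lambda>F G. G \<le> F) A)"
    then have CA: "C \<subseteq> A" and lin: "\<And>F G. F \<in> C \<Longrightarrow> G \<in> C \<Longrightarrow> F \<le> G \<or> G \<le> F"
      by (auto simp: Chains_def relation_of_def)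
    show "\<exists>u\<in>A. \<forall>F\<in>C. u \<le> F"
    proof (cases "C = {}")
      case True
      then show ?thesis by (intro bexI[of _ sequentially]) (auto simp: A_def)
    next
      case False
      then obtain F where F: "F \<in> C" by blast
      have "eventually P (Inf C) \<longleftrightarrow> (\<exists>b\<in>C. eventually P b)" for P
      proof (rule eventually_Inf_base[OF False])
        show "\<exists>x\<in>C. x \<le> inf F G" if "F \<in> C" "G \<in> C" for F G
          using lin[OF that] that by (auto simp: inf_absorb1 inf_absorb2)
      qed
      then have "Inf C \<noteq> bot"
        using CA by (auto simp: trivial_limit_def A_def)
      moreover have "Inf C \<le> sequentially"
        using Inf_lower[OF F] F CA by (auto simp: A_def)
      ultimately show ?thesis
        by (intro bexI[of _ "Inf C"]) (auto simp: A_def Inf_lower)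
    qed
  qed
  then obtain F where F: "F \<noteq> bot" "F \<le> sequentially" "\<And>G. G \<in> A \<Longrightarrow> G \<le> F \<Longrightarrow> G = F"
    by (auto simp: A_def)
  \<comment> \<open>A minimal proper filter decides every \<open>P\<close>: adding \<open>P\<close>
    either produces the improper filter, so that \<open>P\<close> fails eventually, or returns
    \<open>F\<close> itself.\<close>
  have "eventually P F \<or> eventually (\<lambda>n. \<not> P n) F" for P
  proof (cases "inf F (principal {n. P n}) = bot")
    case True
    then show ?thesis
      by (simp add: trivial_limit_def eventually_inf_principal)
  next
    case False
    then have "inf F (principal {n. P n}) = F"
      using F(2) by (intro F(3)) (auto simp: A_def intro: le_infI1)
    then have "F \<le> principal {n. P n}" by (metis inf_le2)
    then show ?thesis by (simp add: le_principal)
  qed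
  with F show ?thesis using that by blast
qed

text \<open>Compactness of a disc gives a cluster point. Along an ultrafilter a cluster point is a
  limit: if \<open>g\<close> were not eventually in an open set around it, \<open>g\<close> would
  eventually avoid that set.\<close>

lemma ultrafilter_limit:
  fixes g :: "nat \<Rightarrow> complex"
  assumes F: "F \<noteq> bot" "\<And>P. eventually P F \<or> eventually (\<lambda>n. \<not> P n) F"
    and g: "eventually (\<lambda>n. norm (g n) \<le> C) F"
  obtains c where "(g \<longlongrightarrow> c) F"
proof -
  have "filtermap g F \<noteq> bot" using F(1) by (simp add: filtermap_bot_iff)
  moreover have "eventually (\<lambda>x. x \<in> cball 0 C) (filtermap g F)"
    using g by (simp add: eventually_filtermap)
  ultimately obtain c where c: "inf (nhds c) (filtermap g F) \<noteq> bot"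
    using compact_cball[of "0::complex" C] unfolding compact_filter by blast
  have "(g \<longlongrightarrow> c) F"
  proof (rule topological_tendstoI, rule ccontr)
    fix S assume S: "open S" "c \<in> S" and "\<not> eventually (\<lambda>n. g n \<in> S) F"
    then have "eventually (\<lambda>w. w \<notin> S) (filtermap g F)"
      using F(2) by (auto simp: eventually_filtermap)
    moreover have "eventually (\<lambda>w. w \<in> S) (nhds c)"
      using S by (rule eventually_nhds_in_open)
    ultimately have "eventually (\<lambda>w. False) (inf (nhds c) (filtermap g F))"
      unfolding eventually_inf by blast
    then show False using c by (simp add: trivial_limit_def)
  qed
  then show ?thesis using that by blast
qed

section \<open>Power sums\<close>

text \<open>For \<open>N \<ge> p\<close> the series converges absolutely on the ball and defines an
  \<open>N\<close>-homogeneous polynomial.\<close>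

definition power_sum :: "nat \<Rightarrow> nat set \<Rightarrow> (nat \<Rightarrow> complex) \<Rightarrow> complex" where
  "power_sum N A x = (\<Sum>k. if k \<in> A then x k ^ N else 0)"

lemma power_le_powr:
  fixes a p :: real
  assumes "0 \<le> a" "a \<le> 1" "0 < p" "p \<le> real N"
  shows "a ^ N \<le> a powr p"
proof (cases "a = 0")
  case True
  then show ?thesis using assms by (cases N) auto
next
  case False
  then have "a ^ N = a powr real N" using assms by (simp add: powr_realpow)
  also have "\<dots> \<le> a powr p" using assms by (intro powr_mono') auto
  finally show ?thesis .
qed

lemma lp_ball_norm_le_1:
  assumes "x \<in> lp_ball p" "0 < p"
  shows "norm (x k) \<le> 1"
  using norm_le_lp_norm[OF lp_ball_lp[OF assms(1)] assms(2), of k] assms(1) by (simp add: lp_ball_def)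

lemma lp_summable: "x \<in> lp p \<Longrightarrow> summable (\<lambda>k. norm (x k) powr p)"
  by (simp add: lp_def)

lemma power_sum_summable:
  assumes "x \<in> lp_ball p" "0 < p" "p \<le> real N"
  shows "summable (\<lambda>k. if k \<in> A then x k ^ N else 0)"
proof (rule summable_comparison_test'[where N = 0])
  show "summable (\<lambda>k. norm (x k) powr p)"
    using assms by (intro lp_summable lp_ball_lp)
  show "norm (if k \<in> A then x k ^ N else 0) \<le> norm (x k) powr p" for k
    using power_le_powr[of "norm (x k)" p N] lp_ball_norm_le_1[OF assms(1,2)] assms
    by (auto simp: norm_power)
qed

lemma power_sum_scale: "power_sum N A (\<lambda>k. c * x k) = c ^ N * power_sum N A x"
  if "summable (\<lambda>k. if k \<in> A then x k ^ N else 0)"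
proof -
  have "(\<lambda>k. if k \<in> A then (c * x k) ^ N else 0) = (\<lambda>k. c ^ N * (if k \<in> A then x k ^ N else 0))"
    by (auto simp: power_mult_distrib)
  then show ?thesis
    using suminf_mult[OF that, of "c ^ N"] by (simp add: power_sum_def)
qed

lemma norm_two_plus_of_nat: "norm (2 + of_nat n :: complex) = 2 + real n"
  using norm_of_nat[of "2 + n", where 'a = complex] by simp

text \<open>Induction on \<open>n\<close>: the remainder \<open>E\<close> for one exponent yields
  \<open>y * E + (n+2) * x ^ (n+1) * (y - x)^2\<close> for the next. Splitting off two powers leaves
  the weight \<open>M ^ n\<close>, which can be summed over coordinates when
  \<open>n \<ge> p\<close>; hence the later hypothesis \<open>p + 2 \<le> N\<close>.\<close>

lemma power_taylor_remainder:
  fixes x y :: complex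
  assumes "norm x \<le> M" "norm y \<le> M"
  shows "norm (y ^ (n+2) - x ^ (n+2) - of_nat (n+2) * x ^ (n+1) * (y - x))
    \<le> real ((n+2)\<^sup>2) * M ^ n * (norm (y - x))\<^sup>2"
proof (induction n)
  case 0
  have "y ^ (0+2) - x ^ (0+2) - of_nat (0+2) * x ^ (0+1) * (y - x) = (y - x)\<^sup>2"
    by (simp add: power2_eq_square algebra_simps)
  then show ?case by (simp add: norm_power)
next
  case (Suc n)
  define d where "d = norm (y - x)"
  define E where "E = y ^ (n+2) - x ^ (n+2) - of_nat (n+2) * x ^ (n+1) * (y - x)"
  have M: "0 \<le> M" using assms(1) norm_ge_zero order_trans by blast
  have d0: "0 \<le> d" by (simp add: d_def)
  have "y ^ (Suc n+2) - x ^ (Suc n+2) - of_nat (Suc n+2) * x ^ (Suc n+1) * (y - x)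
      = y * E + of_nat (n+2) * x ^ (n+1) * (y - x)\<^sup>2"
    by (simp add: E_def power2_eq_square algebra_simps)
  also have "norm \<dots> \<le> norm y * norm E + real (n+2) * norm x ^ (n+1) * d\<^sup>2"
    by (rule norm_triangle_le) (simp add: norm_mult norm_power d_def norm_two_plus_of_nat)
  also have "\<dots> \<le> M * (real ((n+2)\<^sup>2) * M ^ n * d\<^sup>2) + real (n+2) * M ^ (n+1) * d\<^sup>2"
    using Suc assms M norm_ge_zero[of "y - x"] unfolding E_def[symmetric] d_def[symmetric]
    by (intro add_mono mult_mono power_mono) auto
  also have "\<dots> = (real ((n+2)\<^sup>2) + real (n+2)) * (M ^ Suc n * d\<^sup>2)"
    by (simp add: algebra_simps)
  also have "\<dots> \<le> real ((Suc n+2)\<^sup>2) * (M ^ Suc n * d\<^sup>2)"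
    by (rule mult_right_mono)
       (auto simp: power2_eq_square algebra_simps intro!: mult_nonneg_nonneg M d0 zero_le_power)
  finally show ?case by (simp add: d_def mult.assoc)
qed

text \<open>Replaces the weight \<open>M ^ n\<close> of the Taylor bound by one whose sum over all
  coordinates is controlled by the norms of both points.\<close>

lemma max_power_le:
  fixes x y :: complex
  assumes "norm x \<le> 1" "norm y \<le> 1" "0 < p" "p \<le> real n"
  shows "max (norm x) (norm y) ^ n \<le> norm x powr p + norm y powr p"
proof -
  have "norm x ^ n \<le> norm x powr p" "norm y ^ n \<le> norm y powr p"
    using assms by (auto intro: power_le_powr)
  then show ?thesis
    by (simp add: max_def add_increasing add_increasing2)
qed

lemma power_diff_le:
  fixes x y :: complex
  assumes "norm x \<le> 1" "norm y \<le> 1" "0 < p" "p \<le> real n"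
  shows "norm (y ^ (n+2) - x ^ (n+2))
    \<le> 3 * real ((n+2)\<^sup>2) * (norm x powr p + norm y powr p) * norm (y - x)"
proof -
  define M where "M = max (norm x) (norm y)"
  have M: "0 \<le> M" "M \<le> 1" "norm x \<le> M" "norm y \<le> M"
    using assms by (auto simp: M_def le_max_iff_disj)
  define d where "d = norm (y - x)"
  have d: "0 \<le> d" "d \<le> 2"
    using assms norm_triangle_ineq4[of y x] by (auto simp: d_def)
  have "norm (of_nat (n+2) * x ^ (n+1) * (y - x)) = real (n+2) * norm x ^ (n+1) * d"
    by (simp add: norm_mult norm_power d_def norm_two_plus_of_nat)
  also have "\<dots> \<le> real ((n+2)\<^sup>2) * M ^ n * d"
  proof (intro mult_right_mono mult_mono d)
    show "norm x ^ (n+1) \<le> M ^ n"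
      using power_mono[OF M(3), of "n+1"] power_decreasing[of n "n+1" M] M by simp
  qed (auto simp: power2_eq_square)
  finally have 1: "norm (of_nat (n+2) * x ^ (n+1) * (y - x)) \<le> real ((n+2)\<^sup>2) * M ^ n * d" .
  \<comment> \<open>Both points lie in the unit disc, so \<open>d \<le> 2\<close> makes the
    quadratic remainder linear. Together with the derivative term this gives the constant 3 = 1 +
    2.\<close>
  have "real ((n+2)\<^sup>2) * M ^ n * d\<^sup>2 \<le> real ((n+2)\<^sup>2) * M ^ n * (2 * d)"
    using M d by (intro mult_left_mono) (auto simp: power2_eq_square mult_right_mono)
  then have 2: "norm (y ^ (n+2) - x ^ (n+2) - of_nat (n+2) * x ^ (n+1) * (y - x))
      \<le> real ((n+2)\<^sup>2) * M ^ n * (2 * d)"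
    using power_taylor_remainder[OF M(3,4), of n] unfolding d_def[symmetric] by (rule order_trans[rotated])
  have "norm (y ^ (n+2) - x ^ (n+2)) \<le> norm (of_nat (n+2) * x ^ (n+1) * (y - x))
      + norm (y ^ (n+2) - x ^ (n+2) - of_nat (n+2) * x ^ (n+1) * (y - x))"
    by (rule norm_triangle_sub)
  also have "\<dots> \<le> 3 * real ((n+2)\<^sup>2) * M ^ n * d"
    using 1 2 by simp
  also have "\<dots> \<le> 3 * real ((n+2)\<^sup>2) * (norm x powr p + norm y powr p) * d"
    using max_power_le[OF assms] d by (intro mult_right_mono mult_left_mono) (auto simp: M_def)
  finally show ?thesis by (simp add: d_def)
qed

text \<open>Passes from coordinatewise estimates to series: in the ball each of the two weights has
  total mass at most 1, whence the factor 2. Serves the Lipschitz bound, the boundedness of the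
  derivative and its remainder.\<close>

lemma suminf_mixed_le:
  fixes f :: "nat \<Rightarrow> complex"
  assumes p: "0 < p" and x: "x \<in> lp_ball p" and y: "y \<in> lp_ball p"
    and c: "0 \<le> c"
    and le: "\<And>k. norm (f k) \<le> (norm (x k) powr p + norm (y k) powr p) * c"
  shows "summable f" "norm (suminf f) \<le> 2 * c"
proof -
  have s: "summable (\<lambda>k. norm (x k) powr p)" "summable (\<lambda>k. norm (y k) powr p)"
    using x y by (auto intro: lp_summable lp_ball_lp)
  then have s': "summable (\<lambda>k. (norm (x k) powr p + norm (y k) powr p) * c)"
    by (intro summable_mult2 summable_add)
  then have n: "summable (\<lambda>k. norm (f k))"
    by (rule summable_comparison_test'[where N = 0]) (use le in simp)
  then show "summable f" by (rule summable_norm_cancel)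
  have "norm (suminf f) \<le> (\<Sum>k. norm (f k))" by (rule summable_norm[OF n])
  also have "\<dots> \<le> (\<Sum>k. (norm (x k) powr p + norm (y k) powr p) * c)"
    by (rule suminf_le[OF le n s'])
  also have "\<dots> = ((\<Sum>k. norm (x k) powr p) + (\<Sum>k. norm (y k) powr p)) * c"
    using s by (simp add: suminf_mult2[symmetric] suminf_add summable_add)
  also have "\<dots> \<le> 2 * c"
    using lp_ball_suminf_le_1[OF x p] lp_ball_suminf_le_1[OF y p] c by (intro mult_right_mono) auto
  finally show "norm (suminf f) \<le> 2 * c" .
qed

lemma norm_diff_le_lp_dist:
  assumes "1 \<le> p" "x \<in> lp p" "y \<in> lp p"
  shows "norm (x k - y k) \<le> lp_dist p x y"
  using norm_le_lp_norm[OF lp_diff[OF assms], of k] assms(1) by (simp add: lp_dist_def)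

lemma power_sum_lipschitz:
  assumes p: "1 \<le> p" "p \<le> real n" and x: "x \<in> lp_ball p" and y: "y \<in> lp_ball p"
  shows "norm (power_sum (n+2) A y - power_sum (n+2) A x) \<le> 6 * real ((n+2)\<^sup>2) * lp_dist p y x"
proof -
  have p0: "0 < p" using p by simp
  let ?f = "\<lambda>k. (if k \<in> A then y k ^ (n+2) else 0) - (if k \<in> A then x k ^ (n+2) else 0)"
  let ?c = "3 * real ((n+2)\<^sup>2) * lp_dist p y x"
  have c: "0 \<le> ?c" by (simp add: lp_dist_nonneg)
  have le: "norm (?f k) \<le> (norm (x k) powr p + norm (y k) powr p) * ?c" for k
  proof (cases "k \<in> A")
    case True
    have "norm (?f k) \<le> 3 * real ((n+2)\<^sup>2) * (norm (x k) powr p + norm (y k) powr p) * norm (y k - x k)"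
      using power_diff_le[of "x k" "y k" p n] lp_ball_norm_le_1[OF x p0] lp_ball_norm_le_1[OF y p0] p True
      by simp
    also have "\<dots> \<le> 3 * real ((n+2)\<^sup>2) * (norm (x k) powr p + norm (y k) powr p) * lp_dist p y x"
      by (intro mult_left_mono norm_diff_le_lp_dist p lp_ball_lp x y) simp
    finally show ?thesis by (simp add: mult_ac)
  qed (use c in \<open>auto intro!: mult_nonneg_nonneg\<close>)
  have "power_sum (n+2) A y - power_sum (n+2) A x = suminf ?f"
    unfolding power_sum_def using p0 p
    by (intro suminf_diff power_sum_summable[OF y] power_sum_summable[OF x]) auto
  then show ?thesis
    using suminf_mixed_le(2)[OF p0 x y c le] by simp
qed

lemma power_sum_frechet:
  assumes p: "1 \<le> p" "p \<le> real n" and x: "x \<in> lp_ball p"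
  shows "lp_has_frechet_derivative p (power_sum (n+2) A)
    (\<lambda>h. \<Sum>k. if k \<in> A then of_nat (n+2) * x k ^ (n+1) * h k else 0) x"
    (is "lp_has_frechet_derivative p _ ?D x")
proof -
  have p0: "0 < p" using p by simp
  let ?t = "\<lambda>h k. if k \<in> A then of_nat (n+2) * x k ^ (n+1) * h k else 0"
  \<comment> \<open>The weight is doubled to fit the shape of the summation lemma with
    \<open>y = x\<close>.\<close>
  have bnd: "norm (?t h k) \<le> (norm (x k) powr p + norm (x k) powr p) * (real (n+2) * lp_norm p h)"
    if "h \<in> lp p" for h k
  proof (cases "k \<in> A")
    case True
    have "norm (x k) ^ (n+1) \<le> norm (x k) powr p"
      using p lp_ball_norm_le_1[OF x p0] by (intro power_le_powr) auto
    also have "\<dots> \<le> norm (x k) powr p + norm (x k) powr p" by simp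
    finally have "real (n+2) * norm (x k) ^ (n+1) * norm (h k)
      \<le> real (n+2) * (norm (x k) powr p + norm (x k) powr p) * lp_norm p h"
      using norm_le_lp_norm[OF that p0] by (intro mult_mono mult_left_mono) auto
    moreover have "norm (?t h k) = real (n+2) * norm (x k) ^ (n+1) * norm (h k)"
      using True by (simp add: norm_mult norm_power norm_two_plus_of_nat)
    ultimately show ?thesis by (simp only: mult_ac)
  qed (auto intro!: mult_nonneg_nonneg simp: lp_norm_nonneg)
  have c0: "0 \<le> real (n+2) * lp_norm p h" for h by (simp add: lp_norm_nonneg)
  note sm = suminf_mixed_le[OF p0 x x c0 bnd]
  have D: "?D \<in> lp_dual p"
    unfolding lp_dual_def mem_Collect_eq
  proof (intro conjI ballI allI)
    show "?D (\<lambda>k. u k + v k) = ?D u + ?D v" if "u \<in> lp p" "v \<in> lp p" for u v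
      unfolding suminf_add[OF sm(1)[OF that(1)] sm(1)[OF that(2)]]
      by (rule arg_cong[where f = suminf]) (auto simp: algebra_simps)
    show "?D (\<lambda>k. c * u k) = c * ?D u" if "u \<in> lp p" for c u
      unfolding suminf_mult[OF sm(1)[OF that], symmetric]
      by (rule arg_cong[where f = suminf]) (auto simp: algebra_simps)
    have "norm (?D u) \<le> 2 * real (n+2) * lp_norm p u" if "u \<in> lp p" for u
      using sm(2)[OF that] by (simp only: mult.assoc)
    then show "\<exists>C. \<forall>u\<in>lp p. norm (?D u) \<le> C * lp_norm p u" by blast
  qed
  \<comment> \<open>The remainder is quadratic in the distance, so
    \<open>\<delta> = \<epsilon> / K\<close> will do below.\<close>
  have rem: "norm (power_sum (n+2) A y - power_sum (n+2) A x - ?D (\<lambda>k. y k - x k))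
      \<le> 2 * real ((n+2)\<^sup>2) * (lp_dist p y x)\<^sup>2" if y: "y \<in> lp_ball p" for y
  proof -
    let ?f = "\<lambda>k. (if k \<in> A then y k ^ (n+2) else 0) - (if k \<in> A then x k ^ (n+2) else 0)
        - ?t (\<lambda>k. y k - x k) k"
    let ?c = "real ((n+2)\<^sup>2) * (lp_dist p y x)\<^sup>2"
    have c: "0 \<le> ?c" by simp
    have le: "norm (?f k) \<le> (norm (x k) powr p + norm (y k) powr p) * ?c" for k
    proof (cases "k \<in> A")
      case True
      let ?M = "max (norm (x k)) (norm (y k))"
      have "norm (?f k) \<le> real ((n+2)\<^sup>2) * ?M ^ n * (norm (y k - x k))\<^sup>2"
        using power_taylor_remainder[of "x k" ?M "y k" n] True by simp
      also have "\<dots> \<le> real ((n+2)\<^sup>2) * (norm (x k) powr p + norm (y k) powr p) * (lp_dist p y x)\<^sup>2"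
      proof (intro mult_mono mult_left_mono power_mono)
        show "?M ^ n \<le> norm (x k) powr p + norm (y k) powr p"
          using max_power_le lp_ball_norm_le_1[OF x p0] lp_ball_norm_le_1[OF y p0] p0 p(2) by blast
        show "norm (y k - x k) \<le> lp_dist p y x"
          by (intro norm_diff_le_lp_dist p lp_ball_lp x y)
        show "0 \<le> ?M ^ n" by (intro zero_le_power) (simp add: le_max_iff_disj)
      qed auto
      finally show ?thesis by (simp add: mult_ac)
    qed (use c in \<open>auto intro!: mult_nonneg_nonneg\<close>)
    have xy: "(\<lambda>k. y k - x k) \<in> lp p"
      using p x y by (intro lp_diff lp_ball_lp) auto
    have ss: "summable (\<lambda>k. if k \<in> A then y k ^ (n+2) else 0)"
      "summable (\<lambda>k. if k \<in> A then x k ^ (n+2) else 0)"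
      using p0 p by (auto intro!: power_sum_summable[OF y] power_sum_summable[OF x])
    have "power_sum (n+2) A y - power_sum (n+2) A x - ?D (\<lambda>k. y k - x k) = suminf ?f"
      unfolding power_sum_def suminf_diff[OF ss] suminf_diff[OF summable_diff[OF ss] sm(1)[OF xy]] ..
    then show ?thesis
      using suminf_mixed_le(2)[OF p0 x y c le] by simp
  qed
  show ?thesis
    unfolding lp_has_frechet_derivative_def
  proof (intro conjI D allI impI)
    fix \<epsilon> :: real assume \<epsilon>: "0 < \<epsilon>"
    define K where "K = 2 * real ((n+2)\<^sup>2)"
    have K: "0 < K" by (simp add: K_def)
    show "\<exists>\<delta>>0. \<forall>y\<in>lp_ball p. lp_dist p y x < \<delta> \<longrightarrow>
        norm (power_sum (n+2) A y - power_sum (n+2) A x - ?D (\<lambda>k. y k - x k)) \<le> \<epsilon> * lp_dist p y x"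
    proof (intro exI[of _ "\<epsilon> / K"] conjI ballI impI)
      fix y assume y: "y \<in> lp_ball p" "lp_dist p y x < \<epsilon> / K"
      have "K * lp_dist p y x \<le> \<epsilon>"
        using y(2) K by (simp add: field_simps)
      then have "K * lp_dist p y x * lp_dist p y x \<le> \<epsilon> * lp_dist p y x"
        by (intro mult_right_mono lp_dist_nonneg)
      then show "norm (power_sum (n+2) A y - power_sum (n+2) A x - ?D (\<lambda>k. y k - x k))
          \<le> \<epsilon> * lp_dist p y x"
        using rem[OF y(1)] by (simp add: K_def power2_eq_square)
    qed (use \<epsilon> K in auto)
  qed
qed

lemma Au_power_sum:
  assumes p: "1 \<le> p" "p + 2 \<le> real N"
  shows "restrict (power_sum N A) (lp_ball p) \<in> Au p"
proof -
  obtain n where N: "N = n + 2"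
    using p by (metis add.commute le_Suc_ex of_nat_le_iff of_nat_numeral order_trans
        le_add_same_cancel2 zero_le_one)
  then have pn: "p \<le> real n" using p by simp
  show ?thesis
    unfolding N
  proof (rule AuI)
    show "lp_holomorphic p (power_sum (n+2) A)"
      using power_sum_frechet[OF p(1) pn] unfolding lp_holomorphic_def by blast
    show "lp_uniformly_continuous p (power_sum (n+2) A)"
      unfolding lp_uniformly_continuous_def
    proof (intro allI impI)
      fix \<epsilon> :: real assume \<epsilon>: "0 < \<epsilon>"
      define K where "K = 6 * real ((n+2)\<^sup>2)"
      have K: "0 < K" by (simp add: K_def)
      show "\<exists>\<delta>>0. \<forall>x\<in>lp_ball p. \<forall>y\<in>lp_ball p. lp_dist p x y < \<delta> \<longrightarrow>
          norm (power_sum (n+2) A x - power_sum (n+2) A y) < \<epsilon>"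
      proof (intro exI[of _ "\<epsilon> / K"] conjI ballI impI)
        fix x y assume xy: "x \<in> lp_ball p" "y \<in> lp_ball p" "lp_dist p x y < \<epsilon> / K"
        have "norm (power_sum (n+2) A x - power_sum (n+2) A y) \<le> K * lp_dist p x y"
          unfolding K_def by (rule power_sum_lipschitz[OF p(1) pn xy(2,1)])
        also have "\<dots> < \<epsilon>" using xy(3) K by (simp add: field_simps)
        finally show "norm (power_sum (n+2) A x - power_sum (n+2) A y) < \<epsilon>" .
      qed (use \<epsilon> K in auto)
    qed
  qed
qed

section \<open>Young gaps and tails\<close>

text \<open>Mean value theorem between \<open>t\<close> and 1: the slope
  \<open>p * u powr (p - 1)\<close> lies strictly on one side of \<open>p\<close>. Strictness later
  identifies the equality case of Young's inequality.\<close>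

lemma bernoulli_powr_strict:
  fixes t p :: real
  assumes "1 < p" "0 \<le> t" "t \<noteq> 1"
  shows "p * t < p - 1 + t powr p"
proof (cases "t = 0")
  case True
  then show ?thesis using assms by simp
next
  case False
  then have t: "0 < t" using assms by simp
  have der: "((\<lambda>u. u powr p) has_real_derivative p * u powr (p - 1)) (at u)" if "0 < u" for u
    using has_real_derivative_powr[OF that, of p] by simp
  consider "t < 1" | "1 < t" using assms by linarith
  then show ?thesis
  proof cases
    case 1
    obtain u where u: "t < u" "u < 1" "1 powr p - t powr p = (1 - t) * (p * u powr (p - 1))"
      using MVT2[OF 1, of "\<lambda>u. u powr p" "\<lambda>u. p * u powr (p - 1)"] der t by force
    have "u powr (p - 1) < 1 powr (p - 1)"
      using u t assms by (intro powr_less_mono2) auto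
    then have "(1 - t) * (p * u powr (p - 1)) < (1 - t) * (p * 1)"
      using 1 assms by (intro mult_strict_left_mono) auto
    then show ?thesis using u(3) by (simp add: algebra_simps)
  next
    case 2
    obtain u where u: "1 < u" "u < t" "t powr p - 1 powr p = (t - 1) * (p * u powr (p - 1))"
      using MVT2[OF 2, of "\<lambda>u. u powr p" "\<lambda>u. p * u powr (p - 1)"] der by force
    have "1 powr (p - 1) < u powr (p - 1)"
      using u t assms by (intro powr_less_mono2) auto
    then have "(t - 1) * (p * 1) < (t - 1) * (p * u powr (p - 1))"
      using 2 assms by (intro mult_strict_left_mono) auto
    then show ?thesis using u(3) by (simp add: algebra_simps)
  qed
qed

text \<open>The deficit in Young's inequality. The coefficient of \<open>x\<close> is the norming
  functional of \<open>a\<close>: applied to \<open>a\<close> it gives \<open>norm a powr p\<close>.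
  For \<open>a = 0\<close> only \<open>norm x powr p / p\<close> remains.\<close>

definition young_gap :: "real \<Rightarrow> complex \<Rightarrow> complex \<Rightarrow> real" where
  "young_gap p a x = (p - 1) / p * norm a powr p + norm x powr p / p
     - Re (cnj a * of_real (norm a powr (p - 2)) * x)"

text \<open>Separates the deficit in modulus, a Bernoulli deficit at \<open>t = |x| / |a|\<close>,
  from the deficit in phase, \<open>|a| * |x| - Re (cnj a * x)\<close>. Both are
  nonnegative.\<close>

lemma young_gap_split:
  assumes "1 < p" "a \<noteq> 0"
  shows "p * young_gap p a x = norm a powr p * (p - 1 + (norm x / norm a) powr p - p * (norm x / norm a))
     + p * norm a powr (p - 2) * (norm a * norm x - Re (cnj a * x))"
proof -
  have a: "0 < norm a" using assms by simp
  have 1: "norm a powr p * (norm x / norm a) powr p = norm x powr p"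
    using a by (simp add: powr_mult[symmetric])
  have 2: "norm a powr p * (norm x / norm a) = norm a powr (p - 2) * (norm a * norm x)"
    using a by (simp add: powr_diff power2_eq_square)
  have 3: "Re (cnj a * of_real (norm a powr (p - 2)) * x) = norm a powr (p - 2) * Re (cnj a * x)"
    by (simp add: algebra_simps)
  have "p * young_gap p a x = (p - 1) * norm a powr p + norm x powr p
      - p * (norm a powr (p - 2) * Re (cnj a * x))"
  proof -
    have "p * ((p - 1) / p * A + B / p - C) = (p - 1) * A + B - p * C" for A B C
      using assms by (simp add: field_simps)
    then show ?thesis unfolding young_gap_def 3 .
  qed
  also have "\<dots> = (p - 1) * norm a powr p + norm a powr p * (norm x / norm a) powr p
      - p * (norm a powr p * (norm x / norm a)) + p * (norm a powr (p - 2) * (norm a * norm x))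
      - p * (norm a powr (p - 2) * Re (cnj a * x))"
    unfolding 1 2 by simp
  finally show ?thesis by (simp only: algebra_simps)
qed

lemma Re_cnj_mult_le: "Re (cnj a * x) \<le> norm a * norm x"
  using complex_Re_le_cmod[of "cnj a * x"] by (simp only: norm_mult complex_mod_cnj)

lemma young_gap_nonneg:
  assumes "1 < p"
  shows "0 \<le> young_gap p a x"
proof (cases "a = 0")
  case True
  then show ?thesis using assms by (simp add: young_gap_def)
next
  case False
  have "0 \<le> p - 1 + (norm x / norm a) powr p - p * (norm x / norm a)"
    using bernoulli_powr_strict[OF assms, of "norm x / norm a"]
    by (cases "norm x / norm a = 1") auto
  then have "0 \<le> p * young_gap p a x"
    unfolding young_gap_split[OF assms False] using assms Re_cnj_mult_le[of a x]
    by (intro add_nonneg_nonneg mult_nonneg_nonneg) auto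
  then show ?thesis using assms by (simp add: zero_le_mult_iff)
qed

text \<open>Both parts of the splitting vanish. The modulus part gives \<open>|x| = |a|\<close>, the
  phase part \<open>Re (cnj a * x) = |a| * |x|\<close>, and expanding the square gives
  \<open>|x - a| = 0\<close>.\<close>

lemma young_gap_eq_0D:
  assumes "1 < p" "young_gap p a x = 0"
  shows "x = a"
proof (cases "a = 0")
  case True
  then show ?thesis using assms by (simp add: young_gap_def)
next
  case False
  let ?t = "norm x / norm a"
  have a: "0 < norm a powr p" "0 < p * norm a powr (p - 2)" using False assms by auto
  have A: "0 \<le> p - 1 + ?t powr p - p * ?t"
    using bernoulli_powr_strict[OF assms(1), of ?t] by (cases "?t = 1") auto
  have B: "0 \<le> norm a * norm x - Re (cnj a * x)"
    using Re_cnj_mult_le[of a x] by simp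
  have "norm a powr p * (p - 1 + ?t powr p - p * ?t)
      + p * norm a powr (p - 2) * (norm a * norm x - Re (cnj a * x)) = 0"
    using young_gap_split[OF assms(1) False, of x] assms(2) by simp
  then have "norm a powr p * (p - 1 + ?t powr p - p * ?t) = 0 \<and>
      p * norm a powr (p - 2) * (norm a * norm x - Re (cnj a * x)) = 0"
    using mult_nonneg_nonneg[OF less_imp_le[OF a(1)] A] mult_nonneg_nonneg[OF less_imp_le[OF a(2)] B]
    by linarith
  then have 1: "p - 1 + ?t powr p - p * ?t = 0" and 2: "norm a * norm x = Re (cnj a * x)"
    using a by auto
  have "?t = 1"
    using bernoulli_powr_strict[OF assms(1), of ?t] 1 by fastforce
  then have na: "norm x = norm a" using False by simp
  have "(norm (x - a))\<^sup>2 = (norm x)\<^sup>2 + (norm a)\<^sup>2 - 2 * Re (cnj a * x)"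
    unfolding cmod_power2 by (simp add: power2_eq_square algebra_simps)
  also have "\<dots> = 0"
    using 2 na by (simp add: power2_eq_square)
  finally show ?thesis by simp
qed

lemma young_gap_continuous: "1 < p \<Longrightarrow> continuous_on S (young_gap p a)"
  unfolding young_gap_def by (intro continuous_intros continuous_on_powr') auto

text \<open>Turns an equality case into a stability statement: outside a ball around
  \<open>a\<close> the modulus of \<open>f\<close> has a positive minimum by compactness, so values
  tending to 0 drive \<open>u\<close> into the ball.\<close>

lemma tendsto_unique_zero:
  fixes f :: "'a::metric_space \<Rightarrow> real"
  assumes K: "compact K" "continuous_on K f" and z: "\<And>x. x \<in> K \<Longrightarrow> f x = 0 \<Longrightarrow> x = a"
    and u: "\<And>j. u j \<in> K" "((\<lambda>j. f (u j)) \<longlongrightarrow> 0) F"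
  shows "(u \<longlongrightarrow> a) F"
proof (rule tendstoI)
  fix e :: real assume e: "0 < e"
  define K' where "K' = K - ball a e"
  have K': "compact K'" unfolding K'_def using K(1) by (intro compact_diff) auto
  show "eventually (\<lambda>j. dist (u j) a < e) F"
  proof (cases "K' = {}")
    case True
    then have "dist (u j) a < e" for j using u(1)[of j] by (auto simp: K'_def dist_commute)
    then show ?thesis by simp
  next
    case False
    have "continuous_on K' (\<lambda>x. \<bar>f x\<bar>)"
      using K(2) by (intro continuous_intros continuous_on_subset[OF K(2)]) (auto simp: K'_def)
    then obtain b where b: "b \<in> K'" "\<And>x. x \<in> K' \<Longrightarrow> \<bar>f b\<bar> \<le> \<bar>f x\<bar>"
      using continuous_attains_inf[OF K' False] by blast
    have "f b \<noteq> 0" using z[of b] b(1) e by (auto simp: K'_def)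
    then have "eventually (\<lambda>j. \<bar>f (u j)\<bar> < \<bar>f b\<bar>) F"
      using tendstoD[OF u(2), of "\<bar>f b\<bar>"] by (simp add: dist_norm)
    then show ?thesis
    proof eventually_elim
      case (elim j)
      then have "u j \<notin> K'" using b(2)[of "u j"] by force
      then show ?case using u(1)[of j] by (auto simp: K'_def dist_commute)
    qed
  qed
qed

lemma x_exp_le_1: "x * exp (1 - x) \<le> 1" if "0 \<le> x" for x :: real
proof -
  have "x \<le> exp (x - 1)" using exp_ge_add_one_self[of "x - 1"] by simp
  then have "x * exp (1 - x) \<le> exp (x - 1) * exp (1 - x)" by (intro mult_right_mono) auto
  then show ?thesis by (simp add: exp_add[symmetric])
qed

text \<open>The equation amounts to \<open>ln x = x - 1\<close>, whose only positive solution is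
  1.\<close>

lemma x_exp_eq_1D:
  fixes x :: real
  assumes "x * exp (1 - x) = 1"
  shows "x = 1"
proof -
  have "0 < x" using assms by (metis exp_gt_zero zero_less_mult_pos2 zero_less_one)
  moreover have "x = exp (x - 1)"
  proof -
    have "x = (x * exp (1 - x)) * exp (x - 1)" by (simp add: mult.assoc exp_add[symmetric])
    then show ?thesis by (simp add: assms)
  qed
  ultimately show ?thesis using ln_eq_minus_one[of x] by (metis ln_exp)
qed

section \<open>Tails of p-sums and bounds for power sums\<close>

definition lp_tail :: "real \<Rightarrow> nat \<Rightarrow> (nat \<Rightarrow> complex) \<Rightarrow> real" where
  "lp_tail p m x = (\<Sum>k. if m \<le> k then norm (x k) powr p else 0)"

lemma lp_tail_sums:
  assumes "x \<in> lp p"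
  shows "(\<lambda>k. if m \<le> k then norm (x k) powr p else 0) sums lp_tail p m x"
  unfolding lp_tail_def
  by (rule summable_sums, rule summable_comparison_test'[OF lp_summable[OF assms], where N = 0]) auto

lemma lp_head_tail:
  assumes "x \<in> lp p"
  shows "(\<Sum>k. norm (x k) powr p) = (\<Sum>k<m. norm (x k) powr p) + lp_tail p m x"
proof -
  have "(\<lambda>k. (if k \<in> {..<m} then norm (x k) powr p else 0) + (if m \<le> k then norm (x k) powr p else 0))
      sums ((\<Sum>k<m. norm (x k) powr p) + lp_tail p m x)"
    by (intro sums_add lp_tail_sums assms sums_If_finite_set) auto
  moreover have "(\<lambda>k. (if k \<in> {..<m} then norm (x k) powr p else 0) + (if m \<le> k then norm (x k) powr p else 0))
      = (\<lambda>k. norm (x k) powr p)" by auto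
  ultimately show ?thesis by (simp add: sums_iff)
qed

lemma lp_tail_nonneg: "x \<in> lp p \<Longrightarrow> 0 \<le> lp_tail p m x"
  using sums_le[OF _ sums_zero lp_tail_sums[of x p m]] by auto

lemma lp_tail_le_1:
  assumes "x \<in> lp_ball p" "0 < p"
  shows "(\<Sum>k<m. norm (x k) powr p) + lp_tail p m x \<le> 1"
  using lp_ball_suminf_le_1[OF assms] lp_head_tail[OF lp_ball_lp[OF assms(1)], of m] by simp

lemma coord_le_lp_tail:
  assumes "x \<in> lp p" "m \<le> n"
  shows "norm (x n) powr p \<le> lp_tail p m x"
  unfolding lp_tail_def
  using sum_le_suminf[OF sums_summable[OF lp_tail_sums[OF assms(1)]], of "{n}" m] assms(2) by simp

text \<open>With \<open>T\<close> the tail, each \<open>|x k|^p\<close> is at most \<open>T\<close>.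
  Hence \<open>|x k|^N\<close> is at most \<open>T^(N/p - 1) * |x k|^p\<close>, and summing the last
  factor gives another \<open>T\<close>.\<close>

lemma power_sum_norm_le:
  assumes x: "x \<in> lp_ball p" and p: "0 < p" "p \<le> real N" and A: "A \<subseteq> {m..}"
  shows "norm (power_sum N A x) \<le> lp_tail p m x powr (real N / p)"
proof -
  define T where "T = lp_tail p m x"
  have xl: "x \<in> lp p" using x by (rule lp_ball_lp)
  have T: "0 \<le> T" unfolding T_def by (rule lp_tail_nonneg[OF xl])
  have bnd: "norm (x k) ^ N \<le> T powr (real N / p - 1) * norm (x k) powr p" if "k \<in> A" for k
  proof (cases "x k = 0")
    case True
    then show ?thesis using p by (cases N) auto
  next
    case False
    have le: "norm (x k) powr p \<le> T"
      unfolding T_def using that A by (intro coord_le_lp_tail[OF xl]) auto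
    have "norm (x k) ^ N = norm (x k) powr real N" using False by (simp add: powr_realpow)
    also have "\<dots> = (norm (x k) powr p) powr (real N / p - 1) * norm (x k) powr p"
      using p by (simp add: powr_powr powr_add[symmetric] right_diff_distrib)
    also have "\<dots> \<le> T powr (real N / p - 1) * norm (x k) powr p"
      using p le by (intro mult_right_mono powr_mono2) auto
    finally show ?thesis .
  qed
  have s: "(\<lambda>k. T powr (real N / p - 1) * (if m \<le> k then norm (x k) powr p else 0))
      sums (T powr (real N / p - 1) * T)"
    unfolding T_def by (intro sums_mult lp_tail_sums xl)
  have le: "norm (if k \<in> A then x k ^ N else 0)
      \<le> T powr (real N / p - 1) * (if m \<le> k then norm (x k) powr p else 0)" for k
    using bnd[of k] A by (auto simp: norm_power)
  have "norm (power_sum N A x) \<le> (\<Sum>k. norm (if k \<in> A then x k ^ N else 0))"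
    unfolding power_sum_def
    by (rule summable_norm, rule summable_comparison_test'[OF sums_summable[OF s], where N = 0])
       (use le in simp)
  also have "\<dots> \<le> (\<Sum>k. T powr (real N / p - 1) * (if m \<le> k then norm (x k) powr p else 0))"
    by (rule suminf_le[OF le _ sums_summable[OF s]],
        rule summable_comparison_test'[OF sums_summable[OF s], where N = 0]) (use le in simp)
  also have "\<dots> = T powr (real N / p - 1) * T" using s by (simp add: sums_iff)
  also have "\<dots> = T powr (real N / p)"
    using T by (cases "T = 0") (auto simp: powr_diff)
  finally show ?thesis by (simp add: T_def)
qed

text \<open>If every \<open>|x k|^(N - p)\<close> with \<open>k\<close> in \<open>A\<close> were
  below the quotient \<open>c\<close>, the power sum would be at most \<open>c * T\<close>, less
  than \<open>c * (T + e)\<close>, which is its own modulus. The slack \<open>e\<close> makes this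
  strict and avoids division by zero.\<close>

lemma power_sum_coord_ge:
  assumes x: "x \<in> lp_ball p" and p: "0 < p" "p \<le> real N" and A: "A \<subseteq> {m..}" "A \<noteq> {}" and e: "0 < e"
  shows "\<exists>n\<in>A. norm (power_sum N A x) / (lp_tail p m x + e) \<le> norm (x n) powr (real N - p)"
proof (rule ccontr)
  define T where "T = lp_tail p m x"
  define c where "c = norm (power_sum N A x) / (T + e)"
  have xl: "x \<in> lp p" using x by (rule lp_ball_lp)
  have T: "0 \<le> T" unfolding T_def by (rule lp_tail_nonneg[OF xl])
  assume "\<not> ?thesis"
  then have c: "norm (x k) powr (real N - p) < c" if "k \<in> A" for k
    using that by (auto simp: c_def T_def not_le)
  obtain k0 where "k0 \<in> A" using A by blast
  then have c0: "0 < c" using c[of k0] by (metis powr_ge_zero order_le_less_trans)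
  have bnd: "norm (x k) ^ N \<le> c * norm (x k) powr p" if "k \<in> A" for k
  proof (cases "x k = 0")
    case True
    then show ?thesis using p by (cases N) auto
  next
    case False
    have "norm (x k) ^ N = norm (x k) powr (real N - p) * norm (x k) powr p"
      using False by (simp add: powr_realpow powr_add[symmetric])
    also have "\<dots> \<le> c * norm (x k) powr p"
      using c[OF that] by (intro mult_right_mono) auto
    finally show ?thesis .
  qed
  have s: "(\<lambda>k. c * (if m \<le> k then norm (x k) powr p else 0)) sums (c * T)"
    unfolding T_def by (intro sums_mult lp_tail_sums xl)
  have le: "norm (if k \<in> A then x k ^ N else 0) \<le> c * (if m \<le> k then norm (x k) powr p else 0)" for k
    using bnd[of k] A c0 by (auto simp: norm_power)
  have "norm (power_sum N A x) \<le> (\<Sum>k. norm (if k \<in> A then x k ^ N else 0))"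
    unfolding power_sum_def
    by (rule summable_norm, rule summable_comparison_test'[OF sums_summable[OF s], where N = 0])
       (use le in simp)
  also have "\<dots> \<le> (\<Sum>k. c * (if m \<le> k then norm (x k) powr p else 0))"
    by (rule suminf_le[OF le _ sums_summable[OF s]],
        rule summable_comparison_test'[OF sums_summable[OF s], where N = 0]) (use le in simp)
  also have "\<dots> = c * T" using s by (simp add: sums_iff)
  also have "\<dots> < c * (T + e)" using c0 e by simp
  also have "\<dots> = norm (power_sum N A x)" using T e by (simp add: c_def)
  finally show False by simp
qed

text \<open>The other terms satisfy \<open>|x k|^N \<le> |x k|^p\<close>, so they contribute at most
  the tail mass outside coordinate \<open>n\<close>.\<close>

lemma power_sum_single_diff:
  assumes x: "x \<in> lp_ball p" and p: "0 < p" "p \<le> real N" and A: "A \<subseteq> {m..}" "n \<in> A"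
  shows "norm (power_sum N A x - x n ^ N) \<le> lp_tail p m x - norm (x n) powr p"
proof -
  have xl: "x \<in> lp p" using x by (rule lp_ball_lp)
  let ?f = "\<lambda>k. (if k \<in> A then x k ^ N else 0) - (if k = n then x k ^ N else 0)"
  let ?g = "\<lambda>k. (if m \<le> k then norm (x k) powr p else 0) - (if k = n then norm (x k) powr p else 0)"
  have f: "?f sums (power_sum N A x - x n ^ N)"
    unfolding power_sum_def
    by (intro sums_diff summable_sums power_sum_summable[OF x p] sums_single)
  have g: "?g sums (lp_tail p m x - norm (x n) powr p)"
    by (intro sums_diff lp_tail_sums xl sums_single)
  have le: "norm (?f k) \<le> ?g k" for k
    using A power_le_powr[of "norm (x k)" p N] lp_ball_norm_le_1[OF x p(1), of k] p
    by (auto simp: norm_power)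
  have sn: "summable (\<lambda>k. norm (?f k))"
    by (rule summable_comparison_test'[OF sums_summable[OF g], where N = 0]) (use le in simp)
  have "norm (suminf ?f) \<le> (\<Sum>k. norm (?f k))" by (rule summable_norm[OF sn])
  also have "\<dots> \<le> suminf ?g" by (rule suminf_le[OF le sn sums_summable[OF g]])
  finally show ?thesis using f g by (simp add: sums_iff)
qed

section \<open>Peak functions\<close>

text \<open>The equation \<open>norm_eq\<close> is the definition of \<open>s\<close> freed of
  roots; it puts every \<open>w n\<close> with \<open>n \<ge> m\<close> on the unit sphere.\<close>

locale peak_data =
  fixes p s :: real and m :: nat and z :: "nat \<Rightarrow> complex" and \<xi> :: complex
  assumes p: "1 < p" and supp: "\<And>k. m \<le> k \<Longrightarrow> z k = 0" and s: "0 < s"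
    and norm_eq: "(\<Sum>k<m. norm (z k) powr p) + s powr p = 1" and \<xi>: "norm \<xi> = 1"
begin

definition R :: real where
  "R = (\<Sum>k<m. norm (z k) powr p)"

definition w :: "nat \<Rightarrow> nat \<Rightarrow> complex" where
  "w n = (\<lambda>k. z k + of_real s * \<xi> * lp_unit n k)"

text \<open>By Young's inequality, \<open>Re (lin x) \<le> (p - 1) / p * R + (\<Sum>k<m. norm (x k) powr p) / p\<close>, with
  equality only if \<open>x\<close> and \<open>z\<close> have the same coordinates below \<open>m\<close>.\<close>

definition lin :: "(nat \<Rightarrow> complex) \<Rightarrow> complex" where
  "lin x = (\<Sum>k<m. cnj (z k) * of_real (norm (z k) powr (p - 2)) * x k)"

text \<open>With \<open>\<tau>\<close> the tail divided by \<open>s powr p\<close>, Young's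
  inequality gives \<open>Re (lin x) - R \<le> s powr p * (1 - \<tau>) / p\<close> on the ball. The
  coefficient \<open>N / s powr p\<close> therefore bounds the exponential by
  \<open>exp (1 - \<tau>) powr (N / p)\<close>, which matches the bound
  \<open>\<tau> powr (N / p)\<close> of the normalized power sum.\<close>

definition peak :: "nat \<Rightarrow> nat set \<Rightarrow> (nat \<Rightarrow> complex) \<Rightarrow> complex" where
  "peak N A x = exp (of_real (real N / s powr p) * (lin x - of_real R))
     * (power_sum N A x / (of_real s * \<xi>) ^ N)"

lemma p0: "0 < p" and p1: "1 \<le> p" using p by auto

lemma sp: "0 < s powr p" using s by simp

lemma R_eq: "R = 1 - s powr p" using norm_eq by (simp add: R_def)

lemma s\<xi>: "of_real s * \<xi> \<noteq> 0" using s \<xi> by auto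

lemma norm_s\<xi>: "norm (of_real s * \<xi>) = s" using s \<xi> by (simp add: norm_mult)

lemma w_less: "m \<le> n \<Longrightarrow> k < m \<Longrightarrow> w n k = z k"
  by (simp add: w_def lp_unit_def)

lemma w_ge: "m \<le> k \<Longrightarrow> w n k = (if k = n then of_real s * \<xi> else 0)"
  by (simp add: w_def lp_unit_def supp)

lemma w_sums:
  assumes "m \<le> n"
  shows "(\<lambda>k. norm (w n k) powr p) sums 1"
proof -
  have "(\<lambda>k. (if k \<in> {..<m} then norm (z k) powr p else 0) + (if k = n then s powr p else 0))
      sums ((\<Sum>k<m. norm (z k) powr p) + s powr p)"
    by (intro sums_add sums_If_finite_set sums_single) auto
  moreover have "norm (w n k) powr p
      = (if k \<in> {..<m} then norm (z k) powr p else 0) + (if k = n then s powr p else 0)" for k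
    using w_less[OF assms, of k] w_ge[of k n] assms by (cases "k < m") (auto simp: norm_s\<xi>)
  ultimately show ?thesis by (simp add: norm_eq)
qed

lemma w_lp: "m \<le> n \<Longrightarrow> w n \<in> lp p"
  using w_sums by (auto simp: lp_def sums_iff)

lemma w_norm: "m \<le> n \<Longrightarrow> lp_norm p (w n) = 1"
  using w_sums[of n] by (simp add: lp_norm_def sums_iff)

lemma lin_dual: "lin \<in> lp_dual p"
  unfolding lp_dual_def mem_Collect_eq
proof (intro conjI ballI allI)
  show "lin (\<lambda>k. x k + y k) = lin x + lin y" for x y
    by (simp add: lin_def distrib_left sum.distrib)
  show "lin (\<lambda>k. c * x k) = c * lin x" for c x
    by (simp add: lin_def sum_distrib_left mult_ac)
  have "norm (lin x) \<le> (\<Sum>k<m. norm (cnj (z k) * of_real (norm (z k) powr (p - 2)))) * lp_norm p x"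
    if "x \<in> lp p" for x
    unfolding lin_def sum_distrib_right
    by (rule sum_norm_le) (simp add: norm_mult mult_left_mono norm_le_lp_norm[OF that p0])
  then show "\<exists>C. \<forall>x\<in>lp p. norm (lin x) \<le> C * lp_norm p x" by blast
qed

lemma lin_z: "(\<Sum>k<m. cnj (z k) * of_real (norm (z k) powr (p - 2)) * z k) = of_real R"
  unfolding R_def of_real_sum
proof (rule sum.cong[OF refl])
  fix k
  show "cnj (z k) * of_real (norm (z k) powr (p - 2)) * z k = of_real (norm (z k) powr p)"
  proof (cases "z k = 0")
    case False
    have "cnj (z k) * of_real (norm (z k) powr (p - 2)) * z k
        = of_real (norm (z k) powr (p - 2)) * (z k * cnj (z k))" by (simp add: mult_ac)
    also have "\<dots> = of_real (norm (z k) powr (p - 2) * (norm (z k))\<^sup>2)"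
      unfolding complex_norm_square[symmetric] by (simp only: of_real_mult of_real_power)
    also have "norm (z k) powr (p - 2) * (norm (z k))\<^sup>2 = norm (z k) powr p"
      using False by (simp add: powr_diff)
    finally show ?thesis .
  qed simp
qed

lemma lin_w: "m \<le> n \<Longrightarrow> lin (w n) = of_real R"
  unfolding lin_def lin_z[symmetric] by (rule sum.cong) (auto simp: w_less)

lemma power_sum_w:
  assumes "n \<in> A" "A \<subseteq> {m..}" "0 < N"
  shows "(\<lambda>k. if k \<in> A then w n k ^ N else 0) sums (of_real s * \<xi>) ^ N"
proof -
  have "(\<lambda>k. if k \<in> A then w n k ^ N else 0) = (\<lambda>k. if k = n then (of_real s * \<xi>) ^ N else 0)"
    using assms by (auto simp: w_ge fun_eq_iff)
  then show ?thesis using sums_single[of n "\<lambda>_. (of_real s * \<xi>) ^ N"] by simp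
qed

lemma Au_peak:
  assumes N: "p + 2 \<le> real N"
  shows "restrict (peak N A) (lp_ball p) \<in> Au p"
proof -
  let ?B = "lp_ball p"
  let ?\<kappa> = "of_real (real N / s powr p) :: complex"
  define g where "g = (\<lambda>x\<in>?B. ?\<kappa> * restrict lin ?B x + (- ?\<kappa> * of_real R))"
  have g: "g \<in> Au p"
    unfolding g_def by (intro Au_affine p1 Au_lp_dual lin_dual)
  obtain C where C: "0 < C" "\<And>x. x \<in> ?B \<Longrightarrow> norm (g x) \<le> C"
    using Au_bounded[OF p1 g] by blast
  have e: "(\<lambda>x\<in>?B. exp (g x)) \<in> Au p"
    by (rule Au_compose[OF p1 g compact_cball[of 0 C], of exp UNIV])
       (use C in \<open>auto intro!: holomorphic_intros\<close>)
  have "(\<lambda>x\<in>?B. (\<lambda>x\<in>?B. exp (g x)) x *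
      (\<lambda>x\<in>?B. (1 / (of_real s * \<xi>) ^ N) * restrict (power_sum N A) ?B x) x) \<in> Au p" (is "?h \<in> _")
    by (intro Au_mult p1 e Au_scale Au_power_sum N)
  also have "?h = restrict (peak N A) ?B"
    by (rule restrict_ext) (simp add: g_def peak_def right_diff_distrib)
  finally show ?thesis .
qed

text \<open>Supplies the value of \<open>delta p (w n)\<close> at the peak function: along the
  radius \<open>lin\<close> scales by \<open>t\<close> and the power sum by \<open>t ^ N\<close>, so
  both factors are explicit.\<close>

lemma peak_radial:
  assumes "n \<in> A" "A \<subseteq> {m..}" "0 < N"
  shows "(\<lambda>j. peak N A (radial j (w n))) \<longlonglongrightarrow> 1"
proof -
  have n: "m \<le> n" using assms by auto
  let ?t = "\<lambda>j. of_real (1 - 1 / real (j + 2)) :: complex"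
  have "(\<lambda>j. 1 / real (j + 2)) \<longlonglongrightarrow> 0"
    using LIMSEQ_ignore_initial_segment[OF lim_1_over_n, of 2] by simp
  then have t: "?t \<longlonglongrightarrow> of_real (1 - 0)" by (intro tendsto_intros)
  have "peak N A (radial j (w n))
      = exp (of_real (real N / s powr p) * (?t j * of_real R - of_real R)) * ?t j ^ N" for j
  proof -
    have "lin (radial j (w n)) = ?t j * of_real R"
      unfolding radial_def using lp_dual_scale[OF lin_dual w_lp[OF n]] lin_w[OF n] by simp
    moreover have "power_sum N A (radial j (w n)) = ?t j ^ N * (of_real s * \<xi>) ^ N"
      unfolding radial_def using power_sum_w[OF assms]
      by (subst power_sum_scale) (auto simp: sums_iff power_sum_def)
    ultimately show ?thesis using s\<xi> by (simp add: peak_def)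
  qed
  moreover have "(\<lambda>j. exp (of_real (real N / s powr p) * (?t j * of_real R - of_real R)) * ?t j ^ N)
      \<longlonglongrightarrow> exp (of_real (real N / s powr p) * (of_real (1 - 0) * of_real R - of_real R)) * of_real (1 - 0) ^ N"
    by (intro tendsto_intros t)
  ultimately show ?thesis by simp
qed

section \<open>Size of the peak functions and near-maximal points\<close>

lemma Re_lin:
  "Re (lin x) = (p - 1) / p * R + (\<Sum>k<m. norm (x k) powr p) / p - (\<Sum>k<m. young_gap p (z k) (x k))"
  unfolding lin_def R_def young_gap_def
  by (simp add: sum.distrib sum_subtractf sum_distrib_left sum_divide_distrib)

text \<open>The gap sum is kept as a separate factor: it is what forces the coordinates below
  \<open>m\<close> towards those of \<open>z\<close> when the modulus is nearly 1.\<close>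

lemma peak_norm_le:
  assumes x: "x \<in> lp_ball p" and N: "p \<le> real N" and A: "A \<subseteq> {m..}"
  shows "norm (peak N A x) \<le> (lp_tail p m x / s powr p * exp (1 - lp_tail p m x / s powr p)) powr (real N / p)
    * exp (- (real N / s powr p * (\<Sum>k<m. young_gap p (z k) (x k))))"
proof -
  define T where "T = lp_tail p m x"
  define G where "G = (\<Sum>k<m. young_gap p (z k) (x k))"
  define \<kappa> where "\<kappa> = real N / s powr p"
  have T: "0 \<le> T" unfolding T_def by (rule lp_tail_nonneg[OF lp_ball_lp[OF x]])
  have \<kappa>: "0 \<le> \<kappa>" by (simp add: \<kappa>_def)
  \<comment> \<open>Uses \<open>R = 1 - s powr p\<close> and that head and tail of \<open>x\<close>
    have total mass at most 1.\<close>
  have "p * (Re (lin x) - R) \<le> s powr p - T - p * G"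
  proof -
    have "p * Re (lin x) = (p - 1) * R + (\<Sum>k<m. norm (x k) powr p) - p * G"
      unfolding Re_lin G_def using p0 by (simp add: distrib_left right_diff_distrib)
    moreover have "(p - 1) * R = p * R - R" by (simp add: algebra_simps)
    ultimately show ?thesis
      using lp_tail_le_1[OF x p0, of m] R_eq unfolding T_def right_diff_distrib by linarith
  qed
  then have "Re (lin x) - R \<le> (s powr p - T) / p - G"
    using p0 by (simp add: field_simps)
  then have "\<kappa> * (Re (lin x) - R) \<le> \<kappa> * ((s powr p - T) / p - G)"
    using \<kappa> by (intro mult_left_mono) auto
  also have "\<dots> = (1 - T / s powr p) * (real N / p) - \<kappa> * G"
    using sp p0 by (simp add: \<kappa>_def field_simps)
  finally have e: "exp (\<kappa> * (Re (lin x) - R)) \<le> exp ((1 - T / s powr p) * (real N / p)) * exp (- (\<kappa> * G))"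
    by (simp add: exp_add[symmetric])
  have "norm (power_sum N A x / (of_real s * \<xi>) ^ N) \<le> T powr (real N / p) / s ^ N"
    unfolding norm_divide norm_power norm_s\<xi> T_def
    using power_sum_norm_le[OF x p0 N A] s by (intro divide_right_mono) auto
  also have "s ^ N = (s powr p) powr (real N / p)"
    using s p0 by (simp add: powr_powr powr_realpow)
  also have "T powr (real N / p) / (s powr p) powr (real N / p) = (T / s powr p) powr (real N / p)"
    using T by (simp add: powr_divide)
  finally have q: "norm (power_sum N A x / (of_real s * \<xi>) ^ N) \<le> (T / s powr p) powr (real N / p)" .
  have "norm (peak N A x) = exp (\<kappa> * (Re (lin x) - R)) * norm (power_sum N A x / (of_real s * \<xi>) ^ N)"
    unfolding peak_def norm_mult norm_exp_eq_Re \<kappa>_def[symmetric] by simp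
  also have "\<dots> \<le> (exp ((1 - T / s powr p) * (real N / p)) * exp (- (\<kappa> * G)))
      * (T / s powr p) powr (real N / p)"
    by (intro mult_mono e q) auto
  also have "exp ((1 - T / s powr p) * (real N / p)) = exp (1 - T / s powr p) powr (real N / p)"
    by (simp add: powr_def)
  also have "exp (1 - T / s powr p) powr (real N / p) * exp (- (\<kappa> * G)) * (T / s powr p) powr (real N / p)
      = (T / s powr p * exp (1 - T / s powr p)) powr (real N / p) * exp (- (\<kappa> * G))"
    by (simp only: powr_mult mult_ac)
  finally show ?thesis by (simp only: T_def G_def \<kappa>_def)
qed

lemma gap_sum_nonneg: "0 \<le> (\<Sum>k<m. young_gap p (z k) (x k))"
  by (intro sum_nonneg young_gap_nonneg p)

lemma tail_factor:
  assumes "x \<in> lp_ball p"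
  shows "0 \<le> lp_tail p m x / s powr p * exp (1 - lp_tail p m x / s powr p)"
    and "lp_tail p m x / s powr p * exp (1 - lp_tail p m x / s powr p) \<le> 1"
  using lp_tail_nonneg[OF lp_ball_lp[OF assms], of m] sp
  by (auto intro!: x_exp_le_1 simp del: times_divide_eq_left)

lemma peak_norm_le_1:
  assumes "x \<in> lp_ball p" "p \<le> real N" "A \<subseteq> {m..}"
  shows "norm (peak N A x) \<le> 1"
proof (rule order_trans[OF peak_norm_le[OF assms]], rule mult_le_one)
  show "(lp_tail p m x / s powr p * exp (1 - lp_tail p m x / s powr p)) powr (real N / p) \<le> 1"
    using tail_factor[OF assms(1)] p0 by (intro powr_le1) auto
  show "exp (- (real N / s powr p * (\<Sum>k<m. young_gap p (z k) (x k)))) \<le> 1"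
    using gap_sum_nonneg by simp
qed simp

text \<open>Both factors of the norm bound are at most 1, so each tends to 1. The first gives the
  limit of the tail by the equality case of \<open>\<tau> * exp (1 - \<tau>) \<le> 1\<close>; the
  second makes the Young gaps vanish and fixes the coordinates below \<open>m\<close>. Then the
  exponential tends to 1, and the power sum is obtained by division.\<close>

lemma peak_tendsto_1D:
  assumes x: "\<And>j::nat. x j \<in> lp_ball p" and N: "p \<le> real N" and A: "A \<subseteq> {m..}"
    and lim: "(\<lambda>j. peak N A (x j)) \<longlonglongrightarrow> 1"
  shows "(\<lambda>j. lp_tail p m (x j)) \<longlonglongrightarrow> s powr p"
    and "\<And>k. k < m \<Longrightarrow> (\<lambda>j. x j k) \<longlonglongrightarrow> z k"
    and "(\<lambda>j. power_sum N A (x j)) \<longlonglongrightarrow> (of_real s * \<xi>) ^ N"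
proof -
  define \<tau> where "\<tau> j = lp_tail p m (x j) / s powr p" for j
  define B where "B j = \<tau> j * exp (1 - \<tau> j)" for j
  define G where "G j = (\<Sum>k<m. young_gap p (z k) (x j k))" for j
  define \<kappa> where "\<kappa> = real N / s powr p"
  have \<kappa>: "0 < \<kappa>" using N p sp by (simp add: \<kappa>_def)
  have Np: "0 < real N / p" using N p by simp
  have B: "0 \<le> B j" "B j \<le> 1" for j using tail_factor[OF x, of j] by (auto simp: B_def \<tau>_def)
  have G: "0 \<le> G j" for j using gap_sum_nonneg by (simp add: G_def)
  have le: "norm (peak N A (x j)) \<le> B j powr (real N / p) * exp (- (\<kappa> * G j))" for j
    using peak_norm_le[OF x N A, of j] by (simp add: B_def \<tau>_def G_def \<kappa>_def)
  have B1: "B j powr (real N / p) \<le> 1" for j using B[of j] Np by (intro powr_le1) auto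
  have E1: "exp (- (\<kappa> * G j)) \<le> 1" for j using \<kappa> G[of j] by simp
  have nlim: "(\<lambda>j. norm (peak N A (x j))) \<longlonglongrightarrow> 1" using tendsto_norm[OF lim] by simp
  have "(\<lambda>j. B j powr (real N / p)) \<longlonglongrightarrow> 1"
  proof (rule tendsto_sandwich[OF _ _ nlim tendsto_const])
    have "norm (peak N A (x j)) \<le> B j powr (real N / p)" for j
      using le[of j] mult_left_le[OF E1[of j], of "B j powr (real N / p)"] by simp
    then show "eventually (\<lambda>j. norm (peak N A (x j)) \<le> B j powr (real N / p)) sequentially" by simp
  qed (use B1 in simp)
  \<comment> \<open>Raising to the power \<open>p / N\<close> undoes the exponent, so
    \<open>B\<close> itself tends to 1.\<close>
  then have "(\<lambda>j. (B j powr (real N / p)) powr (p / real N)) \<longlonglongrightarrow> 1 powr (p / real N)"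
    by (intro tendsto_intros) auto
  moreover have "(B j powr (real N / p)) powr (p / real N) = B j" for j
  proof -
    have "N \<noteq> 0" using N p by auto
    then show ?thesis using B[of j] p0 by (simp add: powr_powr)
  qed
  ultimately have Blim: "B \<longlonglongrightarrow> 1" by simp
  have "(\<lambda>j. exp (- (\<kappa> * G j))) \<longlonglongrightarrow> 1"
  proof (rule tendsto_sandwich[OF _ _ nlim tendsto_const])
    have "norm (peak N A (x j)) \<le> exp (- (\<kappa> * G j))" for j
      by (rule order_trans[OF le mult_left_le_one_le]) (use B1 in auto)
    then show "eventually (\<lambda>j. norm (peak N A (x j)) \<le> exp (- (\<kappa> * G j))) sequentially" by simp
  qed (use E1 in simp)
  then have "(\<lambda>j. ln (exp (- (\<kappa> * G j)))) \<longlonglongrightarrow> ln 1" by (intro tendsto_intros) auto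
  then have "(\<lambda>j. - inverse \<kappa> * (- (\<kappa> * G j))) \<longlonglongrightarrow> - inverse \<kappa> * 0" by (intro tendsto_intros) simp
  then have Glim: "G \<longlonglongrightarrow> 0" using \<kappa> by (simp add: mult.assoc[symmetric])
  have "\<tau> \<longlonglongrightarrow> 1"
  proof (rule tendsto_unique_zero[of "{0..1 / s powr p}" "\<lambda>u. 1 - u * exp (1 - u)"])
    show "\<tau> j \<in> {0..1 / s powr p}" for j
    proof -
      have "lp_tail p m (x j) \<le> 1"
        using lp_tail_le_1[OF x p0, of j m] sum_nonneg[of "{..<m}" "\<lambda>k. norm (x j k) powr p"] by simp
      then show ?thesis
        using lp_tail_nonneg[OF lp_ball_lp[OF x]] sp by (auto simp: \<tau>_def divide_right_mono)
    qed
    show "(\<lambda>j. 1 - \<tau> j * exp (1 - \<tau> j)) \<longlonglongrightarrow> 0"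
      using tendsto_diff[OF tendsto_const[of 1] Blim] by (simp add: B_def)
  qed (auto intro!: continuous_intros intro: x_exp_eq_1D)
  then have "(\<lambda>j. \<tau> j * s powr p) \<longlonglongrightarrow> 1 * s powr p" by (intro tendsto_intros)
  then show "(\<lambda>j. lp_tail p m (x j)) \<longlonglongrightarrow> s powr p" using sp by (simp add: \<tau>_def)
  show xlim: "(\<lambda>j. x j k) \<longlonglongrightarrow> z k" if k: "k < m" for k
  proof (rule tendsto_unique_zero[of "cball 0 1" "young_gap p (z k)"])
    show "x j k \<in> cball 0 1" for j
      using lp_ball_norm_le_1[OF x p0] by simp
    show "(\<lambda>j. young_gap p (z k) (x j k)) \<longlonglongrightarrow> 0"
    proof (rule tendsto_sandwich[OF _ _ tendsto_const Glim])
      show "eventually (\<lambda>j. young_gap p (z k) (x j k) \<le> G j) sequentially"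
        unfolding G_def using k young_gap_nonneg[OF p]
        by (intro always_eventually allI member_le_sum) auto
    qed (use young_gap_nonneg[OF p] in simp)
  qed (auto intro: young_gap_continuous[OF p] young_gap_eq_0D[OF p])
  have "(\<lambda>j. lin (x j)) \<longlonglongrightarrow> of_real R"
    unfolding lin_def lin_z[symmetric] by (intro tendsto_intros xlim) auto
  then have elim: "(\<lambda>j. exp (of_real \<kappa> * (lin (x j) - of_real R))) \<longlonglongrightarrow> exp (of_real \<kappa> * (of_real R - of_real R))"
    by (intro tendsto_intros)
  have "(\<lambda>j. peak N A (x j) / exp (of_real \<kappa> * (lin (x j) - of_real R)) * (of_real s * \<xi>) ^ N)
      \<longlonglongrightarrow> 1 / exp (of_real \<kappa> * (of_real R - of_real R)) * (of_real s * \<xi>) ^ N"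
    by (intro tendsto_mult tendsto_divide lim elim tendsto_const) auto
  moreover have "peak N A (x j) / exp (of_real \<kappa> * (lin (x j) - of_real R)) * (of_real s * \<xi>) ^ N
      = power_sum N A (x j)" for j
    using s\<xi> by (simp add: peak_def \<kappa>_def)
  ultimately show "(\<lambda>j. power_sum N A (x j)) \<longlonglongrightarrow> (of_real s * \<xi>) ^ N" by simp
qed

text \<open>Three groups of coordinates: those below \<open>m\<close>, those from \<open>m\<close>
  on other than \<open>n\<close>, where \<open>w n\<close> vanishes, and \<open>n\<close>
  itself.\<close>

lemma lp_dist_w:
  assumes x: "x \<in> lp p" and n: "m \<le> n"
  shows "lp_dist p x (w n) = ((\<Sum>k<m. norm (x k - z k) powr p)
    + (lp_tail p m x - norm (x n) powr p) + norm (x n - of_real s * \<xi>) powr p) powr (1 / p)"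
proof -
  have "(\<lambda>k. (if k \<in> {..<m} then norm (x k - z k) powr p else 0)
      + ((if m \<le> k then norm (x k) powr p else 0) - (if k = n then norm (x k) powr p else 0))
      + (if k = n then norm (x k - of_real s * \<xi>) powr p else 0))
      sums ((\<Sum>k<m. norm (x k - z k) powr p)
    + (lp_tail p m x - norm (x n) powr p) + norm (x n - of_real s * \<xi>) powr p)"
    by (intro sums_add sums_diff lp_tail_sums x sums_If_finite_set sums_single) auto
  moreover have "(if k \<in> {..<m} then norm (x k - z k) powr p else 0)
      + ((if m \<le> k then norm (x k) powr p else 0) - (if k = n then norm (x k) powr p else 0))
      + (if k = n then norm (x k - of_real s * \<xi>) powr p else 0) = norm (x k - w n k) powr p" for k
    using w_less[OF n, of k] w_ge[of k n] n by (cases "k < m") auto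
  ultimately show ?thesis
    by (simp add: lp_dist_def lp_norm_def sums_iff)
qed

text \<open>Both exponents \<open>N\<close> and \<open>N + 1\<close> are needed: together they determine the dominating
  coordinate, and not only one of its powers.\<close>

lemma peak_approach:
  assumes x: "\<And>j::nat. x j \<in> lp_ball p" and N: "p < real N" and A: "A \<subseteq> {m..}" "A \<noteq> {}"
    and lim: "(\<lambda>j. peak N A (x j)) \<longlonglongrightarrow> 1" "(\<lambda>j. peak (Suc N) A (x j)) \<longlonglongrightarrow> 1"
  obtains n where "\<And>j. n j \<in> A" "(\<lambda>j. lp_dist p (x j) (w (n j))) \<longlonglongrightarrow> 0"
proof -
  have N': "p \<le> real N" "p \<le> real (Suc N)" using N by auto
  note D = peak_tendsto_1D[OF x N'(1) A(1) lim(1)]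
  note D' = peak_tendsto_1D[OF x N'(2) A(1) lim(2)]
  define T where "T j = lp_tail p m (x j)" for j
  \<comment> \<open>The term \<open>1 / Suc j\<close> is the positive slack needed to select a large
    coordinate and vanishes in the limit. Raising to the power \<open>q\<close> turns the exponent
    \<open>N - p\<close> of the selection bound into \<open>p\<close>.\<close>
  define c where "c j = norm (power_sum N A (x j)) / (T j + 1 / real (Suc j))" for j
  define q where "q = p / (real N - p)"
  have q: "0 < q" using N p by (simp add: q_def)
  have "\<exists>n\<in>A. c j \<le> norm (x j n) powr (real N - p)" for j
    unfolding c_def T_def by (rule power_sum_coord_ge[OF x p0 N'(1) A]) simp
  then obtain n where n: "\<And>j. n j \<in> A" "\<And>j. c j \<le> norm (x j (n j)) powr (real N - p)"
    by metis
  have nm: "m \<le> n j" for j using n(1)[of j] A by auto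
  define y where "y j = x j (n j)" for j
  have T: "0 \<le> T j" for j unfolding T_def by (rule lp_tail_nonneg[OF lp_ball_lp[OF x]])
  have c0: "0 \<le> c j" for j unfolding c_def using T[of j] by simp
  have Tlim: "T \<longlonglongrightarrow> s powr p" using D(1) by (simp add: T_def[abs_def])
  have "(\<lambda>j. T j + 1 / real (Suc j)) \<longlonglongrightarrow> s powr p + 0"
    using LIMSEQ_inverse_real_of_nat by (intro tendsto_add Tlim) (simp add: inverse_eq_divide)
  then have "c \<longlonglongrightarrow> norm ((of_real s * \<xi>) ^ N) / (s powr p + 0)"
    unfolding c_def[abs_def] using sp by (intro tendsto_divide tendsto_norm D(3)) auto
  then have clim: "c \<longlonglongrightarrow> s powr (real N - p)"
    using s by (simp add: norm_power norm_s\<xi> powr_diff powr_realpow)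
  then have "(\<lambda>j. c j powr q) \<longlonglongrightarrow> (s powr (real N - p)) powr q"
    using s by (intro tendsto_intros) auto
  also have "(s powr (real N - p)) powr q = s powr p"
    using N by (simp add: powr_powr q_def)
  finally have clim': "(\<lambda>j. c j powr q) \<longlonglongrightarrow> s powr p" .
  \<comment> \<open>The selected coordinate is squeezed between \<open>c powr q\<close> and the
    whole tail, so in the limit it carries all the tail mass.\<close>
  have ylim: "(\<lambda>j. norm (y j) powr p) \<longlonglongrightarrow> s powr p"
  proof (rule tendsto_sandwich[OF _ _ clim' Tlim])
    have "c j powr q \<le> (norm (y j) powr (real N - p)) powr q" for j
      using n(2)[of j] c0 q by (intro powr_mono2) (auto simp: y_def)
    also have "\<And>j. (norm (y j) powr (real N - p)) powr q = norm (y j) powr p"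
      using N by (simp add: powr_powr q_def)
    finally show "eventually (\<lambda>j. c j powr q \<le> norm (y j) powr p) sequentially" by simp
    show "eventually (\<lambda>j. norm (y j) powr p \<le> T j) sequentially"
      using coord_le_lp_tail[OF lp_ball_lp[OF x] nm] by (simp add: y_def T_def)
  qed
  have rest: "(\<lambda>j. T j - norm (y j) powr p) \<longlonglongrightarrow> 0"
    using tendsto_diff[OF Tlim ylim] by simp
  have pw: "(\<lambda>j. y j ^ M) \<longlonglongrightarrow> (of_real s * \<xi>) ^ M"
    if M: "p \<le> real M" and l: "(\<lambda>j. power_sum M A (x j)) \<longlonglongrightarrow> (of_real s * \<xi>) ^ M" for M
  proof -
    have "(\<lambda>j. power_sum M A (x j) - y j ^ M) \<longlonglongrightarrow> 0"
    proof (rule Lim_null_comparison[OF _ rest])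
      show "eventually (\<lambda>j. norm (power_sum M A (x j) - y j ^ M) \<le> T j - norm (y j) powr p) sequentially"
        unfolding y_def T_def using power_sum_single_diff[OF x p0 M A(1) n(1)] by simp
    qed
    from tendsto_diff[OF l this] show ?thesis by simp
  qed
  \<comment> \<open>Dividing consecutive powers recovers the coordinate itself; at zero this agrees
    with the convention \<open>0 / 0 = 0\<close>.\<close>
  have "(\<lambda>j. y j ^ Suc N / y j ^ N) \<longlonglongrightarrow> (of_real s * \<xi>) ^ Suc N / (of_real s * \<xi>) ^ N"
    using s\<xi> by (intro tendsto_divide pw N' D(3) D'(3)) auto
  moreover have "u ^ Suc N / u ^ N = u" for u :: complex
    using N p by (cases "u = 0") auto
  ultimately have ylim': "y \<longlonglongrightarrow> of_real s * \<xi>" by (simp only:)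
  have "(\<lambda>j. ((\<Sum>k<m. norm (x j k - z k) powr p) + (T j - norm (y j) powr p)
      + norm (y j - of_real s * \<xi>) powr p) powr (1 / p))
      \<longlonglongrightarrow> ((\<Sum>k<m. norm (z k - z k) powr p) + 0 + norm (of_real s * \<xi> - of_real s * \<xi>) powr p) powr (1 / p)"
  proof (rule tendsto_powr'[OF tendsto_add[OF tendsto_add[OF tendsto_sum rest]] tendsto_const])
    show "(\<lambda>j. norm (x j k - z k) powr p) \<longlonglongrightarrow> norm (z k - z k) powr p" if "k \<in> {..<m}" for k
      using that p0 by (intro tendsto_powr' tendsto_intros D(2)) auto
    show "(\<lambda>j. norm (y j - of_real s * \<xi>) powr p) \<longlonglongrightarrow> norm (of_real s * \<xi> - of_real s * \<xi>) powr p"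
      using p0 by (intro tendsto_powr' tendsto_intros ylim') auto
    have "0 \<le> T j - norm (y j) powr p" for j
      using coord_le_lp_tail[OF lp_ball_lp[OF x] nm] by (simp add: y_def T_def)
    then show "(\<Sum>k<m. norm (z k - z k) powr p) + 0 + norm (of_real s * \<xi> - of_real s * \<xi>) powr p \<noteq> 0 \<or>
      0 < 1 / p \<and> eventually (\<lambda>j. 0 \<le> (\<Sum>k<m. norm (x j k - z k) powr p) + (T j - norm (y j) powr p)
      + norm (y j - of_real s * \<xi>) powr p) sequentially"
      using p0 by (intro disjI2 conjI always_eventually allI add_nonneg_nonneg sum_nonneg) auto
  qed
  then have "(\<lambda>j. lp_dist p (x j) (w (n j))) \<longlonglongrightarrow> 0"
    using lp_dist_w[OF lp_ball_lp[OF x] nm] by (simp add: T_def y_def)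
  with n(1) show ?thesis by (rule that)
qed

text \<open>Quantitative form of 1 being an extreme point of the disc:
  \<open>|a - 1|^2 \<le> 2 - 2 * Re a\<close>, and \<open>Re b \<le> 1\<close> bounds this by the
  deficit of the average.\<close>

lemma near_1_of_average:
  fixes a b :: complex
  assumes "norm a \<le> 1" "norm b \<le> 1"
  shows "(norm (a - 1))\<^sup>2 \<le> 4 * norm ((a + b) / 2 - 1)"
proof -
  have "(norm (a - 1))\<^sup>2 = (norm a)\<^sup>2 + 1 - 2 * Re a"
    unfolding cmod_power2 by (simp add: power2_eq_square algebra_simps)
  also have "(norm a)\<^sup>2 \<le> 1" using assms by (simp add: power_le_one)
  also have "Re b \<le> 1" using complex_Re_le_cmod[of b] assms by linarith
  then have "1 + 1 - 2 * Re a \<le> 4 * (1 - Re ((a + b) / 2))" by (simp add: field_simps)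
  also have "\<dots> \<le> 4 * norm ((a + b) / 2 - 1)"
  proof -
    have "1 - Re c \<le> norm (c - 1)" for c
      using abs_Re_le_cmod[of "c - 1"] by simp
    from this[of "(a + b) / 2"] show ?thesis by (rule mult_left_mono) simp
  qed
  finally show ?thesis by simp
qed

text \<open>Makes the sequential statement uniform: failure for every \<open>1 / Suc j\<close> would
  give a sequence along which both peak functions tend to 1 while staying at distance at least
  \<open>\<epsilon>\<close> from all \<open>w n\<close> with \<open>n\<close> in
  \<open>A\<close>.\<close>

lemma near_peak:
  assumes N: "p < real N" and A: "A \<subseteq> {m..}" "A \<noteq> {}" and "0 < \<epsilon>"
  obtains \<eta> where "0 < \<eta>"
    "\<forall>x\<in>lp_ball p. norm ((peak N A x + peak (Suc N) A x) / 2 - 1) < \<eta> \<longrightarrow>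
       (\<exists>n\<in>A. lp_dist p x (w n) < \<epsilon>)"
proof -
  define P where "P x = (peak N A x + peak (Suc N) A x) / 2" for x
  have "\<exists>\<eta>>0. \<forall>x\<in>lp_ball p. norm (P x - 1) < \<eta> \<longrightarrow> (\<exists>n\<in>A. lp_dist p x (w n) < \<epsilon>)"
  proof (rule ccontr)
    assume contra: "\<not> ?thesis"
    have "\<exists>x\<in>lp_ball p. norm (P x - 1) < 1 / real (Suc j) \<and> (\<forall>n\<in>A. \<not> lp_dist p x (w n) < \<epsilon>)" for j
    proof -
      have "0 < 1 / real (Suc j)" by simp
      with contra show ?thesis by blast
    qed
    then obtain x where x: "\<And>j. x j \<in> lp_ball p" "\<And>j. norm (P (x j) - 1) < 1 / real (Suc j)"
      "\<And>j n. n \<in> A \<Longrightarrow> \<not> lp_dist p (x j) (w n) < \<epsilon>" by metis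
    have lim: "(\<lambda>j. a j) \<longlonglongrightarrow> 1"
      if a: "\<And>j. (norm (a j - 1))\<^sup>2 \<le> 4 * norm (P (x j) - 1)" for a :: "nat \<Rightarrow> complex"
    proof -
      have z: "(\<lambda>j. 4 * (1 / real (Suc j))) \<longlonglongrightarrow> 0"
        using tendsto_mult_right_zero[OF LIMSEQ_inverse_real_of_nat, of 4] by (simp add: inverse_eq_divide)
      have "(norm (a j - 1))\<^sup>2 \<le> 4 * (1 / real (Suc j))" for j
        using a[of j] x(2)[of j] by linarith
      then have "(\<lambda>j. (norm (a j - 1))\<^sup>2) \<longlonglongrightarrow> 0"
        by (intro Lim_null_comparison[OF _ z] always_eventually) simp
      then have "(\<lambda>j. sqrt ((norm (a j - 1))\<^sup>2)) \<longlonglongrightarrow> sqrt 0" by (rule tendsto_real_sqrt)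
      then have "(\<lambda>j. norm (a j - 1)) \<longlonglongrightarrow> 0" by simp
      then show ?thesis by (simp only: tendsto_norm_zero_iff LIM_zero_iff)
    qed
    have le: "norm (peak M A (x j)) \<le> 1" if "M = N \<or> M = Suc N" for M j
      using that N by (intro peak_norm_le_1 x A) auto
    have "(\<lambda>j. peak N A (x j)) \<longlonglongrightarrow> 1"
      using le by (intro lim) (simp add: P_def near_1_of_average)
    moreover have "(\<lambda>j. peak (Suc N) A (x j)) \<longlonglongrightarrow> 1"
      using le by (intro lim)
        (simp add: P_def near_1_of_average add.commute[of "peak N A _" "peak (Suc N) A _"])
    ultimately obtain n where n: "\<And>j. n j \<in> A" "(\<lambda>j. lp_dist p (x j) (w (n j))) \<longlonglongrightarrow> 0"
      using peak_approach[where x = x, OF x(1) N A] by blast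
    have "eventually (\<lambda>j. lp_dist p (x j) (w (n j)) < \<epsilon>) sequentially"
      using order_tendstoD(2)[OF n(2) \<open>0 < \<epsilon>\<close>] .
    then show False using x(3)[OF n(1)] by (auto simp: eventually_sequentially)
  qed
  then show ?thesis using that unfolding P_def by blast
qed

end

section \<open>Limit characters\<close>

lemma lp_unit_combo:
  assumes p: "0 < p" and S: "finite S" and c: "\<And>n. n \<in> S \<Longrightarrow> norm (c n) = 1"
  shows "(\<lambda>k. \<Sum>n\<in>S. c n * lp_unit n k) \<in> lp p"
    and "lp_norm p (\<lambda>k. \<Sum>n\<in>S. c n * lp_unit n k) = real (card S) powr (1 / p)"
proof -
  have "(\<Sum>n\<in>S. c n * lp_unit n k) = (if k \<in> S then c k else 0)" for k
    using S by (simp add: lp_unit_def if_distrib[of "(*) _"] cong: if_cong)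
  then have "norm (\<Sum>n\<in>S. c n * lp_unit n k) powr p = (if k \<in> S then 1 else 0)" for k
    using c by simp
  then have "(\<lambda>k. norm (\<Sum>n\<in>S. c n * lp_unit n k) powr p) sums real (card S)"
    using sums_If_finite_set[OF S, of "\<lambda>_. 1::real"] by simp
  then show "(\<lambda>k. \<Sum>n\<in>S. c n * lp_unit n k) \<in> lp p"
    and "lp_norm p (\<lambda>k. \<Sum>n\<in>S. c n * lp_unit n k) = real (card S) powr (1 / p)"
    by (auto simp: lp_def lp_norm_def sums_iff)
qed

lemma lp_unit_lp: "lp_unit n \<in> lp p"
proof -
  have "(\<lambda>k. norm (lp_unit n k) powr p) = (\<lambda>k. if k = n then 1 else 0)"
    by (auto simp: lp_unit_def)
  then show ?thesis using sums_single[of n "\<lambda>_. 1::real"] by (auto simp: lp_def sums_iff)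
qed

lemma lp_dual_sum_unit:
  assumes p: "1 \<le> p" and L: "L \<in> lp_dual p" and S: "finite S"
  shows "(\<lambda>k. \<Sum>n\<in>S. c n * lp_unit n k) \<in> lp p
    \<and> L (\<lambda>k. \<Sum>n\<in>S. c n * lp_unit n k) = (\<Sum>n\<in>S. c n * L (lp_unit n))"
  using S
proof induction
  case empty
  then show ?case using lp_dual_scale[OF L lp_zero, of 0] by (simp add: lp_zero)
next
  case (insert a S)
  then show ?case
    using lp_dual_add[OF L lp_scale[OF lp_unit_lp, of "c a" a], of "\<lambda>k. \<Sum>n\<in>S. c n * lp_unit n k"]
      lp_add[OF p lp_scale[OF lp_unit_lp, of "c a" a], of "\<lambda>k. \<Sum>n\<in>S. c n * lp_unit n k"]
      lp_dual_scale[OF L lp_unit_lp, of "c a" a] by simp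
qed

text \<open>If \<open>\<bar>L e\<^sub>n\<bar> \<ge> \<epsilon>\<close> held on a set \<open>S\<close> with \<open>k\<close> elements, then testing \<open>L\<close> on a sum of unimodular
  multiples of the \<open>e\<^sub>n\<close> would give \<open>k * \<epsilon> \<le> C * k powr (1 / p)\<close>, which bounds \<open>k\<close>.\<close>

lemma lp_dual_unit_tendsto_0:
  assumes p: "1 < p" and L: "L \<in> lp_dual p"
  shows "(\<lambda>n. L (lp_unit n)) \<longlonglongrightarrow> 0"
proof (rule LIMSEQ_I)
  fix \<epsilon> :: real assume \<epsilon>: "0 < \<epsilon>"
  have p1: "1 \<le> p" "0 < p" using p by auto
  obtain C where C: "0 < C" "\<And>x. x \<in> lp p \<Longrightarrow> norm (L x) \<le> C * lp_norm p x"
    using lp_dual_bound[OF L] by blast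
  \<comment> \<open>\<open>p > 1\<close> makes this exponent positive, so \<open>k powr a\<close>
    can outgrow \<open>C / \<epsilon>\<close>.\<close>
  define a where "a = 1 - 1 / p"
  have a: "0 < a" using p by (simp add: a_def)
  define S where "S = {n. \<epsilon> \<le> norm (L (lp_unit n))}"
  have "finite S"
  proof (rule ccontr)
    assume "infinite S"
    obtain k :: nat where k: "(C / \<epsilon> + 1) powr (1 / a) \<le> real k" using real_arch_simple by blast
    obtain T where T: "finite T" "card T = k" "T \<subseteq> S"
      using infinite_arbitrarily_large[OF \<open>infinite S\<close>] by blast
    have pos: "0 < C / \<epsilon> + 1" using C(1) \<epsilon> by (simp add: add_pos_pos)
    then have k0: "0 < real k" using k by (metis powr_gt_zero order_less_le_trans less_irrefl)
    have "((C / \<epsilon> + 1) powr (1 / a)) powr a \<le> real k powr a"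
      using k a by (intro powr_mono2) auto
    then have ka: "C / \<epsilon> + 1 \<le> real k powr a" using pos a by (simp add: powr_powr)
    \<comment> \<open>Conjugate signs turn each \<open>c n * L (lp_unit n)\<close> into its modulus,
      so nothing cancels in the sum.\<close>
    define c where "c n = cnj (sgn (L (lp_unit n)))" for n
    have ne: "L (lp_unit n) \<noteq> 0" if "n \<in> T" for n using that T(3) \<epsilon> by (auto simp: S_def)
    have c1: "norm (c n) = 1" if "n \<in> T" for n using ne[OF that] by (simp add: c_def norm_sgn)
    have cL: "c n * L (lp_unit n) = of_real (norm (L (lp_unit n)))" if "n \<in> T" for n
    proof -
      have "c n * L (lp_unit n) = (L (lp_unit n) * cnj (L (lp_unit n))) / of_real (norm (L (lp_unit n)))"
        by (simp add: c_def sgn_eq)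
      also have "\<dots> = of_real (norm (L (lp_unit n)))"
        unfolding complex_norm_square[symmetric] using ne[OF that] by (simp add: power2_eq_square)
      finally show ?thesis .
    qed
    have "real k * \<epsilon> \<le> (\<Sum>n\<in>T. norm (L (lp_unit n)))"
      using sum_bounded_below[of T \<epsilon> "\<lambda>n. norm (L (lp_unit n))"] T by (auto simp: S_def)
    also have "\<dots> = norm (\<Sum>n\<in>T. c n * L (lp_unit n))"
      using cL by (simp add: of_real_sum[symmetric] sum_nonneg del: of_real_sum)
    also have "\<dots> = norm (L (\<lambda>k. \<Sum>n\<in>T. c n * lp_unit n k))"
      using lp_dual_sum_unit[OF p1(1) L T(1)] by simp
    also have "\<dots> \<le> C * real k powr (1 / p)"
      using C(2)[OF lp_unit_combo(1)[OF p1(2) T(1) c1]] lp_unit_combo(2)[OF p1(2) T(1) c1] T(2) by simp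
    finally have "real k * \<epsilon> \<le> C * real k powr (1 / p)" .
    moreover have "real k = real k powr a * real k powr (1 / p)"
      using k0 by (simp add: powr_add[symmetric] a_def)
    ultimately have "(real k powr a * \<epsilon>) * real k powr (1 / p) \<le> C * real k powr (1 / p)"
      by (metis mult.commute mult.left_commute)
    then have "real k powr a * \<epsilon> \<le> C" using k0 by simp
    then have "real k powr a \<le> C / \<epsilon>" using \<epsilon> by (simp add: field_simps)
    then show False using ka by simp
  qed
  then obtain N where N: "\<And>n. n \<in> S \<Longrightarrow> n < N" unfolding finite_nat_set_iff_bounded by blast
  show "\<exists>N. \<forall>n\<ge>N. norm (L (lp_unit n) - 0) < \<epsilon>"
  proof (intro exI allI impI)
    fix n assume "N \<le> n"
    then have "n \<notin> S" using N by (meson not_le)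
    then show "norm (L (lp_unit n) - 0) < \<epsilon>" by (simp add: S_def not_le)
  qed
qed

section \<open>Weak-star neighborhoods and limits of evaluations\<close>

lemma spectrum_nbhd:
  assumes U: "openin (spectrum_topology p) U" and \<phi>: "\<phi> \<in> U"
  obtains J \<epsilon> where "finite J" "J \<subseteq> Au p" "0 < \<epsilon>"
    "\<forall>\<psi>\<in>spectrum p. (\<forall>g\<in>J. norm (\<psi> g - \<phi> g) < \<epsilon>) \<longrightarrow> \<psi> \<in> U"
proof -
  obtain V where V: "openin (product_topology (\<lambda>_. euclidean) (Au p)) V" "U = V \<inter> spectrum p"
    using U unfolding spectrum_topology_def openin_subtopology by blast
  have "\<phi> \<in> V" using V \<phi> by blast
  then obtain X where X: "finite {f \<in> Au p. X f \<noteq> UNIV}" "\<And>f. f \<in> Au p \<Longrightarrow> open (X f)"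
    "\<phi> \<in> Pi\<^sub>E (Au p) X" "Pi\<^sub>E (Au p) X \<subseteq> V"
    using V(1) unfolding openin_product_topology_alt by (auto simp: open_openin[symmetric])
  define J where "J = {f \<in> Au p. X f \<noteq> UNIV}"
  have "\<exists>e>0. ball (\<phi> f) e \<subseteq> X f" if "f \<in> J" for f
    using X(2)[of f] X(3) that by (auto simp: J_def open_contains_ball PiE_iff)
  then obtain e where e: "\<And>f. f \<in> J \<Longrightarrow> 0 < e f" "\<And>f. f \<in> J \<Longrightarrow> ball (\<phi> f) (e f) \<subseteq> X f"
    by metis
  \<comment> \<open>Inserting 1 keeps the minimum defined when no coordinate is constrained.\<close>
  define \<epsilon> where "\<epsilon> = Min (insert 1 (e ` J))"
  have J: "finite J" using X(1) by (simp add: J_def)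
  have \<epsilon>: "0 < \<epsilon>" unfolding \<epsilon>_def using J e(1) by (subst Min_gr_iff) auto
  have \<epsilon>_le: "\<epsilon> \<le> e f" if "f \<in> J" for f unfolding \<epsilon>_def using J that by (intro Min_le) auto
  have "\<psi> \<in> U" if \<psi>: "\<psi> \<in> spectrum p" "\<And>g. g \<in> J \<Longrightarrow> norm (\<psi> g - \<phi> g) < \<epsilon>" for \<psi>
  proof -
    have "\<psi> f \<in> X f" if "f \<in> Au p" for f
    proof (cases "f \<in> J")
      case True
      then have "dist (\<phi> f) (\<psi> f) < e f"
        using \<psi>(2)[OF True] \<epsilon>_le[OF True] by (simp add: dist_norm norm_minus_commute)
      then show ?thesis using e(2)[OF True] by auto
    next
      case False
      then show ?thesis using that by (simp add: J_def)
    qed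
    moreover have "\<psi> \<in> extensional (Au p)" using \<psi>(1) by (simp add: spectrum_def)
    ultimately have "\<psi> \<in> Pi\<^sub>E (Au p) X" by (simp add: PiE_iff)
    then show ?thesis using X(4) V(2) \<psi>(1) by blast
  qed
  moreover have "J \<subseteq> Au p" by (auto simp: J_def)
  ultimately show ?thesis using that[OF J _ \<epsilon>] by blast
qed

lemma delta_spectrum:
  assumes p: "1 \<le> p" and w: "w \<in> lp p" "lp_norm p w = 1"
  shows "delta p w \<in> spectrum p"
  unfolding spectrum_def mem_Collect_eq
proof (intro conjI ballI allI)
  show "delta p w \<in> extensional (Au p)" by (simp add: delta_def)
  show "\<exists>f\<in>Au p. delta p w f \<noteq> 0"
    using delta_const[OF p w, of 1] by (intro bexI[OF _ Au_const[where c = 1]]) simp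
qed (use delta_add delta_scale delta_mult assms in auto)

text \<open>The limit is taken for each \<open>f\<close> separately and will exist because
  \<open>F\<close> is an ultrafilter and \<open>f\<close> is bounded. Using one \<open>F\<close> for
  all \<open>f\<close> makes the limits respect the algebra operations.\<close>

definition limit_character ::
  "real \<Rightarrow> nat filter \<Rightarrow> (nat \<Rightarrow> nat \<Rightarrow> complex) \<Rightarrow> ((nat \<Rightarrow> complex) \<Rightarrow> complex) \<Rightarrow> complex" where
  "limit_character p F W = (\<lambda>f\<in>Au p. Lim F (\<lambda>n. delta p (W n) f))"

text \<open>Parallelogram identity for \<open>a\<close> and 1. Applied to values of the averaged
  peak function, it gives a bound below 1 away from the peak; applied to a character, it shows that
  modulus 1 forces the value 1.\<close>

lemma half_add_1_norm_le:
  fixes a :: complex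
  assumes "norm a \<le> 1" "\<eta> \<le> norm (a - 1)" "0 \<le> \<eta>"
  shows "(norm (1/2 * a + 1/2))\<^sup>2 \<le> 1 - \<eta>\<^sup>2 / 4"
proof -
  have "4 * (norm (1/2 * a + 1/2))\<^sup>2 + (norm (a - 1))\<^sup>2 = 2 + 2 * (norm a)\<^sup>2"
    unfolding cmod_power2 by (simp add: power2_eq_square algebra_simps)
  moreover have "\<eta>\<^sup>2 \<le> (norm (a - 1))\<^sup>2" using assms by (intro power_mono) auto
  moreover have "(norm a)\<^sup>2 \<le> 1" using assms by (simp add: power_le_one)
  ultimately show ?thesis by linarith
qed

locale peak_ultrafilter = peak_data +
  fixes F :: "nat filter"
  assumes F: "F \<noteq> bot" "F \<le> sequentially" "\<And>P. eventually P F \<or> eventually (\<lambda>n. \<not> P n) F"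
begin

abbreviation \<phi> :: "((nat \<Rightarrow> complex) \<Rightarrow> complex) \<Rightarrow> complex" where
  "\<phi> \<equiv> limit_character p F w"

text \<open>Freeness of \<open>F\<close>. The points \<open>w n\<close> are known to lie on the
  sphere only for \<open>n \<ge> m\<close>, so identities for \<open>delta p (w n)\<close> are
  available eventually.\<close>

lemma ev_ge: "eventually (\<lambda>n. i \<le> n) F"
  using filter_leD[OF F(2) eventually_ge_at_top] .

lemma \<phi>_tendsto:
  assumes f: "f \<in> Au p"
  shows "((\<lambda>n. delta p (w n) f) \<longlongrightarrow> \<phi> f) F"
proof -
  obtain C where C: "0 < C" "\<And>x. x \<in> lp_ball p \<Longrightarrow> norm (f x) \<le> C"
    using Au_bounded[OF p1 f] by blast
  have "eventually (\<lambda>n. norm (delta p (w n) f) \<le> C) F"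
    using ev_ge[of m] by eventually_elim (use delta_norm_le[OF p1 f w_lp w_norm C(2)] in blast)
  then obtain c where c: "((\<lambda>n. delta p (w n) f) \<longlongrightarrow> c) F"
    by (rule ultrafilter_limit[OF F(1) F(3)])
  then show ?thesis using tendsto_Lim[OF F(1) c] f by (simp add: limit_character_def)
qed

lemma \<phi>_eqI:
  assumes f: "f \<in> Au p" and l: "((\<lambda>n. delta p (w n) f) \<longlongrightarrow> c) F"
  shows "\<phi> f = c"
  using tendsto_unique[OF F(1) \<phi>_tendsto[OF f] l] .

lemma \<phi>_eqI':
  assumes f: "f \<in> Au p" and l: "eventually (\<lambda>n. delta p (w n) f = g n) F" and g: "(g \<longlongrightarrow> c) F"
  shows "\<phi> f = c"
  using \<phi>_eqI[OF f] tendsto_cong[OF l] g by blast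

lemma \<phi>_spectrum: "\<phi> \<in> spectrum p"
  unfolding spectrum_def mem_Collect_eq
proof (intro conjI ballI allI)
  note ev = eventually_mono[OF ev_ge[of m]]
  show "\<phi> \<in> extensional (Au p)" by (simp add: limit_character_def)
  show "\<phi> (\<lambda>x\<in>lp_ball p. f x + g x) = \<phi> f + \<phi> g" if "f \<in> Au p" "g \<in> Au p" for f g
    by (rule \<phi>_eqI'[OF Au_add[OF p1 that] ev tendsto_add[OF \<phi>_tendsto[OF that(1)] \<phi>_tendsto[OF that(2)]]])
       (rule delta_add[OF p1 that w_lp w_norm])
  show "\<phi> (\<lambda>x\<in>lp_ball p. f x * g x) = \<phi> f * \<phi> g" if "f \<in> Au p" "g \<in> Au p" for f g
    by (rule \<phi>_eqI'[OF Au_mult[OF p1 that] ev tendsto_mult[OF \<phi>_tendsto[OF that(1)] \<phi>_tendsto[OF that(2)]]])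
       (rule delta_mult[OF p1 that w_lp w_norm])
  show "\<phi> (\<lambda>x\<in>lp_ball p. c * f x) = c * \<phi> f" if "f \<in> Au p" for c f
    by (rule \<phi>_eqI'[OF Au_scale[OF p1 that] ev tendsto_mult[OF tendsto_const \<phi>_tendsto[OF that]]])
       (rule delta_scale[OF p1 that w_lp w_norm])
  have "\<phi> (\<lambda>x\<in>lp_ball p. 1) = 1"
    by (rule \<phi>_eqI'[OF Au_const ev tendsto_const]) (rule delta_const[OF p1 w_lp w_norm])
  then show "\<exists>f\<in>Au p. \<phi> f \<noteq> 0"
    by (intro bexI[OF _ Au_const[where c = 1]]) simp
qed

lemma z_lp: "z \<in> lp p"
proof -
  have "(\<lambda>k. norm (z k) powr p) = (\<lambda>k. if k \<in> {..<m} then norm (z k) powr p else 0)"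
    using supp by (auto simp: not_less)
  then show ?thesis
    unfolding lp_def mem_Collect_eq
    using sums_summable[OF sums_If_finite_set[of "{..<m}" "\<lambda>k. norm (z k) powr p"]] by simp
qed

text \<open>\<open>L (w n)\<close> differs from \<open>L z\<close> by
  \<open>s * \<xi> * L (lp_unit n)\<close>, which tends to 0 by weak nullity.\<close>

lemma \<phi>_fiber: "\<phi> \<in> fiber p z"
  unfolding fiber_def mem_Collect_eq
proof (intro conjI ballI \<phi>_spectrum)
  fix L assume L: "L \<in> lp_dual p"
  show "\<phi> (restrict L (lp_ball p)) = L z"
  proof (rule \<phi>_eqI'[OF Au_lp_dual[OF p1 L]])
    have "(\<lambda>n. L z + of_real s * \<xi> * L (lp_unit n)) \<longlonglongrightarrow> L z + of_real s * \<xi> * 0"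
      by (intro tendsto_intros lp_dual_unit_tendsto_0[OF p L])
    then show "((\<lambda>n. L z + of_real s * \<xi> * L (lp_unit n)) \<longlongrightarrow> L z) F"
      using tendsto_mono[OF F(2)] by simp
    show "eventually (\<lambda>n. delta p (w n) (restrict L (lp_ball p)) = L z + of_real s * \<xi> * L (lp_unit n)) F"
      using ev_ge[of m]
    proof eventually_elim
      case (elim n)
      have "L (w n) = L z + of_real s * \<xi> * L (lp_unit n)"
        unfolding w_def using lp_dual_add[OF L z_lp lp_scale[OF lp_unit_lp]]
          lp_dual_scale[OF L lp_unit_lp] by simp
      then show ?case using delta_lp_dual[OF p1 L w_lp[OF elim] w_norm[OF elim]] by simp
    qed
  qed
qed

lemma \<phi>_ac: "\<phi> \<in> wstar_ac p {m..} (\<lambda>n. delta p (w n))"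
  unfolding wstar_ac_def mem_Collect_eq
proof (intro conjI \<phi>_spectrum allI impI ballI)
  fix U i assume U: "openin (spectrum_topology p) U \<and> \<phi> \<in> U" and i: "i \<in> {m..}"
  obtain J \<epsilon> where J: "finite J" "J \<subseteq> Au p" "0 < \<epsilon>"
    "\<forall>\<psi>\<in>spectrum p. (\<forall>g\<in>J. norm (\<psi> g - \<phi> g) < \<epsilon>) \<longrightarrow> \<psi> \<in> U"
    by (rule spectrum_nbhd[OF conjunct1[OF U] conjunct2[OF U]])
  have "eventually (\<lambda>n. norm (delta p (w n) g - \<phi> g) < \<epsilon>) F" if "g \<in> J" for g
    using tendstoD[OF \<phi>_tendsto \<open>0 < \<epsilon>\<close>] that J(2) by (auto simp: dist_norm)
  then have "eventually (\<lambda>n. \<forall>g\<in>J. norm (delta p (w n) g - \<phi> g) < \<epsilon>) F"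
    using J(1) by (simp add: eventually_ball_finite)
  then have "eventually (\<lambda>n. i \<le> n \<and> delta p (w n) \<in> U) F"
    using ev_ge[of i]
  proof eventually_elim
    case (elim n)
    then have "m \<le> n" using i by simp
    then show ?case using elim J(4) delta_spectrum[OF p1 w_lp w_norm] by blast
  qed
  then obtain n where "i \<le> n" "delta p (w n) \<in> U"
    using eventually_happens'[OF F(1)] by blast
  then show "\<exists>j\<in>{m..}. i \<le> j \<and> delta p (w j) \<in> U"
    using i by (intro bexI[of _ n]) auto
qed

text \<open>Tells apart the characters for different \<open>\<xi>\<close>. From \<open>m\<close> on,
  \<open>w n\<close> has the single nonzero coordinate \<open>s * \<xi>\<close>, so the evaluations
  do not depend on \<open>n \<ge> m\<close>.\<close>

lemma \<phi>_power_sum: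
  assumes N: "p + 2 \<le> real N"
  shows "\<phi> (restrict (power_sum N {m..}) (lp_ball p)) = (of_real s * \<xi>) ^ N"
proof (rule \<phi>_eqI'[OF Au_power_sum[OF p1 N] eventually_mono[OF ev_ge[of m]] tendsto_const])
  fix n assume n: "m \<le> n"
  have N0: "0 < N" using N p by (cases N) auto
  let ?t = "\<lambda>j. of_real (1 - 1 / real (j + 2)) :: complex"
  have "(\<lambda>j. 1 / real (j + 2)) \<longlonglongrightarrow> 0"
    using LIMSEQ_ignore_initial_segment[OF lim_1_over_n, of 2] by simp
  then have "(\<lambda>j. ?t j ^ N * (of_real s * \<xi>) ^ N) \<longlonglongrightarrow> of_real (1 - 0) ^ N * (of_real s * \<xi>) ^ N"
    by (intro tendsto_intros)
  moreover have "power_sum N {m..} (radial j (w n)) = ?t j ^ N * (of_real s * \<xi>) ^ N" for j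
    unfolding radial_def using power_sum_w[of n "{m..}" N] n N0
    by (subst power_sum_scale) (auto simp: sums_iff power_sum_def)
  ultimately show "delta p (w n) (restrict (power_sum N {m..}) (lp_ball p)) = (of_real s * \<xi>) ^ N"
    using radial_ball[OF p1 w_lp[OF n] w_norm[OF n]]
    by (intro delta_eqI[OF p1 Au_power_sum[OF p1 N] w_lp[OF n] w_norm[OF n]]) simp
qed

lemma \<phi>_strong_boundary_point: "strong_boundary_point p \<phi>"
  unfolding strong_boundary_point_def
proof (intro conjI \<phi>_spectrum allI impI)
  fix U assume U: "openin (spectrum_topology p) U \<and> \<phi> \<in> U"
  obtain J \<epsilon> where J: "finite J" "J \<subseteq> Au p" "0 < \<epsilon>"
    "\<forall>\<psi>\<in>spectrum p. (\<forall>g\<in>J. norm (\<psi> g - \<phi> g) < \<epsilon>) \<longrightarrow> \<psi> \<in> U"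
    by (rule spectrum_nbhd[OF conjunct1[OF U] conjunct2[OF U]])
  \<comment> \<open>Error budget: \<open>\<epsilon> / 2\<close> here and
    \<open>\<epsilon> / 4\<close> from the uniform continuity of \<open>g\<close> add up to
    \<open>3/4 * \<epsilon>\<close>, strictly below \<open>\<epsilon>\<close>.\<close>
  define A where "A = {n. m \<le> n \<and> (\<forall>g\<in>J. norm (delta p (w n) g - \<phi> g) < \<epsilon> / 2)}"
  have "eventually (\<lambda>n. norm (delta p (w n) g - \<phi> g) < \<epsilon> / 2) F" if "g \<in> J" for g
    using tendstoD[OF \<phi>_tendsto, of g "\<epsilon> / 2"] that J(2,3) by (auto simp: dist_norm)
  then have evA: "eventually (\<lambda>n. n \<in> A) F"
    unfolding A_def mem_Collect_eq using J(1) ev_ge[of m]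
    by (intro eventually_conj eventually_ball_finite) auto
  then have A: "A \<subseteq> {m..}" "A \<noteq> {}"
    using eventually_happens'[OF F(1) evA] by (auto simp: A_def)
  obtain N :: nat where N: "p + 2 \<le> real N" using real_arch_simple by blast
  then have N': "p + 2 \<le> real (Suc N)" "p < real N" "p \<le> real N" "p \<le> real (Suc N)" "0 < N"
    using p by (auto intro: gr0I)
  define P where "P x = (peak N A x + peak (Suc N) A x) / 2" for x
  define f where "f = (\<lambda>x\<in>lp_ball p. 1/2 * restrict (peak N A) (lp_ball p) x
    + 1/2 * restrict (peak (Suc N) A) (lp_ball p) x)"
  \<comment> \<open>\<open>f\<close> may have modulus near 1 with another argument. After averaging
    with 1, modulus near 1 is possible only where \<open>f\<close> itself is near 1.\<close>
  define h where "h = (\<lambda>x\<in>lp_ball p. 1/2 * f x + 1/2)"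
  have f: "f \<in> Au p" unfolding f_def by (intro Au_combo Au_peak p1 N N')
  have h: "h \<in> Au p" unfolding h_def by (intro Au_affine p1 f)
  have fP: "f x = P x" if "x \<in> lp_ball p" for x using that by (simp add: f_def P_def)
  have f_le: "norm (f x) \<le> 1" if "x \<in> lp_ball p" for x
    using norm_triangle_ineq[of "peak N A x" "peak (Suc N) A x"]
      peak_norm_le_1[OF that N'(3) A(1)] peak_norm_le_1[OF that N'(4) A(1)]
    by (simp add: fP[OF that] P_def norm_divide)
  have h_le: "norm (h x) \<le> 1" if "x \<in> lp_ball p" for x
    using norm_triangle_ineq[of "1/2 * f x" "1/2"] f_le[OF that] that by (simp add: h_def norm_mult)
  have h_radial: "(\<lambda>j. h (radial j (w n))) \<longlonglongrightarrow> 1" if "n \<in> A" for n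
  proof -
    have n: "m \<le> n" using that A by auto
    have "(\<lambda>j. 1/2 * ((peak N A (radial j (w n)) + peak (Suc N) A (radial j (w n))) / 2) + 1/2)
        \<longlonglongrightarrow> 1/2 * ((1 + 1) / 2) + 1/2"
      by (intro tendsto_intros peak_radial that A N') auto
    then show ?thesis
      using radial_ball[OF p1 w_lp[OF n] w_norm[OF n]] by (simp add: h_def fP P_def)
  qed
  have "\<phi> h = 1"
  proof (rule \<phi>_eqI'[OF h eventually_mono[OF evA] tendsto_const])
    fix n assume n: "n \<in> A"
    then have "m \<le> n" using A by auto
    then show "delta p (w n) h = 1"
      using delta_eqI[OF p1 h w_lp w_norm h_radial[OF n]] by simp
  qed
  \<comment> \<open>The supremum 1 is approached along the radius towards any \<open>w n\<close>
    with \<open>n\<close> in \<open>A\<close>.\<close>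
  moreover have "Au_norm p h = 1"
    unfolding Au_norm_def
  proof (rule cSup_eq_non_empty)
    show "(\<lambda>x. norm (h x)) ` lp_ball p \<noteq> {}" using lp_ball_zero by blast
    show "y \<le> 1" if "y \<in> (\<lambda>x. norm (h x)) ` lp_ball p" for y using that h_le by auto
    fix y assume y: "\<And>u. u \<in> (\<lambda>x. norm (h x)) ` lp_ball p \<Longrightarrow> u \<le> y"
    obtain n where n: "n \<in> A" using A by blast
    then have "m \<le> n" using A by auto
    then have "norm (h (radial j (w n))) \<le> y" for j
      using y radial_ball[OF p1 w_lp w_norm] by blast
    then show "1 \<le> y"
      using tendsto_upperbound[OF tendsto_norm[OF h_radial[OF n]], of y] by simp
  qed
  moreover have "norm (\<psi> h) < 1" if \<psi>: "\<psi> \<in> spectrum p - U" for \<psi>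
  proof (rule ccontr)
    assume "\<not> norm (\<psi> h) < 1"
    have \<psi>s: "\<psi> \<in> spectrum p" using \<psi> by simp
    have \<psi>h: "\<psi> h = 1/2 * \<psi> f + 1/2" unfolding h_def by (rule spectrum_affine[OF p1 \<psi>s f])
    have \<psi>f_le: "norm (\<psi> f) \<le> 1" by (rule spectrum_norm_le[OF p1 \<psi>s f f_le])
    have "(1::real)\<^sup>2 \<le> (norm (\<psi> h))\<^sup>2" using \<open>\<not> norm (\<psi> h) < 1\<close> by (intro power_mono) auto
    \<comment> \<open>The parallelogram bound is used with
      \<open>\<eta> = |\<psi> f - 1|\<close>.\<close>
    then have "(norm (\<psi> f - 1))\<^sup>2 / 4 \<le> 0"
      using half_add_1_norm_le[OF \<psi>f_le order_refl norm_ge_zero] unfolding \<psi>h power_one by linarith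
    then have "\<psi> f = 1" by simp
    then have \<psi>h1: "\<psi> h = 1" by (simp add: \<psi>h)
    have "norm (\<psi> g - \<phi> g) < \<epsilon>" if g: "g \<in> J" for g
    proof -
      have gA: "g \<in> Au p" using g J(2) by blast
      obtain \<delta> where \<delta>: "0 < \<delta>"
        "\<And>w x. w \<in> lp p \<Longrightarrow> lp_norm p w = 1 \<Longrightarrow> x \<in> lp_ball p \<Longrightarrow> lp_dist p x w < \<delta> \<Longrightarrow>
           norm (g x - delta p w g) \<le> \<epsilon> / 4"
        using J(3) by (auto intro: delta_uniform_approx[OF p1 gA, of "\<epsilon> / 4"])
      obtain \<eta> where \<eta>: "0 < \<eta>"
        "\<forall>x\<in>lp_ball p. norm (P x - 1) < \<eta> \<longrightarrow> (\<exists>n\<in>A. lp_dist p x (w n) < \<delta>)"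
        unfolding P_def by (rule near_peak[OF N'(2) A \<delta>(1)])
      \<comment> \<open>\<open>q\<close> bounds \<open>|h|^2\<close> where \<open>P\<close> is at
        distance at least \<open>\<eta>\<close> from 1; the maximum with 0 keeps it nonnegative for
        large \<open>\<eta>\<close>.\<close>
      define q where "q = max 0 (1 - \<eta>\<^sup>2 / 4)"
      have q: "0 \<le> q" "q < 1" using \<eta>(1) by (auto simp: q_def)
      define g' where "g' = (\<lambda>x\<in>lp_ball p. 1 * g x + (- \<phi> g))"
      have g': "g' \<in> Au p" unfolding g'_def by (intro Au_affine p1 gA)
      obtain C where C: "0 < C" "\<And>x. x \<in> lp_ball p \<Longrightarrow> norm (g' x) \<le> C"
        using Au_bounded[OF p1 g'] by blast
      have "0 < 3/4 * \<epsilon> / C" using C(1) J(3) by simp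
      then obtain k where k: "q ^ k < 3/4 * \<epsilon> / C" using real_arch_pow_inv[OF _ q(2)] by blast
      \<comment> \<open>The exponent is \<open>2 * k\<close> because \<open>q\<close> bounds the
        square of \<open>|h|\<close>. Since \<open>\<psi> h = 1\<close>, the extra factor suppresses
        \<open>g'\<close> away from the peak without changing its value under
        \<open>\<psi>\<close>.\<close>
      define v where "v = (\<lambda>x\<in>lp_ball p. (\<lambda>x\<in>lp_ball p. h x ^ (2 * k)) x * g' x)"
      have v: "v \<in> Au p" unfolding v_def by (intro Au_mult Au_power p1 h g')
      have v_le: "norm (v x) \<le> 3/4 * \<epsilon>" if x: "x \<in> lp_ball p" for x
      proof (cases "norm (P x - 1) < \<eta>")
        case True
        then obtain n where n: "n \<in> A" "lp_dist p x (w n) < \<delta>" using \<eta>(2) x by blast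
        have mn: "m \<le> n" using n A by auto
        have "norm (g x - delta p (w n) g) \<le> \<epsilon> / 4"
          by (rule \<delta>(2)[OF w_lp[OF mn] w_norm[OF mn] x n(2)])
        moreover have "norm (delta p (w n) g - \<phi> g) < \<epsilon> / 2"
          using n(1) g by (simp add: A_def)
        ultimately have "norm (g' x) \<le> 3/4 * \<epsilon>"
          using norm_triangle_ineq[of "g x - delta p (w n) g" "delta p (w n) g - \<phi> g"] x
          by (simp add: g'_def)
        moreover have "norm (h x) ^ (2 * k) \<le> 1" using h_le[OF x] by (intro power_le_one) auto
        ultimately show ?thesis
          using x mult_mono[of "norm (h x) ^ (2 * k)" 1 "norm (g' x)" "3/4 * \<epsilon>"]
          by (simp add: v_def norm_mult norm_power)
      next
        case False
        then have "(norm (h x))\<^sup>2 \<le> q"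
          using half_add_1_norm_le[OF f_le[OF x], of \<eta>] \<eta>(1) x
          by (simp add: h_def fP q_def)
        then have "norm (h x) ^ (2 * k) \<le> q ^ k"
          unfolding power_mult by (intro power_mono) auto
        then have "norm (h x) ^ (2 * k) * norm (g' x) \<le> q ^ k * C"
          using C(2)[OF x] q(1) by (intro mult_mono) auto
        also have "\<dots> \<le> 3/4 * \<epsilon>" using k C(1) by (simp add: field_simps)
        finally show ?thesis using x by (simp add: v_def norm_mult norm_power)
      qed
      have "\<psi> v = \<psi> g - \<phi> g"
        unfolding v_def spectrum_mult[OF \<psi>s Au_power[OF p1 h] g'] spectrum_power[OF p1 \<psi>s h] \<psi>h1
        unfolding g'_def spectrum_affine[OF p1 \<psi>s gA] by simp
      then have "norm (\<psi> g - \<phi> g) \<le> 3/4 * \<epsilon>"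
        using spectrum_norm_le[OF p1 \<psi>s v v_le] by simp
      then show ?thesis using J(3) by simp
    qed
    then have "\<psi> \<in> U" using J(4) \<psi>s by blast
    then show False using \<psi> by simp
  qed
  ultimately show "\<exists>f\<in>Au p. Au_norm p f = 1 \<and> \<phi> f = 1 \<and> (\<forall>\<psi>\<in>spectrum p - U. norm (\<psi> f) < 1)"
    using h by blast
qed

end

section \<open>Continuum many characters and the conclusion\<close>

lemma real_lepoll_unit_circle: "(UNIV :: real set) \<lesssim> {\<xi>::complex. norm \<xi> = 1}"
proof -
  \<comment> \<open>The Cayley transform, which maps the real line injectively into the
    circle.\<close>
  define h where "h t = (1 + \<i> * of_real t) / (1 - \<i> * of_real t)" for t :: real
  have nz: "1 - \<i> * of_real t \<noteq> 0" for t :: real by (simp add: complex_eq_iff)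
  have "inj h"
  proof (rule injI)
    fix t u assume "h t = h u"
    then have "(1 + \<i> * of_real t) * (1 - \<i> * of_real u) = (1 + \<i> * of_real u) * (1 - \<i> * of_real t)"
      using nz by (simp add: h_def frac_eq_eq)
    then show "t = u" by (simp add: complex_eq_iff)
  qed
  moreover have "norm (h t) = 1" for t
  proof -
    have "norm (1 + \<i> * of_real t) = norm (cnj (1 + \<i> * of_real t))" by (rule complex_mod_cnj[symmetric])
    then have "norm (1 + \<i> * of_real t) = norm (1 - \<i> * of_real t)" by simp
    then show ?thesis using nz[of t] by (simp add: h_def norm_divide)
  qed
  ultimately show ?thesis unfolding lepoll_def by blast
qed

theorem theorem3p16:
  fixes p r s :: real and m :: nat and z :: "nat \<Rightarrow> complex"
  assumes "1 < p"
    and "z \<in> lp_ball p"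
    and "{k. z k \<noteq> 0} \<subseteq> {..<m}"
    and "r = lp_norm p z"
    and "r powr p \<in> \<rat>"
    and "s = (1 - r powr p) powr (1 / p)"
  shows "(UNIV :: real set) \<lesssim> {\<phi> \<in> fiber p z. strong_boundary_point p \<phi>} \<and>
    (\<exists>\<phi> :: complex \<Rightarrow> ((nat \<Rightarrow> complex) \<Rightarrow> complex) \<Rightarrow> complex.
       (\<forall>\<xi>. norm \<xi> = 1 \<longrightarrow>
          strong_boundary_point p (\<phi> \<xi>) \<and>
          \<phi> \<xi> \<in> wstar_ac p {m..} (\<lambda>n. delta p (\<lambda>k. z k + complex_of_real s * \<xi> * lp_unit n k)) \<inter> fiber p z) \<and>
       inj_on \<phi> {\<xi>. norm \<xi> = 1})"
proof -
  have p0: "0 < p" using assms(1) by simp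
  have supp: "z k = 0" if "m \<le> k" for k using assms(3) that by force
  have zl: "z \<in> lp p" and r: "0 \<le> r" "r < 1"
    using assms(2,4) by (auto simp: lp_ball_def lp_norm_nonneg)
  have "lp_tail p m z = 0"
    unfolding lp_tail_def using supp by (simp add: if_distrib cong: if_cong)
  then have R: "r powr p = (\<Sum>k<m. norm (z k) powr p)"
    using lp_norm_powr[OF zl p0] lp_head_tail[OF zl, of m] assms(4) by simp
  have r1: "r powr p < 1" using r p0 powr_less_mono2[of p r 1] by simp
  then have s: "0 < s" and sp: "s powr p = 1 - r powr p"
    using assms(6) p0 by (auto simp: powr_powr)
  obtain F :: "nat filter" where F: "F \<noteq> bot" "F \<le> sequentially"
    "\<forall>P. eventually P F \<or> eventually (\<lambda>n. \<not> P n) F"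
    by (rule free_ultrafilter_exists)
  \<comment> \<open>The same \<open>F\<close> is used for every \<open>\<xi>\<close>; distinctness
    comes from the values on power sums.\<close>
  define \<phi> where "\<phi> \<xi> = limit_character p F (peak_data.w s z \<xi>)" for \<xi>
  have loc: "peak_ultrafilter p s m z \<xi> F" if "norm \<xi> = 1" for \<xi>
    by unfold_locales (use assms(1) supp s sp R that F in auto)
  have main: "strong_boundary_point p (\<phi> \<xi>) \<and>
      \<phi> \<xi> \<in> wstar_ac p {m..} (\<lambda>n. delta p (\<lambda>k. z k + complex_of_real s * \<xi> * lp_unit n k)) \<inter> fiber p z"
    if "norm \<xi> = 1" for \<xi>
  proof -
    interpret peak_ultrafilter p s m z \<xi> F by (rule loc[OF that])
    show ?thesis
      using \<phi>_strong_boundary_point \<phi>_ac \<phi>_fiber by (simp add: \<phi>_def w_def)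
  qed
  have inj: "inj_on \<phi> {\<xi>. norm \<xi> = 1}"
  proof (rule inj_onI)
    fix \<xi> \<zeta> :: complex assume n: "\<xi> \<in> {\<xi>. norm \<xi> = 1}" "\<zeta> \<in> {\<xi>. norm \<xi> = 1}" and eq: "\<phi> \<xi> = \<phi> \<zeta>"
    obtain N :: nat where N: "p + 2 \<le> real N" using real_arch_simple by blast
    \<comment> \<open>One exponent determines \<open>\<xi>\<close> only up to a root of unity; two
      consecutive exponents determine it by cancellation.\<close>
    have pw: "\<xi> ^ M = \<zeta> ^ M" if M: "p + 2 \<le> real M" for M
    proof -
      have "(of_real s * \<xi>) ^ M = (of_real s * \<zeta>) ^ M"
        using peak_ultrafilter.\<phi>_power_sum[OF loc M, of \<xi>] peak_ultrafilter.\<phi>_power_sum[OF loc M, of \<zeta>]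
          n eq unfolding \<phi>_def by simp
      then show ?thesis using s by (simp add: power_mult_distrib)
    qed
    have "\<xi> \<noteq> 0" "\<zeta> \<noteq> 0" using n by auto
    then show "\<xi> = \<zeta>" using pw[of N] pw[of "Suc N"] N by simp
  qed
  have "{\<xi>::complex. norm \<xi> = 1} \<lesssim> {\<phi> \<in> fiber p z. strong_boundary_point p \<phi>}"
    unfolding lepoll_def using inj main by blast
  with real_lepoll_unit_circle have "(UNIV :: real set) \<lesssim> {\<phi> \<in> fiber p z. strong_boundary_point p \<phi>}"
    by (rule lepoll_trans)
  with main inj show ?thesis by blast
qed

end
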